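(* Let $0<s<1$ and let $\varepsilon>0$. Then there is a function $C=C_{s,\varepsilon}:[0,\infty)\to(0,\infty)$ such that for every $u_0\in H^s(\mathbb{R})$, the global solution $u$ of the focusing cubic nonlinear Schrödinger equation $$ i u_t+u_{xx}=-|u|^2u,\qquad u(x,0)=u_0(x),\qquad (x,t)\in\mathbb{R}\times\mathbb{R}, $$ satisfies $$ \|u(t)\|_{H^s}\le C(\|u_0\|_{H^s})\,(1+|t|)^{2s+\varepsilon}\qquad\text{for all } t\in\mathbb{R}. $$
   Context: $u:\mathbb{R}\times\mathbb{R}\to\mathbb{C}$ is complex-valued and $H^s=H^s(\mathbb{R})$ is the $L^2$-based Sobolev space in $x$. It is known that the Cauchy problem is globally well-posed in $H^s(\mathbb{R})$ for every $s\ge 0$; "the global solution" is the solution $u\in C(\mathbb{R};H^s(\mathbb{R}))$ given by this well-posedness theory (for general data it is the limit, in $C([-T,T];H^s)$ for every $T$, of the smooth solutions arising from smooth rapidly decreasing data converging to $u_0$ in $H^s$). *)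

theory Defs
  imports "HOL-Analysis.Analysis"
begin

section \<open>The space \<open>L\<^sup>2\<close> and its Fourier transform\<close>

text \<open>Elements of \<open>L\<^sup>2\<close> and of \<open>H\<^sup>s\<close> are handled through Borel representatives; every notion
  below is invariant under changes on null sets.\<close>

definition L2 :: "(real \<Rightarrow> complex) set" where
  "L2 = {f \<in> borel_measurable lborel. integrable lborel (\<lambda>x. (norm (f x))\<^sup>2)}"

definition truncated_fourier :: "real \<Rightarrow> (real \<Rightarrow> complex) \<Rightarrow> real \<Rightarrow> complex" where
  "truncated_fourier R f \<xi> =
     complex_of_real (1 / sqrt (2 * pi)) * (LINT x:{-R..R}|lborel. cis (- (x * \<xi>)) * f x)"

text \<open>Plancherel: \<open>g\<close> is the unitary Fourier transform of \<open>f \<in> L\<^sup>2\<close> if it is the limit in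
  \<open>L\<^sup>2\<close> of the transforms of the truncations of \<open>f\<close>. The nonnegative Lebesgue integral is used because,
  unlike the Bochner integral, it does not vanish on non-integrable functions.\<close>

definition is_fourier_L2 :: "(real \<Rightarrow> complex) \<Rightarrow> (real \<Rightarrow> complex) \<Rightarrow> bool" where
  "is_fourier_L2 f g \<longleftrightarrow> g \<in> L2 \<and>
     ((\<lambda>R. \<integral>\<^sup>+ \<xi>. ennreal ((norm (truncated_fourier R f \<xi> - g \<xi>))\<^sup>2) \<partial>lborel) \<longlongrightarrow> 0) at_top"

text \<open>For \<open>f \<in> L\<^sup>2\<close> such a \<open>g\<close> exists and is unique up to null sets.\<close>

definition fourier_L2 :: "(real \<Rightarrow> complex) \<Rightarrow> real \<Rightarrow> complex" where
  "fourier_L2 f = (SOME g. is_fourier_L2 f g)"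


section \<open>Sobolev spaces\<close>

definition sobolev_space :: "real \<Rightarrow> (real \<Rightarrow> complex) set" where
  "sobolev_space s = {f \<in> L2.
     integrable lborel (\<lambda>\<xi>. (1 + \<xi>\<^sup>2) powr s * (norm (fourier_L2 f \<xi>))\<^sup>2)}"

text \<open>Only meaningful on \<^term>\<open>sobolev_space s\<close>.\<close>

definition sobolev_norm :: "real \<Rightarrow> (real \<Rightarrow> complex) \<Rightarrow> real" where
  "sobolev_norm s f =
     sqrt (LINT \<xi>|lborel. (1 + \<xi>\<^sup>2) powr s * (norm (fourier_L2 f \<xi>))\<^sup>2)"


section \<open>The focusing cubic nonlinear Schroedinger equation\<close>

text \<open>The class \<open>C\<^sup>\<infinity>(\<real>; \<S>(\<real>))\<close> of flows \<open>v t x\<close>: here \<open>D j m\<close> is the derivative of \<open>v\<close> of order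
  \<open>j\<close> in \<open>t\<close> and \<open>m\<close> in \<open>x\<close>, and all of them decay rapidly in \<open>x\<close>, locally uniformly in \<open>t\<close>.
  In particular \<open>v t\<close> is a Schwartz function for every \<open>t\<close>. The decay requirement also singles out
  the solution of the equation with given Schwartz data.\<close>

definition schwartz_flow :: "(real \<Rightarrow> real \<Rightarrow> complex) \<Rightarrow> bool" where
  "schwartz_flow v \<longleftrightarrow> (\<exists>D :: nat \<Rightarrow> nat \<Rightarrow> real \<Rightarrow> real \<Rightarrow> complex.
     D 0 0 = v \<and>
     (\<forall>j m t x. ((\<lambda>\<tau>. D j m \<tau> x) has_vector_derivative D (Suc j) m t x) (at t)) \<and>
     (\<forall>j m t x. ((\<lambda>y. D j m t y) has_vector_derivative D j (Suc m) t x) (at x)) \<and>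
     (\<forall>j m k T. \<exists>M. \<forall>t\<in>{-T..T}. \<forall>x. \<bar>x\<bar> ^ k * norm (D j m t x) \<le> M))"

definition schwartz_nls_solution :: "(real \<Rightarrow> real \<Rightarrow> complex) \<Rightarrow> bool" where
  "schwartz_nls_solution v \<longleftrightarrow> schwartz_flow v \<and>
     (\<forall>t x. \<i> * vector_derivative (\<lambda>\<tau>. v \<tau> x) (at t)
            + vector_derivative (\<lambda>y. vector_derivative (\<lambda>z. v t z) (at y)) (at x)
          = - (complex_of_real ((norm (v t x))\<^sup>2) * v t x))"

definition continuous_sobolev_flow :: "real \<Rightarrow> (real \<Rightarrow> real \<Rightarrow> complex) \<Rightarrow> bool" where
  "continuous_sobolev_flow s u \<longleftrightarrow> (\<forall>t. u t \<in> sobolev_space s) \<and>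
     (\<forall>t. ((\<lambda>\<tau>. sobolev_norm s (\<lambda>x. u \<tau> x - u t x)) \<longlongrightarrow> 0) (at t))"

text \<open>The global solution in \<open>C(\<real>; H\<^sup>s)\<close> given by the well-posedness theory: the limit, in
  \<open>C([-T,T]; H\<^sup>s)\<close> for every \<open>T\<close>, of smooth solutions \<open>v n\<close> whose Schwartz data \<open>v n 0\<close> converge
  to \<open>u0\<close> in \<open>H\<^sup>s\<close>. The limit does not depend on the approximating sequence.\<close>

definition nls_global_solution ::
    "real \<Rightarrow> (real \<Rightarrow> complex) \<Rightarrow> (real \<Rightarrow> real \<Rightarrow> complex) \<Rightarrow> bool" where
  "nls_global_solution s u0 u \<longleftrightarrow>
     continuous_sobolev_flow s u \<and>
     (AE x in lborel. u 0 x = u0 x) \<and>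
     (\<exists>v :: nat \<Rightarrow> real \<Rightarrow> real \<Rightarrow> complex.
        (\<forall>n. schwartz_nls_solution (v n)) \<and>
        (\<lambda>n. sobolev_norm s (\<lambda>x. v n 0 x - u0 x)) \<longlonglongrightarrow> 0 \<and>
        (\<forall>T>0. \<forall>e>0. \<forall>\<^sub>F n in sequentially.
           \<forall>t\<in>{-T..T}. sobolev_norm s (\<lambda>x. v n t x - u t x) < e))"

end

theory Submission
  imports Defs "HOL-Probability.Probability" "HOL-Real_Asymp.Real_Asymp"
begin

text \<open>The cubic Schroedinger equation on the line is completely integrable, and its solutions stay bounded
in \<open>H\<^sup>s\<close>, uniformly in time, for \<open>0 < s < 1\<close>. Since \<open>(1 + \<bar>t\<bar>) powr (2 * s + \<epsilon>) \<ge> 1\<close>, a bound that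
depends only on the initial norm gives the claim.

The Lax pair of the equation contains a spectral parameter \<open>\<kappa> > 0\<close>. The quotient \<open>w\<close> of the two components
of its solution that decays at \<open>-\<infinity>\<close> satisfies the Riccati equation
\<open>w' = - 2 \<kappa> w - v - (1/2) (cnj v) w\<^sup>2\<close>, in which time is a parameter. The density \<open>(cnj v) w\<close> obeys a local
conservation law, so that \<open>A = \<integral> (cnj v) w\<close> is constant in time (\<open>riccati_invariant_conserved\<close>). To first order
\<open>w\<close> is \<open>- (d/dx + 2 \<kappa>)\<inverse> v\<close>, and Plancherel's identity turns \<open>\<parallel>v\<parallel>\<^sup>2 + 2 \<kappa> Re A\<close> into
\<open>E = \<integral> \<xi>\<^sup>2 / (4 \<kappa>\<^sup>2 + \<xi>\<^sup>2) |v^|\<^sup>2 d\<xi>\<close>, where \<open>v^\<close> is the Fourier transform, up to terms of order four and higher in \<open>v\<close>.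

With \<open>M\<close> a bound for the conserved \<open>L\<^sup>2\<close> norm and \<open>\<kappa>\<close> large compared with \<open>M\<^sup>2\<close>, these terms are at most
\<open>E / 2 + M ^ 6 / (2 \<kappa>\<^sup>2)\<close> (\<open>riccati_energy_estimate\<close>): the first summand can be absorbed, and so
\<open>E(t) \<le> 3 E(0) + 2 M ^ 6 / \<kappa>\<^sup>2\<close> for all times. This inequality is multiplied by \<open>\<kappa> powr (2 s - 1)\<close> and integrated
over all \<open>\<kappa>\<close> above a threshold. As \<open>\<integral>\<^sub>0\<^sup>\<infinity> \<kappa> powr (2 s - 1) \<xi>\<^sup>2 / (4 \<kappa>\<^sup>2 + \<xi>\<^sup>2) d\<kappa>\<close> is a constant times \<open>|\<xi>| powr (2 s)\<close> when
\<open>0 < s < 1\<close>, this controls the high frequencies in \<open>H\<^sup>s\<close>, and the error stays finite because \<open>\<kappa> powr (2 s - 3)\<close> is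
integrable at infinity for \<open>s < 1\<close>. The low frequencies are controlled by the mass. The result is
\<open>schwartz_solution_bound\<close>.

General data are reached by approximation. This uses that the \<open>L\<^sup>2\<close> Fourier transform exists and is linear up to
null sets, which follows from Bessel's inequality for truncated functions and the completeness argument in
\<open>is_fourier_L2_exists\<close>.\<close>

section \<open>Continuous functions of quadratic decay\<close>

text \<open>Quadratic decay suffices for integrability and for the vanishing of boundary terms, and it is inherited
by products with bounded functions and by the resolvent of \<open>d/dx + 2 \<kappa>\<close>. So one class contains the solution at a
fixed time, the Riccati function and every error term.\<close>

definition decaying :: "(real \<Rightarrow> complex) \<Rightarrow> bool" where
  "decaying f \<longleftrightarrow> continuous_on UNIV f \<and> (\<exists>C. \<forall>x. norm (f x) \<le> C / (1 + x\<^sup>2))"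

lemma decayingI:
  assumes "continuous_on UNIV f" "\<And>x. norm (f x) \<le> C / (1 + x\<^sup>2)"
  shows "decaying f"
  using assms by (auto simp: decaying_def)

lemma decayingE:
  assumes "decaying f"
  obtains C where "C \<ge> 0" "continuous_on UNIV f" "\<And>x. norm (f x) \<le> C / (1 + x\<^sup>2)" "\<And>x. norm (f x) \<le> C"
proof -
  obtain C where C: "\<And>x. norm (f x) \<le> C / (1 + x\<^sup>2)" and c: "continuous_on UNIV f"
    using assms by (auto simp: decaying_def)
  have C0: "C \<ge> 0" using order_trans[OF norm_ge_zero C[of 0]] by simp
  moreover have "norm (f x) \<le> C" for x
  proof -
    have "C / (1 + x\<^sup>2) \<le> C / 1" using C0 by (intro divide_left_mono) (auto simp: add_pos_nonneg)
    then show ?thesis using C[of x] by simp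
  qed
  ultimately show ?thesis using that C c by blast
qed

lemma decaying_bounded_ex: "decaying f \<Longrightarrow> continuous_on UNIV f \<and> (\<exists>C. \<forall>x. norm (f x) \<le> C)"
  by (auto elim!: decayingE)

lemma decaying_continuous: "decaying f \<Longrightarrow> continuous_on UNIV f"
  by (simp add: decaying_def)

lemma continuous_borel_measurable: "continuous_on UNIV (f :: real \<Rightarrow> 'a::real_normed_vector) \<Longrightarrow> f \<in> borel_measurable borel"
  by (rule borel_measurable_continuous_onI)

lemma decaying_measurable: "decaying f \<Longrightarrow> f \<in> borel_measurable borel"
  by (intro continuous_borel_measurable decaying_continuous)

lemma integrable_decay_weight: "integrable lborel (\<lambda>x::real. 1 / (1 + x\<^sup>2))"
  using integrable_inverse_1_plus_square
  by (simp add: set_integrable_def inverse_eq_divide)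

lemma decaying_integrable:
  assumes "decaying f" shows "integrable lborel f"
proof -
  obtain C where C: "\<And>x. norm (f x) \<le> C / (1 + x\<^sup>2)" "C \<ge> 0" using decayingE[OF assms] by metis
  show ?thesis
  proof (rule Bochner_Integration.integrable_bound)
    show "integrable lborel (\<lambda>x. C * (1 / (1 + x\<^sup>2)))" by (intro integrable_mult_right integrable_decay_weight)
    show "f \<in> borel_measurable lborel" using decaying_measurable[OF assms] by simp
    show "AE x in lborel. norm (f x) \<le> norm (C * (1 / (1 + x\<^sup>2)))" using C by (auto simp: abs_mult add_nonneg_nonneg)
  qed
qed

lemma decaying_mult_bounded:
  assumes "decaying f" "continuous_on UNIV g" "\<And>x. norm (g x) \<le> B"
  shows "decaying (\<lambda>x. f x * g x)"
proof -
  obtain C where C: "C \<ge> 0" "continuous_on UNIV f" "\<And>x. norm (f x) \<le> C / (1 + x\<^sup>2)"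
    using decayingE[OF assms(1)] by metis
  show ?thesis
  proof (rule decayingI)
    show "continuous_on UNIV (\<lambda>x. f x * g x)" by (intro continuous_intros C assms)
    fix x
    have "norm (f x * g x) \<le> (C / (1 + x\<^sup>2)) * B"
      unfolding norm_mult by (intro mult_mono C assms) (use C in \<open>auto simp: add_nonneg_nonneg\<close>)
    then show "norm (f x * g x) \<le> (C * B) / (1 + x\<^sup>2)" by simp
  qed
qed

lemma decaying_mult:
  assumes "decaying f" "decaying g"
  shows "decaying (\<lambda>x. f x * g x)"
  using assms(2) by (rule decayingE) (rule decaying_mult_bounded[OF assms(1)])

lemma decaying_add:
  assumes "decaying f" "decaying g"
  shows "decaying (\<lambda>x. f x + g x)"
proof -
  obtain C where C: "continuous_on UNIV f" "\<And>x. norm (f x) \<le> C / (1 + x\<^sup>2)"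
    using decayingE[OF assms(1)] by metis
  obtain D where D: "continuous_on UNIV g" "\<And>x. norm (g x) \<le> D / (1 + x\<^sup>2)"
    using decayingE[OF assms(2)] by metis
  show ?thesis
  proof (rule decayingI)
    show "continuous_on UNIV (\<lambda>x. f x + g x)" by (intro continuous_intros C D)
    show "norm (f x + g x) \<le> (C + D) / (1 + x\<^sup>2)" for x
      using norm_triangle_mono[OF C(2) D(2), of x x] by (simp add: add_divide_distrib)
  qed
qed

lemma decaying_cmult: "decaying f \<Longrightarrow> decaying (\<lambda>x. c * f x)"
  using decaying_mult_bounded[of f "\<lambda>_. c" "norm c"] by (simp add: mult.commute)

lemma decaying_uminus: "decaying f \<Longrightarrow> decaying (\<lambda>x. - f x)"
  using decaying_cmult[of f "-1"] by simp

lemma decaying_diff: "decaying f \<Longrightarrow> decaying g \<Longrightarrow> decaying (\<lambda>x. f x - g x)"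
  using decaying_add[of f "\<lambda>x. - g x"] decaying_uminus[of g] by simp

lemma decaying_cnj: "decaying f \<Longrightarrow> decaying (\<lambda>x. cnj (f x))"
  unfolding decaying_def by (auto intro!: continuous_intros)

lemma decaying_norm_sq_integrable:
  assumes "decaying f" shows "integrable lborel (\<lambda>x. (norm (f x))\<^sup>2)"
proof -
  have "integrable lborel (\<lambda>x. norm (f x * cnj (f x)))"
    by (intro integrable_norm decaying_integrable decaying_mult decaying_cnj assms)
  then show ?thesis by (simp add: norm_mult power2_eq_square)
qed

lemma inverse_decay_weight_at_infinity:
  "((\<lambda>x::real. C / (1 + x\<^sup>2)) \<longlongrightarrow> 0) at_top" "((\<lambda>x::real. C / (1 + x\<^sup>2)) \<longlongrightarrow> 0) at_bot"
  by real_asymp+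

lemma decaying_tendsto_0:
  assumes "decaying f" shows "(f \<longlongrightarrow> 0) at_top" "(f \<longlongrightarrow> 0) at_bot"
proof -
  obtain C where C: "\<And>x. norm (f x) \<le> C / (1 + x\<^sup>2)"
    using decayingE[OF assms(1)] by metis
  show "(f \<longlongrightarrow> 0) at_top"
    by (rule Lim_null_comparison[OF _ inverse_decay_weight_at_infinity(1)[of C]]) (use C in auto)
  show "(f \<longlongrightarrow> 0) at_bot"
    by (rule Lim_null_comparison[OF _ inverse_decay_weight_at_infinity(2)[of C]]) (use C in auto)
qed

lemma integral_derivative_line:
  fixes F :: "real \<Rightarrow> 'a::euclidean_space"
  assumes "\<And>x. (F has_vector_derivative f x) (at x)" "continuous_on UNIV f" "integrable lborel f"
    and "(F \<longlongrightarrow> 0) at_bot" "(F \<longlongrightarrow> 0) at_top"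
  shows "(LINT x|lborel. f x) = 0"
proof -
  have "(LBINT x=-\<infinity>..\<infinity>. f x) = 0 - 0"
    by (rule interval_integral_FTC_integrable[where F=F])
       (use assms in \<open>auto simp: ereal_tendsto_simps set_integrable_def continuous_on_eq_continuous_at\<close>)
  then show ?thesis by (simp add: interval_lebesgue_integral_def set_lebesgue_integral_def)
qed

lemma integral_derivative_halfline:
  fixes F :: "real \<Rightarrow> 'a::euclidean_space"
  assumes F: "\<And>x. (F has_vector_derivative f x) (at x)" "continuous_on UNIV f" "integrable lborel f"
    and "(F \<longlongrightarrow> 0) at_bot"
  shows "(LINT x:{..a}|lborel. f x) = F a"
proof -
  have "(LBINT x=-\<infinity>..ereal a. f x) = F a - 0"
  proof (rule interval_integral_FTC_integrable[where F=F])
    show "set_integrable lborel (einterval (- \<infinity>) (ereal a)) f"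
      using assms(3) by (auto simp: set_integrable_def intro!: integrable_real_mult_indicator integrable_mult_indicator)
    have "(F \<longlongrightarrow> F a) (at a)"
      using has_vector_derivative_continuous[OF F(1)[of a]] by (simp add: isCont_def)
    then have "(F \<longlongrightarrow> F a) (at_left a)" by (rule filterlim_mono) (auto simp: at_le)
    then show "((F \<circ> real_of_ereal) \<longlongrightarrow> F a) (at_left (ereal a))"
      by (simp add: ereal_tendsto_simps)
  qed (use assms in \<open>auto simp: ereal_tendsto_simps continuous_on_eq_continuous_at\<close>)
  moreover have "(LBINT x=-\<infinity>..ereal a. f x) = (LINT x:{..<a}|lborel. f x)"
    by (simp add: interval_lebesgue_integral_def)
  moreover have "(LINT x:{..<a}|lborel. f x) = (LINT x:{..a}|lborel. f x)"
    unfolding set_lebesgue_integral_def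
    by (rule integral_cong_AE) (use assms(3) AE_lborel_singleton[of a] in \<open>auto split: split_indicator elim!: eventually_mono\<close>)
  ultimately show ?thesis by simp
qed

lemma Cauchy_Schwarz_integral:
  fixes f g :: "'a \<Rightarrow> real"
  assumes [measurable]: "f \<in> borel_measurable M" "g \<in> borel_measurable M"
    and f: "integrable M (\<lambda>x. (f x)\<^sup>2)" and g: "integrable M (\<lambda>x. (g x)\<^sup>2)"
  shows "integrable M (\<lambda>x. f x * g x)"
    and "(LINT x|M. \<bar>f x * g x\<bar>)\<^sup>2 \<le> (LINT x|M. (f x)\<^sup>2) * (LINT x|M. (g x)\<^sup>2)"
proof -
  show i: "integrable M (\<lambda>x. f x * g x)"
  proof (rule Bochner_Integration.integrable_bound[OF Bochner_Integration.integrable_add[OF f g]])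
    show "AE x in M. norm (f x * g x) \<le> norm ((f x)\<^sup>2 + (g x)\<^sup>2)"
    proof (rule AE_I2)
      fix x
      have "2 * (\<bar>f x\<bar> * \<bar>g x\<bar>) \<le> (f x)\<^sup>2 + (g x)\<^sup>2"
        using sum_squares_bound[of "\<bar>f x\<bar>" "\<bar>g x\<bar>"] by simp
      moreover have "0 \<le> \<bar>f x\<bar> * \<bar>g x\<bar>" by simp
      ultimately show "norm (f x * g x) \<le> norm ((f x)\<^sup>2 + (g x)\<^sup>2)"
        unfolding real_norm_def abs_mult by linarith
    qed
  qed simp
  have "(\<integral>\<^sup>+x. ennreal \<bar>f x\<bar> * ennreal \<bar>g x\<bar> \<partial>M)\<^sup>2 \<le> (\<integral>\<^sup>+x. ennreal \<bar>f x\<bar> ^ 2 \<partial>M) * (\<integral>\<^sup>+x. ennreal \<bar>g x\<bar> ^ 2 \<partial>M)"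
    by (rule Cauchy_Schwarz_nn_integral) auto
  moreover have "(\<integral>\<^sup>+x. ennreal \<bar>f x\<bar> * ennreal \<bar>g x\<bar> \<partial>M) = ennreal (LINT x|M. \<bar>f x * g x\<bar>)"
    using integrable_abs[OF i] by (subst nn_integral_eq_integral[symmetric]) (auto simp: ennreal_mult abs_mult)
  moreover have "(\<integral>\<^sup>+x. ennreal \<bar>f x\<bar> ^ 2 \<partial>M) = ennreal (LINT x|M. (f x)\<^sup>2)"
    using f by (subst nn_integral_eq_integral[symmetric]) (auto simp: ennreal_power)
  moreover have "(\<integral>\<^sup>+x. ennreal \<bar>g x\<bar> ^ 2 \<partial>M) = ennreal (LINT x|M. (g x)\<^sup>2)"
    using g by (subst nn_integral_eq_integral[symmetric]) (auto simp: ennreal_power)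
  ultimately show "(LINT x|M. \<bar>f x * g x\<bar>)\<^sup>2 \<le> (LINT x|M. (f x)\<^sup>2) * (LINT x|M. (g x)\<^sup>2)"
    by (simp add: ennreal_power ennreal_mult'[symmetric])
qed

abbreviation mass :: "(real \<Rightarrow> complex) \<Rightarrow> real" where
  "mass f \<equiv> (LINT x|lborel. (norm (f x))\<^sup>2)"

section \<open>The resolvent of a first-order operator\<close>

text \<open>The operator \<open>(d/dx + 2 \<kappa>)\<inverse>\<close>: \<open>resolvent \<kappa> g\<close> is the only bounded solution of \<open>y' + 2 \<kappa> y = g\<close>.\<close>

definition resolvent :: "real \<Rightarrow> (real \<Rightarrow> complex) \<Rightarrow> real \<Rightarrow> complex" where
  "resolvent \<kappa> g x = (LINT y:{0..}|lborel. exp (- (2 * \<kappa> * y)) *\<^sub>R g (x - y))"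

lemma nn_integral_exp_halfline:
  assumes "a > 0" shows "(\<integral>\<^sup>+y. ennreal (exp (- (a * y))) * indicator {0..} y \<partial>lborel) = ennreal (1 / a)"
proof -
  have "(\<integral>\<^sup>+y. ennreal (exp (- (a * y))) * indicator {0..} y \<partial>lborel) = ennreal (0 - (- exp (- (a * 0)) / a))"
  proof (rule nn_integral_FTC_atLeast)
    show "((\<lambda>y. - exp (- (a * y)) / a) \<longlongrightarrow> 0) at_top" using assms by real_asymp
    show "DERIV (\<lambda>y. - exp (- (a * y)) / a) x :> exp (- (a * x))" for x
      using assms by (auto intro!: derivative_eq_intros)
  qed auto
  then show ?thesis by simp
qed

lemma exp_halfline_integrable:
  assumes "a > 0"
  shows "set_integrable lborel {0..} (\<lambda>y::real. exp (- (a * y)))"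
    and "(LINT y:{0..}|lborel. exp (- (a * y))) = 1 / a"
proof -
  have *: "(\<integral>\<^sup>+y. ennreal (indicator {0..} y * exp (- (a * y))) \<partial>lborel) = ennreal (1 / a)"
    using nn_integral_exp_halfline[OF assms] by (simp add: mult.commute ennreal_mult' ennreal_indicator)
  have "has_bochner_integral lborel (\<lambda>y. indicator {0..} y * exp (- (a * y))) (1 / a)"
    by (rule has_bochner_integral_nn_integral) (use assms * in auto)
  then show "set_integrable lborel {0..} (\<lambda>y::real. exp (- (a * y)))"
    and "(LINT y:{0..}|lborel. exp (- (a * y))) = 1 / a"
    by (auto simp: has_bochner_integral_iff set_integrable_def set_lebesgue_integral_def)
qed

lemma resolvent_integrable:
  fixes g :: "real \<Rightarrow> complex"
  assumes "\<kappa> > 0" "continuous_on UNIV g" "\<And>x. norm (g x) \<le> B"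
  shows "set_integrable lborel {0..} (\<lambda>y. exp (- (2 * \<kappa> * y)) *\<^sub>R g (x - y))"
  unfolding set_integrable_def
proof (rule Bochner_Integration.integrable_bound)
  have "integrable lborel (\<lambda>y. indicator {0..} y * exp (- (2 * \<kappa> * y)))"
    using exp_halfline_integrable(1)[of "2 * \<kappa>"] assms by (simp add: set_integrable_def)
  then show "integrable lborel (\<lambda>y. B * (indicator {0..} y * exp (- (2 * \<kappa> * y))))"
    by (rule integrable_mult_right)
  have [measurable]: "g \<in> borel_measurable borel" using assms(2) by (rule continuous_borel_measurable)
  show "(\<lambda>y. indicat_real {0..} y *\<^sub>R exp (- (2 * \<kappa> * y)) *\<^sub>R g (x - y)) \<in> borel_measurable lborel"
    by measurable
  have B: "B \<ge> 0" using assms(3)[of 0] norm_ge_zero order_trans by blast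
  show "AE y in lborel. norm (indicat_real {0..} y *\<^sub>R exp (- (2 * \<kappa> * y)) *\<^sub>R g (x - y)) \<le> norm (B * (indicator {0..} y * exp (- (2 * \<kappa> * y))))"
    using assms(3) B by (auto simp: abs_mult mult.commute intro!: mult_left_mono split: split_indicator)
qed

lemma resolvent_norm_le:
  assumes "\<kappa> > 0" "continuous_on UNIV g" "\<And>x. norm (g x) \<le> B"
  shows "norm (resolvent \<kappa> g x) \<le> (LINT y:{0..}|lborel. exp (- (2 * \<kappa> * y)) * norm (g (x - y)))"
  unfolding resolvent_def set_lebesgue_integral_def
  by (rule order_trans[OF integral_norm_bound]) (simp add: abs_mult mult.assoc)

lemma resolvent_norm_integrable:
  fixes g :: "real \<Rightarrow> complex"
  assumes "\<kappa> > 0" "continuous_on UNIV g" "\<And>x. norm (g x) \<le> B"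
  shows "set_integrable lborel {0..} (\<lambda>y. exp (- (2 * \<kappa> * y)) * norm (g (x - y)))"
  using set_integrable_norm[OF resolvent_integrable[OF assms]] by simp

lemma resolvent_bounded:
  assumes "\<kappa> > 0" "continuous_on UNIV g" "\<And>x. norm (g x) \<le> B"
  shows "norm (resolvent \<kappa> g x) \<le> B / (2 * \<kappa>)"
proof -
  have "norm (resolvent \<kappa> g x) \<le> (LINT y:{0..}|lborel. exp (- (2 * \<kappa> * y)) * norm (g (x - y)))"
    by (rule resolvent_norm_le[OF assms])
  also have "\<dots> \<le> (LINT y:{0..}|lborel. exp (- (2 * \<kappa> * y)) * B)"
    by (rule set_integral_mono[OF resolvent_norm_integrable[OF assms]])
       (use assms exp_halfline_integrable(1)[of "2 * \<kappa>"] in \<open>auto intro!: mult_left_mono\<close>)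
  also have "\<dots> = B / (2 * \<kappa>)" using exp_halfline_integrable(2)[of "2 * \<kappa>"] assms by simp
  finally show ?thesis .
qed

lemma resolvent_eq_halfline:
  "resolvent \<kappa> g x = exp (- (2 * \<kappa> * x)) *\<^sub>R (LINT y:{..x}|lborel. exp (2 * \<kappa> * y) *\<^sub>R g y)"
proof -
  have "(LINT y:{..x}|lborel. exp (2 * \<kappa> * y) *\<^sub>R g y)
      = (LINT y|lborel. indicator {..x} (x + (-1) * y) *\<^sub>R exp (2 * \<kappa> * (x + (-1) * y)) *\<^sub>R g (x + (-1) * y))"
    unfolding set_lebesgue_integral_def by (subst lborel_integral_real_affine[where c="-1" and t=x]) auto
  also have "\<dots> = (LINT y|lborel. exp (2 * \<kappa> * x) *\<^sub>R (indicator {0..} y *\<^sub>R exp (- (2 * \<kappa> * y)) *\<^sub>R g (x - y)))"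
    by (rule Bochner_Integration.integral_cong) (auto split: split_indicator simp: exp_add[symmetric] algebra_simps)
  also have "\<dots> = exp (2 * \<kappa> * x) *\<^sub>R resolvent \<kappa> g x"
    unfolding resolvent_def set_lebesgue_integral_def by (rule integral_scaleR_right)
  finally show ?thesis by (simp add: exp_minus)
qed

lemma resolvent_halfline_integrable:
  fixes g :: "real \<Rightarrow> complex"
  assumes "\<kappa> > 0" "continuous_on UNIV g" "\<And>x. norm (g x) \<le> B"
  shows "set_integrable lborel {..x} (\<lambda>y. exp (2 * \<kappa> * y) *\<^sub>R g y)"
proof -
  have "integrable lborel (\<lambda>y. exp (2 * \<kappa> * x) *\<^sub>R (indicator {0..} y *\<^sub>R exp (- (2 * \<kappa> * y)) *\<^sub>R g (x - y)))"
    using resolvent_integrable[OF assms] unfolding set_integrable_def by (intro integrable_scaleR_right) 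
  also have "(\<lambda>y. exp (2 * \<kappa> * x) *\<^sub>R (indicator {0..} y *\<^sub>R exp (- (2 * \<kappa> * y)) *\<^sub>R g (x - y)))
     = (\<lambda>y. indicator {..x} (x + (-1) * y) *\<^sub>R exp (2 * \<kappa> * (x + (-1) * y)) *\<^sub>R g (x + (-1) * y))"
    by (rule ext) (auto split: split_indicator simp: exp_add[symmetric] algebra_simps)
  finally show ?thesis
    unfolding set_integrable_def by (subst lborel_integrable_real_affine_iff[of "-1" _ x, symmetric]) auto
qed

text \<open>After multiplication by \<open>exp (2 \<kappa> x)\<close> the resolvent becomes the primitive, from \<open>-\<infinity>\<close>, of a continuous function.\<close>

lemma resolvent_has_derivative:
  assumes "\<kappa> > 0" "continuous_on UNIV g" "\<And>x. norm (g x) \<le> B"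
  shows "(resolvent \<kappa> g has_vector_derivative (g x - (2 * \<kappa>) *\<^sub>R resolvent \<kappa> g x)) (at x)"
proof -
  define h where "h y = exp (2 * \<kappa> * y) *\<^sub>R g y" for y
  define I where "I x = (LINT y:{..x}|lborel. h y)" for x
  have ch: "continuous_on UNIV h" unfolding h_def by (intro continuous_intros assms)
  define a where "a = x - 1"
  have I: "I z = I a + integral {a..z} h" if "a \<le> z" for z
  proof -
    have "set_integrable lborel {..z} h" for z
      unfolding h_def by (rule resolvent_halfline_integrable[OF assms])
    note si = this
    have sj: "set_integrable lborel {a..z} h" by (rule set_integrable_subset[OF si[of z]]) auto
    have sk: "set_integrable lborel {a<..z} h" by (rule set_integrable_subset[OF si[of z]]) auto
    have "I z = (LINT y:{..a} \<union> {a<..z}|lborel. h y)" unfolding I_def using that by (simp add: ivl_disj_un)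
    also have "\<dots> = I a + (LINT y:{a<..z}|lborel. h y)"
      unfolding I_def by (rule set_integral_Un) (use si sk in auto)
    also have "(LINT y:{a<..z}|lborel. h y) = (LINT y:{a..z}|lborel. h y)"
      unfolding set_lebesgue_integral_def
      by (rule integral_cong_AE) (use sk sj AE_lborel_singleton[of a] in \<open>auto simp: set_integrable_def split: split_indicator elim!: eventually_mono\<close>)
    also have "\<dots> = integral {a..z} h" by (rule set_borel_integral_eq_integral[OF sj])
    finally show ?thesis .
  qed
  have "((\<lambda>z. integral {a..z} h) has_vector_derivative h x) (at x within {a..x+1})"
    by (rule integral_has_vector_derivative) (auto simp: a_def intro: continuous_on_subset[OF ch])
  then have "((\<lambda>z. integral {a..z} h) has_vector_derivative h x) (at x)"
    by (subst (asm) at_within_interior) (auto simp: a_def)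
  then have "((\<lambda>z. I a + integral {a..z} h) has_vector_derivative h x) (at x)"
    by (auto intro!: derivative_eq_intros)
  then have dI: "(I has_vector_derivative h x) (at x)"
    by (rule has_vector_derivative_transform_within_open[of _ _ _ "{a<..}"]) (auto simp: a_def intro: I[symmetric, unfolded a_def])
  have "((\<lambda>z. exp (- (2 * \<kappa> * z)) *\<^sub>R I z) has_vector_derivative
      (exp (- (2 * \<kappa> * x)) *\<^sub>R h x + (- (2 * \<kappa>) * exp (- (2 * \<kappa> * x))) *\<^sub>R I x)) (at x)"
    by (rule has_vector_derivative_scaleR[OF _ dI]) (auto intro!: derivative_eq_intros)
  moreover have "(\<lambda>z. exp (- (2 * \<kappa> * z)) *\<^sub>R I z) = resolvent \<kappa> g"
    by (rule ext) (simp add: resolvent_eq_halfline I_def h_def)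
  moreover have "exp (- (2 * \<kappa> * x)) *\<^sub>R h x = g x" by (simp add: h_def exp_minus)
  moreover have "exp (- (2 * \<kappa> * x)) *\<^sub>R I x = resolvent \<kappa> g x" by (simp add: resolvent_eq_halfline I_def h_def)
  ultimately show ?thesis by (simp add: scaleR_scaleR[symmetric] del: scaleR_scaleR)
qed

lemma resolvent_continuous:
  assumes "\<kappa> > 0" "continuous_on UNIV g" "\<And>x. norm (g x) \<le> B"
  shows "continuous_on UNIV (resolvent \<kappa> g)"
  using has_vector_derivative_continuous[OF resolvent_has_derivative[OF assms]] by (simp add: continuous_on_eq_continuous_at)

text \<open>The difference of two bounded solutions is a multiple of \<open>exp (- 2 \<kappa> x)\<close>, which is unbounded at \<open>-\<infinity>\<close> unless it
is zero.\<close>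

lemma resolvent_unique:
  assumes \<kappa>: "\<kappa> > 0" and g: "continuous_on UNIV g" "\<And>x. norm (g x) \<le> B"
    and y: "\<And>x. (y has_vector_derivative (g x - (2 * \<kappa>) *\<^sub>R y x)) (at x)" "\<And>x. norm (y x) \<le> D"
  shows "y = resolvent \<kappa> g"
proof -
  define z where "z x = y x - resolvent \<kappa> g x" for x
  have "(z has_vector_derivative (- (2 * \<kappa>) *\<^sub>R z x)) (at x)" for x
    unfolding z_def
    by (rule derivative_eq_intros y resolvent_has_derivative[OF \<kappa> g] refl)+ (simp add: algebra_simps)
  then have "((\<lambda>x. exp (2 * \<kappa> * x) *\<^sub>R z x) has_vector_derivative
      (exp (2 * \<kappa> * x) *\<^sub>R (- (2 * \<kappa>) *\<^sub>R z x) + (2 * \<kappa> * exp (2 * \<kappa> * x)) *\<^sub>R z x)) (at x)" for x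
    by (intro has_vector_derivative_scaleR) (auto intro!: derivative_eq_intros)
  then have "((\<lambda>x. exp (2 * \<kappa> * x) *\<^sub>R z x) has_vector_derivative 0) (at x)" for x
    by (simp add: mult.commute)
  then obtain c where c: "exp (2 * \<kappa> * x) *\<^sub>R z x = c" for x
    using has_vector_derivative_zero_constant[of UNIV "\<lambda>x. exp (2 * \<kappa> * x) *\<^sub>R z x"] by auto
  have zb: "norm (z x) \<le> D + B / (2 * \<kappa>)" for x
    unfolding z_def by (intro norm_triangle_le_diff add_mono y resolvent_bounded[OF \<kappa> g])
  have nc: "norm c \<le> exp (2 * \<kappa> * x) * (D + B / (2 * \<kappa>))" for x
  proof -
    have "norm c = norm (exp (2 * \<kappa> * x) *\<^sub>R z x)" unfolding c ..
    also have "\<dots> = exp (2 * \<kappa> * x) * norm (z x)" by simp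
    also have "\<dots> \<le> exp (2 * \<kappa> * x) * (D + B / (2 * \<kappa>))" by (intro mult_left_mono zb) simp
    finally show ?thesis .
  qed
  have "((\<lambda>x. exp (2 * \<kappa> * x) * (D + B / (2 * \<kappa>))) \<longlongrightarrow> 0 * (D + B / (2 * \<kappa>))) at_bot"
    by (intro tendsto_mult tendsto_const) (use \<kappa> in real_asymp)
  then have "norm c \<le> 0"
    by (intro tendsto_lowerbound[where F=at_bot]) (use nc in auto)
  then have "z x = 0" for x using c[of x] by simp
  then show ?thesis by (auto simp: z_def)
qed

lemma resolvent_add:
  assumes "\<kappa> > 0" "continuous_on UNIV f" "\<And>x. norm (f x) \<le> A" "continuous_on UNIV g" "\<And>x. norm (g x) \<le> B"
  shows "resolvent \<kappa> (\<lambda>x. f x + g x) x = resolvent \<kappa> f x + resolvent \<kappa> g x"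
  unfolding resolvent_def scaleR_add_right
  by (rule set_integral_add[OF resolvent_integrable[OF assms(1-3)] resolvent_integrable[OF assms(1,4,5)]])

lemma resolvent_uminus: "resolvent \<kappa> (\<lambda>x. - f x) x = - resolvent \<kappa> f x"
  unfolding resolvent_def set_lebesgue_integral_def by simp

text \<open>From \<open>1 + x\<^sup>2 \<le> 2 (1 + y\<^sup>2) (1 + (x - y)\<^sup>2)\<close>, decay at \<open>x - y\<close> becomes decay at \<open>x\<close> at the price of a factor \<open>1 + y\<^sup>2\<close>.
Half of the exponential kernel pays for it.\<close>

lemma resolvent_decaying:
  assumes \<kappa>: "\<kappa> > 0" and g: "decaying g"
  shows "decaying (resolvent \<kappa> g)"
proof -
  obtain C where C: "C \<ge> 0" "continuous_on UNIV g" "\<And>x. norm (g x) \<le> C / (1 + x\<^sup>2)" "\<And>x. norm (g x) \<le> C"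
    using decayingE[OF g] by metis
  define D where "D = 2 * C * (1 + 2 / \<kappa>\<^sup>2)"
  have weight: "exp (- (2 * \<kappa> * y)) * norm (g (x - y)) \<le> D / (1 + x\<^sup>2) * exp (- (\<kappa> * y))" if "y \<ge> 0" for x y
  proof -
    have *: "1 + x\<^sup>2 \<le> 2 * (1 + y\<^sup>2) * (1 + (x - y)\<^sup>2)"
    proof -
      have "0 \<le> (x - 2 * y)\<^sup>2 + 2 * (y * (x - y))\<^sup>2 + 1" by simp
      moreover have "2 * (1 + y\<^sup>2) * (1 + (x - y)\<^sup>2) - (1 + x\<^sup>2) = (x - 2 * y)\<^sup>2 + 2 * (y * (x - y))\<^sup>2 + 1"
        by (simp add: power2_eq_square algebra_simps)
      ultimately show ?thesis by linarith
    qed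
    have "1 + \<kappa> * y + (\<kappa> * y)\<^sup>2 / 2 \<le> exp (\<kappa> * y)"
      using that \<kappa> by (intro exp_lower_Taylor_quadratic) simp
    then have e: "1 + \<kappa> * y + (\<kappa> * y)\<^sup>2 / 2 \<le> exp (\<kappa> * y)" .
    have "(1 + 2 / \<kappa>\<^sup>2) * (1 + \<kappa> * y + (\<kappa> * y)\<^sup>2 / 2) \<ge> 1 + y\<^sup>2"
    proof -
      have expand: "(1 + c) * (1 + a + b) - (1 + c * b) = a + b + c * (1 + a)" for a b c :: real
        by (simp add: algebra_simps)
      have "2 / \<kappa>\<^sup>2 * ((\<kappa> * y)\<^sup>2 / 2) = y\<^sup>2" using \<kappa> by (simp add: power_mult_distrib)
      with expand[of "2 / \<kappa>\<^sup>2" "\<kappa> * y" "(\<kappa> * y)\<^sup>2 / 2"]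
      have "(1 + 2 / \<kappa>\<^sup>2) * (1 + \<kappa> * y + (\<kappa> * y)\<^sup>2 / 2) - (1 + y\<^sup>2) = \<kappa> * y + (\<kappa> * y)\<^sup>2 / 2 + 2 / \<kappa>\<^sup>2 * (1 + \<kappa> * y)"
        by simp
      moreover have "\<dots> \<ge> 0" using \<kappa> that by (intro add_nonneg_nonneg mult_nonneg_nonneg) auto
      ultimately show ?thesis by linarith
    qed
    also have "(1 + 2 / \<kappa>\<^sup>2) * (1 + \<kappa> * y + (\<kappa> * y)\<^sup>2 / 2) \<le> (1 + 2 / \<kappa>\<^sup>2) * exp (\<kappa> * y)"
      by (intro mult_left_mono e) (auto simp: add_nonneg_nonneg)
    finally have **: "1 + y\<^sup>2 \<le> (1 + 2 / \<kappa>\<^sup>2) * exp (\<kappa> * y)" .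
    have pos: "0 < 1 + x\<^sup>2" "0 < 1 + (x - y)\<^sup>2" by (simp_all add: add_pos_nonneg)
    have "1 / (1 + (x - y)\<^sup>2) \<le> 2 * (1 + y\<^sup>2) / (1 + x\<^sup>2)"
      using * pos by (simp add: field_simps)
    also have "\<dots> \<le> 2 * ((1 + 2 / \<kappa>\<^sup>2) * exp (\<kappa> * y)) / (1 + x\<^sup>2)"
      using ** pos by (intro divide_right_mono mult_left_mono) auto
    finally have weight_le: "1 / (1 + (x - y)\<^sup>2) \<le> 2 * ((1 + 2 / \<kappa>\<^sup>2) * exp (\<kappa> * y)) / (1 + x\<^sup>2)" .
    have factor: "c * (2 * (a * b) / d) = 2 * c * a / d * b" for a b c d :: real by simp
    have "norm (g (x - y)) \<le> C * (1 / (1 + (x - y)\<^sup>2))" using C(3)[of "x - y"] by simp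
    also have "\<dots> \<le> C * (2 * ((1 + 2 / \<kappa>\<^sup>2) * exp (\<kappa> * y)) / (1 + x\<^sup>2))"
      by (rule mult_left_mono[OF weight_le C(1)])
    also have "\<dots> = D / (1 + x\<^sup>2) * exp (\<kappa> * y)" unfolding D_def by (rule factor)
    finally have "norm (g (x - y)) \<le> D / (1 + x\<^sup>2) * exp (\<kappa> * y)" .
    then have "exp (- (2 * \<kappa> * y)) * norm (g (x - y)) \<le> exp (- (2 * \<kappa> * y)) * (D / (1 + x\<^sup>2) * exp (\<kappa> * y))"
      by (rule mult_left_mono) simp
    also have "\<dots> = D / (1 + x\<^sup>2) * (exp (- (2 * \<kappa> * y)) * exp (\<kappa> * y))" by (simp only: mult_ac)
    also have "exp (- (2 * \<kappa> * y)) * exp (\<kappa> * y) = exp (- (\<kappa> * y))" by (simp flip: exp_add)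
    finally show ?thesis .
  qed
  show ?thesis
  proof (rule decayingI)
    show "continuous_on UNIV (resolvent \<kappa> g)" by (rule resolvent_continuous[OF \<kappa> C(2,4)])
    fix x
    have "norm (resolvent \<kappa> g x) \<le> (LINT y:{0..}|lborel. exp (- (2 * \<kappa> * y)) * norm (g (x - y)))"
      by (rule resolvent_norm_le[OF \<kappa> C(2,4)])
    also have "\<dots> \<le> (LINT y:{0..}|lborel. D / (1 + x\<^sup>2) * exp (- (\<kappa> * y)))"
      by (rule set_integral_mono[OF resolvent_norm_integrable[OF \<kappa> C(2,4)]])
         (use weight exp_halfline_integrable(1)[OF \<kappa>] in auto)
    also have "\<dots> = (D / \<kappa>) / (1 + x\<^sup>2)" using exp_halfline_integrable(2)[OF \<kappa>] by simp
    finally show "norm (resolvent \<kappa> g x) \<le> (D / \<kappa>) / (1 + x\<^sup>2)" .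
  qed
qed

lemma decaying_resolvent_derivative:
  assumes "decaying g" "\<kappa> > 0"
  shows "(resolvent \<kappa> g has_vector_derivative (g x - (2 * \<kappa>) *\<^sub>R resolvent \<kappa> g x)) (at x)"
proof -
  obtain C where C: "continuous_on UNIV g" "\<And>x. norm (g x) \<le> C" using decaying_bounded_ex[OF assms(1)] by blast
  show ?thesis by (rule resolvent_has_derivative[OF assms(2) C])
qed

text \<open>Cauchy-Schwarz against the kernel, whose \<open>L\<^sup>2\<close> norm is \<open>1 / (2 sqrt \<kappa>)\<close>. This negative power of \<open>\<kappa>\<close> is what makes the
Riccati equation a small perturbation of a linear one when \<open>\<kappa>\<close> is large compared with the mass.\<close>

lemma resolvent_square_integrable_bound:
  assumes \<kappa>: "\<kappa> > 0" and p: "decaying p" and b: "continuous_on UNIV b" "\<And>x. norm (b x) \<le> B"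
    and M: "(mass p) \<le> M\<^sup>2" "M \<ge> 0"
  shows "norm (resolvent \<kappa> (\<lambda>x. p x * b x) x) \<le> M / (2 * sqrt \<kappa>) * B"
proof -
  have B: "B \<ge> 0" using b(2)[of 0] norm_ge_zero order_trans by blast
  obtain C where C: "continuous_on UNIV (\<lambda>x. p x * b x)" "\<And>x. norm (p x * b x) \<le> C"
    using decayingE[OF decaying_mult_bounded[OF p b]] by metis
  have [measurable]: "p \<in> borel_measurable borel" using p by (rule decaying_measurable)
  let ?e = "\<lambda>y. indicator {0..} y * exp (- (2 * \<kappa> * y)) :: real"
  have e2: "(\<lambda>y. (?e y)\<^sup>2) = (\<lambda>y. indicator {0..} y *\<^sub>R exp (- (4 * \<kappa> * y)))"
    by (rule ext) (auto split: split_indicator simp: power2_eq_square simp flip: exp_add)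
  have ei: "integrable lborel (\<lambda>y. (?e y)\<^sup>2)" and eI: "(LINT y|lborel. (?e y)\<^sup>2) = 1 / (4 * \<kappa>)"
    unfolding e2
    by (rule exp_halfline_integrable(1)[unfolded set_integrable_def] exp_halfline_integrable(2)[unfolded set_lebesgue_integral_def],
        use \<kappa> in simp)+
  have pi0: "integrable lborel (\<lambda>x. (norm (p x))\<^sup>2)" by (rule decaying_norm_sq_integrable[OF p])
  have pi: "integrable lborel (\<lambda>y. (norm (p (x - y)))\<^sup>2)"
    using lborel_integrable_real_affine_iff[of "-1" "\<lambda>y. (norm (p y))\<^sup>2" x] pi0 by simp
  have pI: "(LINT y|lborel. (norm (p (x - y)))\<^sup>2) = (mass p)"
    using lborel_integral_real_affine[of "-1" "\<lambda>y. (norm (p y))\<^sup>2" x] by simp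
  have CSi: "integrable lborel (\<lambda>y. ?e y * norm (p (x - y)))"
    by (rule Cauchy_Schwarz_integral(1)[OF _ _ ei pi]) auto
  have "(LINT y|lborel. \<bar>?e y * norm (p (x - y))\<bar>)\<^sup>2 \<le> (LINT y|lborel. (?e y)\<^sup>2) * (LINT y|lborel. (norm (p (x - y)))\<^sup>2)"
    by (rule Cauchy_Schwarz_integral(2)[OF _ _ ei pi]) auto
  also have "\<dots> \<le> 1 / (4 * \<kappa>) * M\<^sup>2" unfolding eI pI using \<kappa> M by (intro mult_left_mono) auto
  also have "\<dots> = (M / (2 * sqrt \<kappa>))\<^sup>2" using \<kappa> by (simp add: power_divide power_mult_distrib)
  finally have CS: "(LINT y|lborel. \<bar>?e y * norm (p (x - y))\<bar>) \<le> M / (2 * sqrt \<kappa>)"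
    by (rule power2_le_imp_le) (use \<kappa> M in auto)
  have "norm (resolvent \<kappa> (\<lambda>x. p x * b x) x) \<le> (LINT y:{0..}|lborel. exp (- (2 * \<kappa> * y)) * norm (p (x - y) * b (x - y)))"
    by (rule resolvent_norm_le[OF \<kappa> C])
  also have "\<dots> \<le> (LINT y|lborel. \<bar>?e y * norm (p (x - y))\<bar> * B)"
    unfolding set_lebesgue_integral_def
  proof (rule integral_mono)
    show "integrable lborel (\<lambda>y. indicat_real {0..} y *\<^sub>R (exp (- (2 * \<kappa> * y)) * norm (p (x - y) * b (x - y))))"
      using resolvent_norm_integrable[OF \<kappa> C] unfolding set_integrable_def .
    show "integrable lborel (\<lambda>y. \<bar>?e y * norm (p (x - y))\<bar> * B)"
      by (intro integrable_mult_left integrable_abs CSi)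
    show "indicat_real {0..} y *\<^sub>R (exp (- (2 * \<kappa> * y)) * norm (p (x - y) * b (x - y))) \<le> \<bar>?e y * norm (p (x - y))\<bar> * B" for y
      using b(2)[of "x - y"] by (auto simp: norm_mult abs_mult mult.assoc intro!: mult_left_mono split: split_indicator)
  qed
  also have "\<dots> = (LINT y|lborel. \<bar>?e y * norm (p (x - y))\<bar>) * B" by simp
  also have "\<dots> \<le> M / (2 * sqrt \<kappa>) * B" by (rule mult_right_mono[OF CS B])
  finally show ?thesis .
qed

lemma has_vector_derivative_inner_self:
  fixes y :: "real \<Rightarrow> complex"
  assumes "(y has_vector_derivative y') (at x)"
  shows "((\<lambda>x. (norm (y x))\<^sup>2) has_vector_derivative (2 * inner (y x) y')) (at x)"
  using bounded_bilinear.has_vector_derivative[OF bounded_bilinear_inner assms assms]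
  by (simp add: power2_norm_eq_inner inner_commute)

lemma decaying_inner_integrable:
  assumes "decaying f" "decaying g"
  shows "integrable lborel (\<lambda>x. inner (f x) (g x))"
proof -
  have "(\<lambda>x. inner (f x) (g x)) = (\<lambda>x. Re (cnj (f x) * g x))" by (simp add: inner_complex_def)
  then show ?thesis
    using integrable_Re[OF decaying_integrable[OF decaying_mult[OF decaying_cnj[OF assms(1)] assms(2)]]] by simp
qed

lemma integral_inner_derivative_self:
  assumes "decaying y" "decaying y'" "\<And>x. (y has_vector_derivative y' x) (at x)"
  shows "(LINT x|lborel. inner (y x) (y' x)) = 0"
proof -
  have "(LINT x|lborel. 2 * inner (y x) (y' x)) = 0"
  proof (rule integral_derivative_line[OF has_vector_derivative_inner_self[OF assms(3)]])
    show "continuous_on UNIV (\<lambda>x. 2 * inner (y x) (y' x))"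
      by (intro continuous_intros decaying_continuous assms)
    show "integrable lborel (\<lambda>x. 2 * inner (y x) (y' x))"
      by (intro integrable_mult_right decaying_inner_integrable assms)
    show "((\<lambda>x. (norm (y x))\<^sup>2) \<longlongrightarrow> 0) at_bot"
      using tendsto_power[OF tendsto_norm[OF decaying_tendsto_0(2)[OF assms(1)]], of 2] by simp
    show "((\<lambda>x. (norm (y x))\<^sup>2) \<longlongrightarrow> 0) at_top"
      using tendsto_power[OF tendsto_norm[OF decaying_tendsto_0(1)[OF assms(1)]], of 2] by simp
  qed
  then show ?thesis by simp
qed

text \<open>In the expansion of \<open>|y' + 2 \<kappa> y|\<^sup>2\<close> the mixed term is the derivative of \<open>2 \<kappa> |y|\<^sup>2\<close>, whose integral vanishes.\<close>

lemma damped_energy_identity: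
  assumes "decaying y" "decaying g" "\<And>x. (y has_vector_derivative (g x - (2 * \<kappa>) *\<^sub>R y x)) (at x)"
  shows "(mass g) = (LINT x|lborel. (norm (g x - (2 * \<kappa>) *\<^sub>R y x))\<^sup>2) + 4 * \<kappa>\<^sup>2 * (mass y)"
    and "(LINT x|lborel. inner (g x) (y x)) = 2 * \<kappa> * (mass y)"
proof -
  define y' where "y' x = g x - (2 * \<kappa>) *\<^sub>R y x" for x
  have d: "decaying y'" unfolding y'_def scaleR_conv_of_real by (intro decaying_diff decaying_cmult assms)
  have z: "(LINT x|lborel. inner (y x) (y' x)) = 0"
    by (rule integral_inner_derivative_self[OF assms(1) d]) (use assms(3) in \<open>simp add: y'_def\<close>)
  have g: "g x = y' x + (2 * \<kappa>) *\<^sub>R y x" for x by (simp add: y'_def)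
  have i1: "integrable lborel (\<lambda>x. inner (y x) (y' x))" by (rule decaying_inner_integrable[OF assms(1) d])
  have i2: "integrable lborel (\<lambda>x. (norm (y x))\<^sup>2)" by (rule decaying_norm_sq_integrable[OF assms(1)])
  have i3: "integrable lborel (\<lambda>x. (norm (y' x))\<^sup>2)" by (rule decaying_norm_sq_integrable[OF d])
  have "(norm (g x))\<^sup>2 = (norm (y' x))\<^sup>2 + 4 * \<kappa>\<^sup>2 * (norm (y x))\<^sup>2 + 4 * \<kappa> * inner (y x) (y' x)" for x
    unfolding g power2_norm_eq_inner by (simp add: inner_commute power2_eq_square algebra_simps)
  then have "(mass g) = (LINT x|lborel. (norm (y' x))\<^sup>2 + 4 * \<kappa>\<^sup>2 * (norm (y x))\<^sup>2 + 4 * \<kappa> * inner (y x) (y' x))"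
    by simp
  also have "\<dots> = (mass y') + 4 * \<kappa>\<^sup>2 * (mass y) + 4 * \<kappa> * (LINT x|lborel. inner (y x) (y' x))"
    using i1 i2 i3 by simp
  finally show "(mass g) = (LINT x|lborel. (norm (g x - (2 * \<kappa>) *\<^sub>R y x))\<^sup>2) + 4 * \<kappa>\<^sup>2 * (mass y)"
    using z by (simp add: y'_def)
  have "inner (g x) (y x) = inner (y x) (y' x) + 2 * \<kappa> * (norm (y x))\<^sup>2" for x
    unfolding g power2_norm_eq_inner by (simp add: inner_commute algebra_simps)
  then show "(LINT x|lborel. inner (g x) (y x)) = 2 * \<kappa> * (mass y)"
    using i1 i2 z by simp
qed

text \<open>Integrate the derivative of \<open>|y|\<^sup>2\<close> from \<open>-\<infinity>\<close> to \<open>x\<close> and apply Cauchy-Schwarz.\<close>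

lemma sup_norm_sq_le:
  assumes "decaying y" "decaying y'" "\<And>x. (y has_vector_derivative y' x) (at x)"
  shows "(norm (y x))\<^sup>2 \<le> 2 * sqrt ((mass y) * (mass y'))"
proof -
  have [measurable]: "y \<in> borel_measurable borel" "y' \<in> borel_measurable borel"
    using assms by (auto intro: decaying_measurable)
  have i: "integrable lborel (\<lambda>x. norm (y x) * norm (y' x))"
    using integrable_norm[OF decaying_integrable[OF decaying_mult[OF assms(1,2)]]] by (simp add: norm_mult)
  have i2: "integrable lborel (\<lambda>x. 2 * inner (y x) (y' x))"
      by (intro integrable_mult_right decaying_inner_integrable assms)
  have "(norm (y x))\<^sup>2 = (LINT z:{..x}|lborel. 2 * inner (y z) (y' z))"
  proof (rule integral_derivative_halfline[OF has_vector_derivative_inner_self[OF assms(3)], symmetric])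
    show "continuous_on UNIV (\<lambda>x. 2 * inner (y x) (y' x))"
      by (intro continuous_intros decaying_continuous assms)
    show "((\<lambda>x. (norm (y x))\<^sup>2) \<longlongrightarrow> 0) at_bot"
      using tendsto_power[OF tendsto_norm[OF decaying_tendsto_0(2)[OF assms(1)]], of 2] by simp
  qed (rule i2)
  also have "\<dots> \<le> (LINT z|lborel. 2 * (norm (y z) * norm (y' z)))"
    unfolding set_lebesgue_integral_def
  proof (rule integral_mono)
    show "integrable lborel (\<lambda>z. indicat_real {..x} z *\<^sub>R (2 * inner (y z) (y' z)))"
      by (intro integrable_mult_indicator i2) auto
    show "integrable lborel (\<lambda>z. 2 * (norm (y z) * norm (y' z)))" by (intro integrable_mult_right i)
    show "indicat_real {..x} z *\<^sub>R (2 * inner (y z) (y' z)) \<le> 2 * (norm (y z) * norm (y' z))" for z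
      using norm_cauchy_schwarz[of "y z" "y' z"] by (auto split: split_indicator)
  qed
  also have "\<dots> = 2 * (LINT z|lborel. \<bar>norm (y z) * norm (y' z)\<bar>)" using i by (simp add: abs_mult)
  also have "(LINT z|lborel. \<bar>norm (y z) * norm (y' z)\<bar>) \<le> sqrt ((mass y) * (mass y'))"
    by (rule real_le_rsqrt, rule Cauchy_Schwarz_integral(2)) (auto intro: decaying_norm_sq_integrable assms)
  finally show ?thesis by simp
qed

section \<open>Bessel and Plancherel\<close>

definition fourier :: "(real \<Rightarrow> complex) \<Rightarrow> real \<Rightarrow> complex" where
  "fourier f \<xi> = complex_of_real (1 / sqrt (2 * pi)) * (LINT x|lborel. cis (- (x * \<xi>)) * f x)"

lemma cis_measurable [measurable]: "cis \<in> borel_measurable borel"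
  by (intro borel_measurable_continuous_onI continuous_intros)

lemma cnj_measurable [measurable]: "cnj \<in> borel_measurable borel"
  by (intro borel_measurable_continuous_onI continuous_intros)

lemma mult_cnj_eq_norm_sq: "z * cnj z = complex_of_real ((norm z)\<^sup>2)"
  by (rule complex_norm_square[symmetric])

lemma cis_mult_integrable:
  fixes f :: "real \<Rightarrow> complex"
  assumes f: "integrable lborel f" and [measurable]: "h \<in> borel_measurable borel"
  shows "integrable lborel (\<lambda>x. cis (h x) * f x)"
proof (rule Bochner_Integration.integrable_bound[OF f])
  have [measurable]: "f \<in> borel_measurable borel" using f by auto
  show "(\<lambda>x. cis (h x) * f x) \<in> borel_measurable lborel" by measurable
qed (simp add: norm_mult)

lemma fourier_measurable [measurable]:
  assumes "f \<in> borel_measurable borel" shows "fourier f \<in> borel_measurable borel"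
  unfolding fourier_def using assms by measurable

lemma fourier_bounded:
  "norm (fourier f \<xi>) \<le> 1 / sqrt (2 * pi) * (LINT x|lborel. norm (f x))"
proof -
  have "norm (LINT x|lborel. cis (- (x * \<xi>)) * f x) \<le> (LINT x|lborel. norm (cis (- (x * \<xi>)) * f x))"
    by (rule integral_norm_bound)
  then show ?thesis by (simp add: fourier_def norm_mult norm_divide divide_right_mono)
qed

lemma fourier_diff:
  assumes "integrable lborel f" "integrable lborel g"
  shows "fourier (\<lambda>x. f x - g x) \<xi> = fourier f \<xi> - fourier g \<xi>"
proof -
  have "(LINT x|lborel. cis (- (x * \<xi>)) * (f x - g x)) = (LINT x|lborel. cis (- (x * \<xi>)) * f x) - (LINT x|lborel. cis (- (x * \<xi>)) * g x)"
    unfolding right_diff_distrib by (rule Bochner_Integration.integral_diff) (intro cis_mult_integrable assms; measurable)+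
  then show ?thesis by (simp only: fourier_def right_diff_distrib)
qed

lemma fourier_cmult: "fourier (\<lambda>x. c * f x) \<xi> = c * fourier f \<xi>"
proof -
  have "(LINT x|lborel. cis (- (x * \<xi>)) * (c * f x)) = c * (LINT x|lborel. cis (- (x * \<xi>)) * f x)"
    by (subst integral_mult_right_zero[symmetric]) (simp add: mult_ac)
  then show ?thesis by (simp add: fourier_def)
qed

lemma fourier_derivative:
  assumes "decaying y" "decaying y'" "\<And>x. (y has_vector_derivative y' x) (at x)"
  shows "fourier y' \<xi> = \<i> * \<xi> * fourier y \<xi>"
proof -
  have cb: "continuous_on UNIV (\<lambda>x. cis (- (x * \<xi>)))" by (intro continuous_intros)
  have dy: "decaying (\<lambda>x. y x * cis (- (x * \<xi>)))" "decaying (\<lambda>x. y' x * cis (- (x * \<xi>)))"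
    by (rule decaying_mult_bounded[OF _ cb, where B=1]; use assms in simp)+
  have d: "((\<lambda>x. y x * cis (- (x * \<xi>))) has_vector_derivative
      (y' x * cis (- (x * \<xi>)) - \<i> * \<xi> * (y x * cis (- (x * \<xi>))))) (at x)" for x
  proof -
    have "((\<lambda>x. cis (- (x * \<xi>))) has_vector_derivative (- \<xi>) *\<^sub>R (\<i> * cis (- (x * \<xi>)))) (at x)"
      unfolding has_vector_derivative_def by (auto intro!: derivative_eq_intros)
    then have "((\<lambda>x. y x * cis (- (x * \<xi>))) has_vector_derivative
      (y x * ((- \<xi>) *\<^sub>R (\<i> * cis (- (x * \<xi>)))) + y' x * cis (- (x * \<xi>)))) (at x)"
      by (rule has_vector_derivative_mult[OF assms(3)])
    then show ?thesis by (simp add: scaleR_conv_of_real algebra_simps)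
  qed
  have "(LINT x|lborel. y' x * cis (- (x * \<xi>)) - \<i> * \<xi> * (y x * cis (- (x * \<xi>)))) = 0"
  proof (rule integral_derivative_line[OF d])
    have "decaying (\<lambda>x. y' x * cis (- (x * \<xi>)) - \<i> * \<xi> * (y x * cis (- (x * \<xi>))))"
      by (intro decaying_diff decaying_cmult dy)
    then show "continuous_on UNIV (\<lambda>x. y' x * cis (- (x * \<xi>)) - \<i> * \<xi> * (y x * cis (- (x * \<xi>))))"
      "integrable lborel (\<lambda>x. y' x * cis (- (x * \<xi>)) - \<i> * \<xi> * (y x * cis (- (x * \<xi>))))"
      by (auto intro: decaying_continuous decaying_integrable)
  qed (auto intro: decaying_tendsto_0 dy)
  also have "(LINT x|lborel. y' x * cis (- (x * \<xi>)) - \<i> * \<xi> * (y x * cis (- (x * \<xi>)))) =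
     (LINT x|lborel. y' x * cis (- (x * \<xi>))) - \<i> * \<xi> * (LINT x|lborel. y x * cis (- (x * \<xi>)))"
    using decaying_integrable[OF dy(1)] decaying_integrable[OF dy(2)] by simp
  finally show ?thesis by (simp add: fourier_def mult.commute)
qed

lemma fourier_multiplication_formula:
  assumes f: "integrable lborel f" and g: "integrable lborel g"
  shows "(LINT \<xi>|lborel. fourier f \<xi> * g \<xi>) = (LINT x|lborel. f x * fourier g x)"
proof -
  have [measurable]: "f \<in> borel_measurable borel" "g \<in> borel_measurable borel" using f g by auto
  let ?H = "\<lambda>(x, \<xi>). cis (- (x * \<xi>)) * (f x * g \<xi>)"
  have int: "integrable (lborel \<Otimes>\<^sub>M lborel) ?H"
  proof (rule lborel_pair.Fubini_integrable)
    show "?H \<in> borel_measurable (lborel \<Otimes>\<^sub>M lborel)" by measurable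
    have "(\<lambda>x. LINT \<xi>|lborel. norm (cis (- (x * \<xi>)) * (f x * g \<xi>))) = (\<lambda>x. norm (f x) * (LINT \<xi>|lborel. norm (g \<xi>)))"
      by (simp add: norm_mult)
    then show "integrable lborel (\<lambda>x. LINT y|lborel. norm (?H (x, y)))"
      using integrable_norm[OF f] by simp
    show "AE x in lborel. integrable lborel (\<lambda>y. ?H (x, y))"
      using g by (auto intro!: cis_mult_integrable)
  qed
  have "(LINT \<xi>|lborel. LINT x|lborel. ?H (x, \<xi>)) = (LINT x|lborel. LINT \<xi>|lborel. ?H (x, \<xi>))"
    using lborel_pair.Fubini_integral[OF int] by simp
  moreover have "(LINT x|lborel. ?H (x, \<xi>)) = (LINT x|lborel. cis (- (x * \<xi>)) * f x) * g \<xi>" for \<xi>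
    by (subst integral_mult_left_zero[symmetric]) (simp add: mult_ac)
  moreover have "(LINT \<xi>|lborel. ?H (x, \<xi>)) = f x * (LINT \<xi>|lborel. cis (- (\<xi> * x)) * g \<xi>)" for x
    by (subst integral_mult_right_zero[symmetric]) (simp add: mult_ac)
  ultimately have "(LINT \<xi>|lborel. (LINT x|lborel. cis (- (x * \<xi>)) * f x) * g \<xi>) = (LINT x|lborel. f x * (LINT \<xi>|lborel. cis (- (\<xi> * x)) * g \<xi>))"
    by simp
  then show ?thesis
    unfolding fourier_def by (simp add: mult.assoc mult.left_commute[of "f _"])
qed

lemma gaussian_fourier:
  assumes "\<sigma> > 0"
  shows "integrable lborel (\<lambda>\<xi>. complex_of_real (exp (- (\<sigma> * \<xi>)\<^sup>2 / 2)))"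
    and "fourier (\<lambda>\<xi>. complex_of_real (exp (- (\<sigma> * \<xi>)\<^sup>2 / 2))) z = complex_of_real (exp (- (z / \<sigma>)\<^sup>2 / 2) / \<sigma>)"
proof -
  let ?d = "\<lambda>x. complex_of_real (std_normal_density x)"
  have di: "integrable lborel std_normal_density" by (simp add: integrable_normal_density)
  have e: "exp (- (\<sigma> * \<xi>)\<^sup>2 / 2) = sqrt (2 * pi) * std_normal_density (0 + \<sigma> * \<xi>)" for \<xi>
    by (simp add: std_normal_density_def)
  have "integrable lborel (\<lambda>\<xi>. sqrt (2 * pi) * std_normal_density (0 + \<sigma> * \<xi>))"
    by (intro integrable_mult_right) (subst lborel_integrable_real_affine_iff, use assms di in auto)
  then show "integrable lborel (\<lambda>\<xi>. complex_of_real (exp (- (\<sigma> * \<xi>)\<^sup>2 / 2)))"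
    unfolding e by (rule integrable_of_real)
  have "complex_of_real (exp (- (t^2) / 2)) = (LINT x|lborel. cis (t * x) * ?d x)" for t
  proof -
    have "complex_of_real (exp (- (t^2) / 2)) = char std_normal_distribution t"
      by (simp add: char_std_normal_distribution)
    also have "\<dots> = (CLINT x|lborel. std_normal_density x *\<^sub>R iexp (t * x))"
      unfolding char_def by (rule integral_density) auto
    finally show ?thesis by (simp add: cis_conv_exp scaleR_conv_of_real mult.commute)
  qed
  note char = this[of "- (z / \<sigma>)"]
  have "(LINT x|lborel. cis (- (z / \<sigma>) * x) * ?d x)
      = \<sigma> *\<^sub>R (LINT \<xi>|lborel. cis (- (z / \<sigma>) * (0 + \<sigma> * \<xi>)) * ?d (0 + \<sigma> * \<xi>))"
    using assms by (subst lborel_integral_real_affine[of \<sigma> _ 0]) auto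
  also have "(\<lambda>\<xi>. cis (- (z / \<sigma>) * (0 + \<sigma> * \<xi>)) * ?d (0 + \<sigma> * \<xi>)) = (\<lambda>\<xi>. complex_of_real (1 / sqrt (2 * pi)) * (cis (- (\<xi> * z)) * complex_of_real (exp (- (\<sigma> * \<xi>)\<^sup>2 / 2))))"
    using assms unfolding e by (intro ext) (simp add: mult.commute)
  also have "\<sigma> *\<^sub>R (LINT \<xi>|lborel. complex_of_real (1 / sqrt (2 * pi)) * (cis (- (\<xi> * z)) * complex_of_real (exp (- (\<sigma> * \<xi>)\<^sup>2 / 2)))) = \<sigma> * fourier (\<lambda>\<xi>. complex_of_real (exp (- (\<sigma> * \<xi>)\<^sup>2 / 2))) z"
    unfolding fourier_def by (subst integral_mult_right_zero) (simp add: scaleR_conv_of_real)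
  finally show "fourier (\<lambda>\<xi>. complex_of_real (exp (- (\<sigma> * \<xi>)\<^sup>2 / 2))) z = complex_of_real (exp (- (z / \<sigma>)\<^sup>2 / 2) / \<sigma>)"
    using assms unfolding char[symmetric] by (simp add: field_simps)
qed

text \<open>The Gaussian weight makes the triple integral behind \<open>\<integral> |f^|\<^sup>2\<close> absolutely convergent. Two applications of the
multiplication formula, to \<open>f\<close> and to the reflected conjugate of \<open>f\<close>, move the transform onto the Gaussian. On the right
\<open>f\<close> is paired with an average of its translates, and this average tends to \<open>f\<close> as \<open>\<sigma> \<rightarrow> 0\<close>.\<close>

lemma gaussian_weighted_plancherel:
  assumes f: "integrable lborel f" and \<sigma>: "\<sigma> > 0"
  shows "integrable lborel (\<lambda>\<xi>. exp (- (\<sigma> * \<xi>)\<^sup>2 / 2) * (norm (fourier f \<xi>))\<^sup>2)"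
    and "complex_of_real (LINT \<xi>|lborel. exp (- (\<sigma> * \<xi>)\<^sup>2 / 2) * (norm (fourier f \<xi>))\<^sup>2)
      = (LINT x|lborel. f x * (LINT z|lborel. std_normal_density z *\<^sub>R cnj (f (x - \<sigma> * z))))"
proof -
  have [measurable]: "f \<in> borel_measurable borel" using f by auto
  define e where "e \<xi> = complex_of_real (exp (- (\<sigma> * \<xi>)\<^sup>2 / 2))" for \<xi>
  have ei: "integrable lborel e" unfolding e_def by (rule gaussian_fourier(1)[OF \<sigma>])
  have [measurable]: "e \<in> borel_measurable borel" using ei by auto
  define B where "B = 1 / sqrt (2 * pi) * (LINT x|lborel. norm (f x))"
  have B: "norm (fourier f \<xi>) \<le> B" for \<xi> unfolding B_def by (rule fourier_bounded)
  have B0: "B \<ge> 0" using B[of 0] norm_ge_zero order_trans by blast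
  define g where "g \<xi> = cnj (fourier f \<xi>) * e \<xi>" for \<xi>
  have gi: "integrable lborel g"
  proof (rule Bochner_Integration.integrable_bound)
    show "integrable lborel (\<lambda>\<xi>. B * norm (e \<xi>))" using integrable_norm[OF ei] by simp
    show "g \<in> borel_measurable lborel" unfolding g_def by measurable
    show "AE \<xi> in lborel. norm (g \<xi>) \<le> norm (B * norm (e \<xi>))"
      using B B0 by (auto simp: g_def norm_mult abs_mult intro!: mult_right_mono)
  qed
  have fg: "fourier f \<xi> * g \<xi> = complex_of_real (exp (- (\<sigma> * \<xi>)\<^sup>2 / 2) * (norm (fourier f \<xi>))\<^sup>2)" for \<xi>
  proof -
    have "fourier f \<xi> * g \<xi> = (fourier f \<xi> * cnj (fourier f \<xi>)) * e \<xi>" by (simp add: g_def mult_ac)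
    also have "\<dots> = complex_of_real ((norm (fourier f \<xi>))\<^sup>2 * exp (- (\<sigma> * \<xi>)\<^sup>2 / 2))"
      unfolding mult_cnj_eq_norm_sq e_def of_real_mult ..
    finally show ?thesis by (simp only: mult.commute)
  qed
  have fgi: "integrable lborel (\<lambda>\<xi>. fourier f \<xi> * g \<xi>)"
  proof (rule Bochner_Integration.integrable_bound)
    show "integrable lborel (\<lambda>\<xi>. B * norm (g \<xi>))" using integrable_norm[OF gi] by simp
    show "(\<lambda>\<xi>. fourier f \<xi> * g \<xi>) \<in> borel_measurable lborel" unfolding g_def by measurable
    show "AE \<xi> in lborel. norm (fourier f \<xi> * g \<xi>) \<le> norm (B * norm (g \<xi>))"
      using B B0 by (auto simp: norm_mult abs_mult intro!: mult_right_mono)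
  qed
  then show "integrable lborel (\<lambda>\<xi>. exp (- (\<sigma> * \<xi>)\<^sup>2 / 2) * (norm (fourier f \<xi>))\<^sup>2)"
    unfolding fg complex_of_real_integrable_eq .
  define f' where "f' y = cnj (f (0 + (-1) * y))" for y
  have f'i: "integrable lborel f'"
    unfolding f'_def by (subst integrable_cnj) (subst lborel_integrable_real_affine_iff, use f in auto)
  have cnj_fourier: "cnj (fourier f \<xi>) = fourier f' \<xi>" for \<xi>
  proof -
    have "cnj (LINT x|lborel. cis (- (x * \<xi>)) * f x) = (LINT x|lborel. cis (x * \<xi>) * cnj (f x))"
      by (subst Bochner_Integration.integral_cnj[symmetric]) (simp add: cis_cnj)
    also have "\<dots> = (LINT y|lborel. cis ((0 + (-1) * y) * \<xi>) * f' y)"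
      unfolding f'_def by (subst lborel_integral_real_affine[of "-1" _ 0]) auto
    finally show ?thesis by (simp add: fourier_def)
  qed
  have fourier_g: "fourier g x = (LINT z|lborel. std_normal_density z *\<^sub>R cnj (f (x - \<sigma> * z)))" for x
  proof -
    have ci: "integrable lborel (\<lambda>\<xi>. cis (- (\<xi> * x)) * e \<xi>)" by (rule cis_mult_integrable[OF ei]) measurable
    have ce: "fourier (\<lambda>\<xi>. cis (- (\<xi> * x)) * e \<xi>) y = fourier e (x + y)" for y
    proof -
      have "- (\<xi> * y) + - (\<xi> * x) = - (\<xi> * (x + y))" for \<xi> :: real by (simp add: algebra_simps)
      then show ?thesis by (simp only: fourier_def mult.assoc[symmetric] cis_mult)
    qed
    have "fourier g x = complex_of_real (1 / sqrt (2 * pi)) * (LINT \<xi>|lborel. fourier f' \<xi> * (cis (- (\<xi> * x)) * e \<xi>))"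
      unfolding fourier_def[of g] g_def cnj_fourier by (simp add: mult_ac)
    also have "(LINT \<xi>|lborel. fourier f' \<xi> * (cis (- (\<xi> * x)) * e \<xi>)) = (LINT y|lborel. f' y * fourier e (x + y))"
      unfolding fourier_multiplication_formula[OF f'i ci] ce ..
    also have "\<dots> = \<sigma> *\<^sub>R (LINT z|lborel. f' (- x + \<sigma> * z) * fourier e (x + (- x + \<sigma> * z)))"
      using \<sigma> by (subst lborel_integral_real_affine[of \<sigma> _ "- x"]) auto
    also have "\<dots> = \<sigma> *\<^sub>R (LINT z|lborel. (sqrt (2 * pi) / \<sigma>) *\<^sub>R (std_normal_density z *\<^sub>R cnj (f (x - \<sigma> * z))))"
      unfolding e_def gaussian_fourier(2)[OF \<sigma>] f'_def using \<sigma>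
      by (simp add: std_normal_density_def scaleR_conv_of_real mult_ac)
    also have "\<dots> = sqrt (2 * pi) * (LINT z|lborel. std_normal_density z *\<^sub>R cnj (f (x - \<sigma> * z)))"
      using \<sigma> by (subst integral_scaleR_right) (simp add: scaleR_conv_of_real)
    finally show ?thesis by simp
  qed
  have "complex_of_real (LINT \<xi>|lborel. exp (- (\<sigma> * \<xi>)\<^sup>2 / 2) * (norm (fourier f \<xi>))\<^sup>2) = (LINT \<xi>|lborel. fourier f \<xi> * g \<xi>)"
    unfolding fg by (rule integral_complex_of_real[symmetric])
  also have "\<dots> = (LINT x|lborel. f x * fourier g x)" by (rule fourier_multiplication_formula[OF f gi])
  finally show "complex_of_real (LINT \<xi>|lborel. exp (- (\<sigma> * \<xi>)\<^sup>2 / 2) * (norm (fourier f \<xi>))\<^sup>2)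
      = (LINT x|lborel. f x * (LINT z|lborel. std_normal_density z *\<^sub>R cnj (f (x - \<sigma> * z))))"
    unfolding fourier_g .
qed

lemma norm_integral_le_nn_integral:
  fixes f :: "'a \<Rightarrow> 'b::{banach, second_countable_topology}"
  shows "ennreal (norm (integral\<^sup>L M f)) \<le> (\<integral>\<^sup>+x. ennreal (norm (f x)) \<partial>M)"
  by (cases "integrable M f") (auto simp: integral_norm_bound_ennreal not_integrable_integral_eq)

text \<open>The product of \<open>f x\<close> with a translate is at most the mean of the two squares. Integrating over \<open>x\<close> first, both
squares give the mass of \<open>f\<close>, and the Gaussian density has integral one.\<close>

lemma gaussian_weighted_bessel:
  assumes f: "integrable lborel f" and f2: "integrable lborel (\<lambda>x. (norm (f x))\<^sup>2)" and \<sigma>: "\<sigma> > 0"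
  shows "(LINT \<xi>|lborel. exp (- (\<sigma> * \<xi>)\<^sup>2 / 2) * (norm (fourier f \<xi>))\<^sup>2) \<le> (mass f)"
proof -
  have [measurable]: "f \<in> borel_measurable borel" using f by auto
  let ?d = "\<lambda>z. ennreal (std_normal_density z)"
  let ?I = "(\<integral>\<^sup>+x. ennreal ((norm (f x))\<^sup>2) \<partial>lborel)"
  have half: "ennreal (1/2) + ennreal (1/2) = 1" by (subst ennreal_plus[symmetric]) auto
  have d1: "(\<integral>\<^sup>+z. ?d z \<partial>lborel) = 1"
    using integral_normal_density[of 1 0] integrable_normal_density[of 1 0]
    by (subst nn_integral_eq_integral) auto
  have "ennreal (LINT \<xi>|lborel. exp (- (\<sigma> * \<xi>)\<^sup>2 / 2) * (norm (fourier f \<xi>))\<^sup>2)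
     = ennreal (norm (complex_of_real (LINT \<xi>|lborel. exp (- (\<sigma> * \<xi>)\<^sup>2 / 2) * (norm (fourier f \<xi>))\<^sup>2)))"
    by (subst norm_of_real) (simp add: abs_of_nonneg)
  also have "\<dots> \<le> (\<integral>\<^sup>+x. ennreal (norm (f x * (LINT z|lborel. std_normal_density z *\<^sub>R cnj (f (x - \<sigma> * z))))) \<partial>lborel)"
    unfolding gaussian_weighted_plancherel(2)[OF f \<sigma>] by (rule norm_integral_le_nn_integral)
  also have "\<dots> \<le> (\<integral>\<^sup>+x. \<integral>\<^sup>+z. ?d z * ennreal (norm (f x) * norm (f (x - \<sigma> * z))) \<partial>lborel \<partial>lborel)"
  proof (rule nn_integral_mono)
    fix x
    have "ennreal (norm (f x * (LINT z|lborel. std_normal_density z *\<^sub>R cnj (f (x - \<sigma> * z)))))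
       = ennreal (norm (f x)) * ennreal (norm (LINT z|lborel. std_normal_density z *\<^sub>R cnj (f (x - \<sigma> * z))))"
      by (simp add: norm_mult ennreal_mult)
    also have "\<dots> \<le> ennreal (norm (f x)) * (\<integral>\<^sup>+z. ennreal (norm (std_normal_density z *\<^sub>R cnj (f (x - \<sigma> * z)))) \<partial>lborel)"
      by (intro mult_left_mono norm_integral_le_nn_integral) auto
    also have "\<dots> = (\<integral>\<^sup>+z. ?d z * ennreal (norm (f x) * norm (f (x - \<sigma> * z))) \<partial>lborel)"
      by (subst nn_integral_cmult[symmetric]) (auto simp: ennreal_mult[symmetric] mult_ac intro!: nn_integral_cong)
    finally show "ennreal (norm (f x * (LINT z|lborel. std_normal_density z *\<^sub>R cnj (f (x - \<sigma> * z)))))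
      \<le> (\<integral>\<^sup>+z. ?d z * ennreal (norm (f x) * norm (f (x - \<sigma> * z))) \<partial>lborel)" .
  qed
  also have "\<dots> \<le> (\<integral>\<^sup>+x. \<integral>\<^sup>+z. ?d z * (ennreal (1/2) * ennreal ((norm (f x))\<^sup>2) + ennreal (1/2) * ennreal ((norm (f (x - \<sigma> * z)))\<^sup>2)) \<partial>lborel \<partial>lborel)"
  proof (intro nn_integral_mono mult_left_mono)
    fix x z
    have "norm (f x) * norm (f (x - \<sigma> * z)) \<le> 1/2 * (norm (f x))\<^sup>2 + 1/2 * (norm (f (x - \<sigma> * z)))\<^sup>2"
      using sum_squares_bound[of "norm (f x)" "norm (f (x - \<sigma> * z))"] by simp
    then have "ennreal (norm (f x) * norm (f (x - \<sigma> * z))) \<le> ennreal (1/2 * (norm (f x))\<^sup>2 + 1/2 * (norm (f (x - \<sigma> * z)))\<^sup>2)"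
      by (rule ennreal_leI)
    also have "\<dots> = ennreal (1/2) * ennreal ((norm (f x))\<^sup>2) + ennreal (1/2) * ennreal ((norm (f (x - \<sigma> * z)))\<^sup>2)"
      by (simp only: ennreal_mult'[symmetric] ennreal_plus[symmetric] zero_le_power2 norm_ge_zero mult_nonneg_nonneg zero_le_divide_1_iff zero_le_numeral)
    finally show "ennreal (norm (f x) * norm (f (x - \<sigma> * z))) \<le> ennreal (1/2) * ennreal ((norm (f x))\<^sup>2) + ennreal (1/2) * ennreal ((norm (f (x - \<sigma> * z)))\<^sup>2)" .
  qed auto
  also have "\<dots> = (\<integral>\<^sup>+x. \<integral>\<^sup>+z. ?d z * (ennreal (1/2) * ennreal ((norm (f x))\<^sup>2)) \<partial>lborel \<partial>lborel) + (\<integral>\<^sup>+x. \<integral>\<^sup>+z. ?d z * (ennreal (1/2) * ennreal ((norm (f (x - \<sigma> * z)))\<^sup>2)) \<partial>lborel \<partial>lborel)"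
    unfolding distrib_left by (subst nn_integral_add[symmetric]) (auto intro!: nn_integral_cong nn_integral_add)
  also have "(\<integral>\<^sup>+x. \<integral>\<^sup>+z. ?d z * (ennreal (1/2) * ennreal ((norm (f x))\<^sup>2)) \<partial>lborel \<partial>lborel) = ennreal (1/2) * ?I"
    by (subst nn_integral_multc) (auto simp: d1 nn_integral_cmult)
  also have "(\<integral>\<^sup>+x. \<integral>\<^sup>+z. ?d z * (ennreal (1/2) * ennreal ((norm (f (x - \<sigma> * z)))\<^sup>2)) \<partial>lborel \<partial>lborel)
     = (\<integral>\<^sup>+z. \<integral>\<^sup>+x. ?d z * (ennreal (1/2) * ennreal ((norm (f (x - \<sigma> * z)))\<^sup>2)) \<partial>lborel \<partial>lborel)"
    by (rule lborel_pair.Fubini') measurable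
  also have "\<dots> = (\<integral>\<^sup>+z. ?d z * (ennreal (1/2) * ?I) \<partial>lborel)"
  proof (rule nn_integral_cong)
    fix z
    have "?I = (\<integral>\<^sup>+x. ennreal ((norm (f (x - \<sigma> * z)))\<^sup>2) \<partial>lborel)"
      by (subst nn_integral_real_affine[of _ 1 "- \<sigma> * z"]) (auto simp: algebra_simps)
    then show "(\<integral>\<^sup>+x. ?d z * (ennreal (1/2) * ennreal ((norm (f (x - \<sigma> * z)))\<^sup>2)) \<partial>lborel) = ?d z * (ennreal (1/2) * ?I)"
      by (simp add: nn_integral_cmult)
  qed
  also have "\<dots> = ennreal (1/2) * ?I" by (subst nn_integral_multc) (auto simp: d1)
  also have "ennreal (1/2) * ?I + ennreal (1/2) * ?I = ?I"
    by (simp only: distrib_right[symmetric] half mult_1_left)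
  also have "?I = ennreal (mass f)" by (rule nn_integral_eq_integral[OF f2]) auto
  finally show ?thesis by (subst (asm) ennreal_le_iff) auto
qed

text \<open>Fatou's lemma for \<open>\<sigma> = 1 / (n + 1)\<close> removes the Gaussian weight.\<close>

lemma fourier_bessel:
  assumes f: "integrable lborel f" and f2: "integrable lborel (\<lambda>x. (norm (f x))\<^sup>2)"
  shows "(\<integral>\<^sup>+\<xi>. ennreal ((norm (fourier f \<xi>))\<^sup>2) \<partial>lborel) \<le> ennreal (mass f)"
proof -
  have [measurable]: "f \<in> borel_measurable borel" using f by auto
  let ?g = "\<lambda>n \<xi>. exp (- (1 / real (Suc n) * \<xi>)\<^sup>2 / 2) * (norm (fourier f \<xi>))\<^sup>2"
  have lim: "(\<lambda>n. ?g n \<xi>) \<longlonglongrightarrow> (norm (fourier f \<xi>))\<^sup>2" for \<xi>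
  proof -
    have "(\<lambda>n. exp (- (1 / real (Suc n) * \<xi>)\<^sup>2 / 2)) \<longlonglongrightarrow> exp (- (0 * \<xi>)\<^sup>2 / 2)"
      by (intro tendsto_intros) (use LIMSEQ_inverse_real_of_nat in \<open>simp_all add: inverse_eq_divide\<close>)
    from tendsto_mult[OF this tendsto_const[of "(norm (fourier f \<xi>))\<^sup>2"]] show ?thesis by simp
  qed
  have "(\<integral>\<^sup>+\<xi>. ennreal ((norm (fourier f \<xi>))\<^sup>2) \<partial>lborel) = (\<integral>\<^sup>+\<xi>. liminf (\<lambda>n. ennreal (?g n \<xi>)) \<partial>lborel)"
    by (intro nn_integral_cong lim_imp_Liminf[symmetric] tendsto_ennrealI lim) auto
  also have "\<dots> \<le> liminf (\<lambda>n. \<integral>\<^sup>+\<xi>. ennreal (?g n \<xi>) \<partial>lborel)"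
    by (rule nn_integral_liminf) measurable
  also have "\<dots> \<le> ennreal (mass f)"
  proof (rule order_trans[OF Liminf_le_Limsup Limsup_bounded])
    show "\<forall>\<^sub>F n in sequentially. (\<integral>\<^sup>+\<xi>. ennreal (?g n \<xi>) \<partial>lborel) \<le> ennreal (mass f)"
    proof (rule always_eventually, rule allI)
      fix n
      have "(\<integral>\<^sup>+\<xi>. ennreal (?g n \<xi>) \<partial>lborel) = ennreal (LINT \<xi>|lborel. ?g n \<xi>)"
        by (rule nn_integral_eq_integral[OF gaussian_weighted_plancherel(1)[OF f]]) auto
      also have "\<dots> \<le> ennreal (mass f)"
        by (intro ennreal_leI gaussian_weighted_bessel f f2) auto
      finally show "(\<integral>\<^sup>+\<xi>. ennreal (?g n \<xi>) \<partial>lborel) \<le> ennreal (mass f)" .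
    qed
  qed auto
  finally show ?thesis .
qed

lemma fourier_norm_sq_integrable:
  assumes f: "integrable lborel f" and f2: "integrable lborel (\<lambda>x. (norm (f x))\<^sup>2)"
  shows "integrable lborel (\<lambda>\<xi>. (norm (fourier f \<xi>))\<^sup>2)"
proof (rule integrableI_nonneg)
  have [measurable]: "f \<in> borel_measurable borel" using f by auto
  show "(\<lambda>\<xi>. (norm (fourier f \<xi>))\<^sup>2) \<in> borel_measurable lborel" by measurable
  show "(\<integral>\<^sup>+\<xi>. ennreal ((norm (fourier f \<xi>))\<^sup>2) \<partial>lborel) < \<infinity>"
    using fourier_bessel[OF f f2] by (simp add: le_less_trans)
qed auto

text \<open>For bounded continuous \<open>f\<close> dominated convergence applies on both sides of the Gaussian identity, which improves
Bessel's inequality to an equality.\<close>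

lemma fourier_plancherel:
  assumes f: "decaying f"
  shows "(LINT \<xi>|lborel. (norm (fourier f \<xi>))\<^sup>2) = (mass f)"
proof -
  obtain C where C: "C \<ge> 0" "continuous_on UNIV f" "\<And>x. norm (f x) \<le> C"
    using decayingE[OF f] by metis
  have fi: "integrable lborel f" by (rule decaying_integrable[OF f])
  have f2: "integrable lborel (\<lambda>x. (norm (f x))\<^sup>2)" by (rule decaying_norm_sq_integrable[OF f])
  have [measurable]: "f \<in> borel_measurable borel" using fi by auto
  define \<sigma> where "\<sigma> n = 1 / real (Suc n)" for n
  have \<sigma>: "\<sigma> n > 0" "\<sigma> \<longlonglongrightarrow> 0" for n
    using LIMSEQ_inverse_real_of_nat by (auto simp: \<sigma>_def[abs_def] inverse_eq_divide)
  let ?h = "\<lambda>n x. LINT z|lborel. std_normal_density z *\<^sub>R cnj (f (x - \<sigma> n * z))"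
  have di: "integrable lborel std_normal_density" by (simp add: integrable_normal_density)
  have dI: "(LINT z|lborel. std_normal_density z) = 1" using integral_normal_density[of 1 0] by simp
  have "(\<lambda>n. LINT \<xi>|lborel. exp (- (\<sigma> n * \<xi>)\<^sup>2 / 2) * (norm (fourier f \<xi>))\<^sup>2) \<longlonglongrightarrow> (LINT \<xi>|lborel. (norm (fourier f \<xi>))\<^sup>2)"
  proof (rule integral_dominated_convergence[OF _ _ fourier_norm_sq_integrable[OF fi f2]])
    show "AE \<xi> in lborel. (\<lambda>n. exp (- (\<sigma> n * \<xi>)\<^sup>2 / 2) * (norm (fourier f \<xi>))\<^sup>2) \<longlonglongrightarrow> (norm (fourier f \<xi>))\<^sup>2"
    proof (rule AE_I2)
      fix \<xi>
      have "(\<lambda>n. exp (- (\<sigma> n * \<xi>)\<^sup>2 / 2)) \<longlonglongrightarrow> exp (- (0 * \<xi>)\<^sup>2 / 2)"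
        by (intro tendsto_intros \<sigma>) simp_all
      from tendsto_mult[OF this tendsto_const[of "(norm (fourier f \<xi>))\<^sup>2"]]
      show "(\<lambda>n. exp (- (\<sigma> n * \<xi>)\<^sup>2 / 2) * (norm (fourier f \<xi>))\<^sup>2) \<longlonglongrightarrow> (norm (fourier f \<xi>))\<^sup>2" by simp
    qed
    show "AE \<xi> in lborel. norm (exp (- (\<sigma> n * \<xi>)\<^sup>2 / 2) * (norm (fourier f \<xi>))\<^sup>2) \<le> (norm (fourier f \<xi>))\<^sup>2" for n
      by (auto simp: abs_mult intro!: mult_left_le_one_le)
  qed auto
  then have A: "(\<lambda>n. complex_of_real (LINT \<xi>|lborel. exp (- (\<sigma> n * \<xi>)\<^sup>2 / 2) * (norm (fourier f \<xi>))\<^sup>2)) \<longlonglongrightarrow> complex_of_real (LINT \<xi>|lborel. (norm (fourier f \<xi>))\<^sup>2)"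
    by (rule tendsto_of_real)
  have density_bound: "norm (std_normal_density z *\<^sub>R w) \<le> C * std_normal_density z" if "norm w \<le> C" for w :: complex and z
    using mult_left_mono[OF that normal_density_nonneg[of 0 1 z]] by (simp add: mult.commute)
  have h: "(\<lambda>n. ?h n x) \<longlonglongrightarrow> cnj (f x)" for x
  proof -
    have "(\<lambda>n. ?h n x) \<longlonglongrightarrow> (LINT z|lborel. std_normal_density z *\<^sub>R cnj (f x))"
    proof (rule integral_dominated_convergence)
      show "integrable lborel (\<lambda>z. C * std_normal_density z)" using di by simp
      show "AE z in lborel. norm (std_normal_density z *\<^sub>R cnj (f (x - \<sigma> n * z))) \<le> C * std_normal_density z" for n
        by (intro AE_I2 density_bound) (simp add: C)
      show "AE z in lborel. (\<lambda>n. std_normal_density z *\<^sub>R cnj (f (x - \<sigma> n * z))) \<longlonglongrightarrow> std_normal_density z *\<^sub>R cnj (f x)"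
      proof (rule AE_I2)
        fix z
        have "(\<lambda>n. x - \<sigma> n * z) \<longlonglongrightarrow> x - 0 * z" by (intro tendsto_intros \<sigma>)
        then have "(\<lambda>n. f (x - \<sigma> n * z)) \<longlonglongrightarrow> f x"
          using C(2) by (intro isCont_tendsto_compose[of x f]) (auto simp: continuous_on_eq_continuous_at)
        then show "(\<lambda>n. std_normal_density z *\<^sub>R cnj (f (x - \<sigma> n * z))) \<longlonglongrightarrow> std_normal_density z *\<^sub>R cnj (f x)"
          by (intro tendsto_intros)
      qed
    qed auto
    also have "(LINT z|lborel. std_normal_density z *\<^sub>R cnj (f x)) = cnj (f x)"
      using di dI by simp
    finally show ?thesis .
  qed
  have hb: "norm (?h n x) \<le> C" for n x
  proof -
    have "norm (?h n x) \<le> (LINT z|lborel. C * std_normal_density z)"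
    proof (rule order_trans[OF integral_norm_bound integral_mono'])
      show "integrable lborel (\<lambda>z. C * std_normal_density z)" using di by simp
      show "norm (std_normal_density z *\<^sub>R cnj (f (x - \<sigma> n * z))) \<le> C * std_normal_density z" for z
        by (rule density_bound) (simp add: C)
    qed (use C in auto)
    then show ?thesis using di dI by simp
  qed
  have "(\<lambda>n. LINT x|lborel. f x * ?h n x) \<longlonglongrightarrow> (LINT x|lborel. f x * cnj (f x))"
  proof (rule integral_dominated_convergence)
    show "integrable lborel (\<lambda>x. norm (f x) * C)" using integrable_norm[OF fi] by simp
    show "AE x in lborel. (\<lambda>n. f x * ?h n x) \<longlonglongrightarrow> f x * cnj (f x)"
      by (intro AE_I2 tendsto_intros h)
    show "AE x in lborel. norm (f x * ?h n x) \<le> norm (f x) * C" for n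
      using hb by (auto simp: norm_mult intro!: mult_left_mono)
  qed measurable
  also have "(LINT x|lborel. f x * cnj (f x)) = complex_of_real (mass f)"
    unfolding mult_cnj_eq_norm_sq by (rule integral_complex_of_real)
  finally have B: "(\<lambda>n. complex_of_real (LINT \<xi>|lborel. exp (- (\<sigma> n * \<xi>)\<^sup>2 / 2) * (norm (fourier f \<xi>))\<^sup>2)) \<longlonglongrightarrow> complex_of_real (mass f)"
    unfolding gaussian_weighted_plancherel(2)[OF fi \<sigma>(1)] .
  show ?thesis using LIMSEQ_unique[OF A B] by simp
qed

section \<open>The Fourier transform on \<open>L\<^sup>2\<close>\<close>

lemma L2_borel: "f \<in> L2 \<Longrightarrow> f \<in> borel_measurable borel"
  by (simp add: L2_def)

lemma L2_norm_sq_integrable: "f \<in> L2 \<Longrightarrow> integrable lborel (\<lambda>x. (norm (f x))\<^sup>2)"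
  by (simp add: L2_def)

lemma norm_sq_add_le: "(norm (a + b :: complex))\<^sup>2 \<le> 2 * (norm a)\<^sup>2 + 2 * (norm b)\<^sup>2"
proof -
  have "(norm (a + b))\<^sup>2 \<le> (norm a + norm b)\<^sup>2" by (intro power_mono norm_triangle_ineq) simp
  also have "\<dots> \<le> 2 * (norm a)\<^sup>2 + 2 * (norm b)\<^sup>2"
    using sum_squares_bound[of "norm a" "norm b"] by (simp add: power2_sum)
  finally show ?thesis .
qed

lemma norm_sq_diff_le: "(norm (a - b :: complex))\<^sup>2 \<le> 2 * (norm a)\<^sup>2 + 2 * (norm b)\<^sup>2"
  using norm_sq_add_le[of a "- b"] by simp

lemma L2_diff:
  assumes f: "f \<in> L2" and g: "g \<in> L2"
  shows "(\<lambda>x. f x - g x) \<in> L2"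
proof -
  have [measurable]: "f \<in> borel_measurable borel" "g \<in> borel_measurable borel" using f g by (auto intro: L2_borel)
  have "integrable lborel (\<lambda>x. (norm (f x - g x))\<^sup>2)"
  proof (rule Bochner_Integration.integrable_bound)
    show "integrable lborel (\<lambda>x. 2 * (norm (f x))\<^sup>2 + 2 * (norm (g x))\<^sup>2)"
      by (intro Bochner_Integration.integrable_add integrable_mult_right L2_norm_sq_integrable f g)
  qed (use norm_sq_diff_le in auto)
  then show ?thesis by (simp add: L2_def)
qed

lemma decaying_L2: "decaying f \<Longrightarrow> f \<in> L2"
  using decaying_measurable[of f] decaying_norm_sq_integrable[of f] by (simp add: L2_def)

lemma bounded_part_integrable:
  assumes f: "f \<in> L2" and A: "A \<in> sets borel" "A \<subseteq> {-R..R}"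
  shows "integrable lborel (\<lambda>x. indicator A x *\<^sub>R f x)" "integrable lborel (\<lambda>x. (norm (indicator A x *\<^sub>R f x))\<^sup>2)"
proof -
  have [measurable]: "f \<in> borel_measurable borel" "A \<in> sets borel" using f A by (auto intro: L2_borel)
  have f2: "integrable lborel (\<lambda>x. (norm (f x))\<^sup>2)" using f by (rule L2_norm_sq_integrable)
  have b: "norm (f x) \<le> 1 + (norm (f x))\<^sup>2" for x
    using self_le_power[of "norm (f x)" 2] by (cases "norm (f x) \<le> 1") (auto simp: add_increasing2)
  show "integrable lborel (\<lambda>x. indicator A x *\<^sub>R f x)"
  proof (rule Bochner_Integration.integrable_bound)
    show "integrable lborel (\<lambda>x. indicator {-R..R} x + (norm (f x))\<^sup>2)"
      by (intro Bochner_Integration.integrable_add f2 integrable_real_indicator) (auto simp: emeasure_lborel_Icc_eq)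
    show "AE x in lborel. norm (indicator A x *\<^sub>R f x) \<le> norm (indicator {-R..R} x + (norm (f x))\<^sup>2)"
    proof (rule AE_I2)
      fix x
      show "norm (indicator A x *\<^sub>R f x) \<le> norm (indicator {-R..R} x + (norm (f x))\<^sup>2)"
        using b[of x] A(2) by (cases "x \<in> A") (auto simp: subset_eq)
    qed
  qed simp
  show "integrable lborel (\<lambda>x. (norm (indicator A x *\<^sub>R f x))\<^sup>2)"
    by (rule Bochner_Integration.integrable_bound[OF f2]) (auto split: split_indicator)
qed

lemma truncated_fourier_eq: "truncated_fourier R f = fourier (\<lambda>x. indicator {-R..R} x *\<^sub>R f x)"
proof
  fix \<xi>
  have "(LINT x:{-R..R}|lborel. cis (- (x * \<xi>)) * f x) = (LINT x|lborel. cis (- (x * \<xi>)) * (indicator {-R..R} x *\<^sub>R f x))"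
    unfolding set_lebesgue_integral_def by (rule Bochner_Integration.integral_cong) auto
  then show "truncated_fourier R f \<xi> = fourier (\<lambda>x. indicator {-R..R} x *\<^sub>R f x) \<xi>"
    by (simp only: truncated_fourier_def fourier_def)
qed

lemma truncated_fourier_measurable:
  assumes "f \<in> L2" shows "truncated_fourier R f \<in> borel_measurable borel"
  using L2_borel[OF assms] unfolding truncated_fourier_eq by measurable

lemma truncated_fourier_diff:
  assumes "f \<in> L2" "g \<in> L2"
  shows "truncated_fourier R (\<lambda>x. f x - g x) \<xi> = truncated_fourier R f \<xi> - truncated_fourier R g \<xi>"
proof -
  have "fourier (\<lambda>x. indicator {-R..R} x *\<^sub>R f x - indicator {-R..R} x *\<^sub>R g x) \<xi>
      = fourier (\<lambda>x. indicator {-R..R} x *\<^sub>R f x) \<xi> - fourier (\<lambda>x. indicator {-R..R} x *\<^sub>R g x) \<xi>"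
    by (rule fourier_diff) (rule bounded_part_integrable(1)[where R=R]; use assms in simp)+
  then show ?thesis by (simp only: truncated_fourier_eq scaleR_diff_right)
qed

lemma truncated_fourier_cauchy:
  assumes f: "f \<in> L2" and R: "R \<le> R'"
  shows "(\<integral>\<^sup>+\<xi>. ennreal ((norm (truncated_fourier R' f \<xi> - truncated_fourier R f \<xi>))\<^sup>2) \<partial>lborel)
     \<le> ennreal (LINT x:- {-R..R}|lborel. (norm (f x))\<^sup>2)"
proof -
  let ?A = "{-R'..R'} - {-R..R}"
  have [measurable]: "f \<in> borel_measurable borel" using f by (auto intro: L2_borel)
  note A = bounded_part_integrable[OF f, of ?A R']
  have "truncated_fourier R' f \<xi> - truncated_fourier R f \<xi> = fourier (\<lambda>x. indicator ?A x *\<^sub>R f x) \<xi>" for \<xi>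
  proof -
    have "(\<lambda>x. indicator ?A x *\<^sub>R f x) = (\<lambda>x. indicator {-R'..R'} x *\<^sub>R f x - indicator {-R..R} x *\<^sub>R f x)"
      using R by (intro ext) (auto split: split_indicator)
    then show ?thesis
      unfolding truncated_fourier_eq using R
      by (simp only:) (rule fourier_diff[symmetric]; rule bounded_part_integrable[OF f, where R=R']; auto)
  qed
  then have "(\<integral>\<^sup>+\<xi>. ennreal ((norm (truncated_fourier R' f \<xi> - truncated_fourier R f \<xi>))\<^sup>2) \<partial>lborel)
    = (\<integral>\<^sup>+\<xi>. ennreal ((norm (fourier (\<lambda>x. indicator ?A x *\<^sub>R f x) \<xi>))\<^sup>2) \<partial>lborel)" by simp
  also have "\<dots> \<le> ennreal (LINT x|lborel. (norm (indicator ?A x *\<^sub>R f x))\<^sup>2)"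
    by (rule fourier_bessel) (rule A; auto)+
  also have "\<dots> \<le> ennreal (LINT x:- {-R..R}|lborel. (norm (f x))\<^sup>2)"
    unfolding set_lebesgue_integral_def
  proof (intro ennreal_leI integral_mono)
    show "integrable lborel (\<lambda>x. (norm (indicator ?A x *\<^sub>R f x))\<^sup>2)" by (rule A) auto
    show "integrable lborel (\<lambda>x. indicat_real (- {-R..R}) x *\<^sub>R (norm (f x))\<^sup>2)"
      by (intro integrable_mult_indicator L2_norm_sq_integrable f) auto
  qed (auto split: split_indicator)
  finally show ?thesis .
qed

lemma L2_tail_tendsto_0:
  assumes f: "f \<in> L2"
  shows "((\<lambda>R. LINT x:- {-R..R}|lborel. (norm (f x))\<^sup>2) \<longlongrightarrow> 0) at_top"
proof -
  have [measurable]: "f \<in> borel_measurable borel" using f by (auto intro: L2_borel)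
  have "((\<lambda>R. LINT x:- {-R..R}|lborel. (norm (f x))\<^sup>2) \<longlongrightarrow> (LINT x::real|lborel. (0::real))) at_top"
    unfolding set_lebesgue_integral_def
  proof (rule integral_dominated_convergence_at_top[where w="\<lambda>x. (norm (f x))\<^sup>2"])
    show "integrable lborel (\<lambda>x. (norm (f x))\<^sup>2)" by (rule L2_norm_sq_integrable[OF f])
    show "AE x in lborel. ((\<lambda>R. indicat_real (- {-R..R}) x *\<^sub>R (norm (f x))\<^sup>2) \<longlongrightarrow> 0) at_top"
    proof (rule AE_I2, rule tendsto_eventually)
      fix x :: real
      show "\<forall>\<^sub>F R in at_top. indicat_real (- {-R..R}) x *\<^sub>R (norm (f x))\<^sup>2 = 0"
        using eventually_ge_at_top[of "\<bar>x\<bar>"] by eventually_elim (auto split: split_indicator)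
    qed
  qed (auto split: split_indicator)
  then show ?thesis by simp
qed

lemma Fatou_norm_sq:
  assumes lim: "AE \<xi> in lborel. (\<lambda>k. F k \<xi>) \<longlonglongrightarrow> g \<xi>" and [measurable]: "\<And>k. F k \<in> borel_measurable borel" "h \<in> borel_measurable borel"
    and b: "\<forall>\<^sub>F k in sequentially. (\<integral>\<^sup>+\<xi>. ennreal ((norm (h \<xi> - F k \<xi> :: complex))\<^sup>2) \<partial>lborel) \<le> B"
  shows "(\<integral>\<^sup>+\<xi>. ennreal ((norm (h \<xi> - g \<xi>))\<^sup>2) \<partial>lborel) \<le> B"
proof -
  have "(\<integral>\<^sup>+\<xi>. ennreal ((norm (h \<xi> - g \<xi>))\<^sup>2) \<partial>lborel) = (\<integral>\<^sup>+\<xi>. liminf (\<lambda>k. ennreal ((norm (h \<xi> - F k \<xi>))\<^sup>2)) \<partial>lborel)"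
  proof (rule nn_integral_cong_AE, use lim in eventually_elim)
    fix \<xi> assume "(\<lambda>k. F k \<xi>) \<longlonglongrightarrow> g \<xi>"
    then have "(\<lambda>k. ennreal ((norm (h \<xi> - F k \<xi>))\<^sup>2)) \<longlonglongrightarrow> ennreal ((norm (h \<xi> - g \<xi>))\<^sup>2)"
      by (intro tendsto_ennrealI tendsto_intros)
    then show "ennreal ((norm (h \<xi> - g \<xi>))\<^sup>2) = liminf (\<lambda>k. ennreal ((norm (h \<xi> - F k \<xi>))\<^sup>2))"
      by (intro lim_imp_Liminf[symmetric]) auto
  qed
  also have "\<dots> \<le> liminf (\<lambda>k. \<integral>\<^sup>+\<xi>. ennreal ((norm (h \<xi> - F k \<xi>))\<^sup>2) \<partial>lborel)"
    by (rule nn_integral_liminf) measurable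
  also have "\<dots> \<le> B" by (rule order_trans[OF Liminf_le_Limsup Limsup_bounded[OF b]]) simp
  finally show ?thesis .
qed

text \<open>The series \<open>\<Sum> 2 ^ k |F (k+1) - F k|\<^sup>2\<close> has a finite integral, so it converges almost everywhere. There the increments
themselves are summable, because \<open>d \<le> 2 ^ k d\<^sup>2 + 2 ^ (- k)\<close> for every \<open>d \<ge> 0\<close>.\<close>

lemma fast_cauchy_converges_AE:
  fixes F :: "nat \<Rightarrow> real \<Rightarrow> complex"
  assumes [measurable]: "\<And>k. F k \<in> borel_measurable borel"
    and b: "\<And>k. (\<integral>\<^sup>+\<xi>. ennreal ((norm (F (Suc k) \<xi> - F k \<xi>))\<^sup>2) \<partial>lborel) \<le> ennreal ((1/4) ^ k)"
  shows "AE \<xi> in lborel. convergent (\<lambda>k. F k \<xi>)"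
proof -
  let ?a = "\<lambda>k \<xi>. 2 ^ k * (norm (F (Suc k) \<xi> - F k \<xi>))\<^sup>2"
  have "(\<integral>\<^sup>+\<xi>. (\<Sum>k. ennreal (?a k \<xi>)) \<partial>lborel) = (\<Sum>k. \<integral>\<^sup>+\<xi>. ennreal (?a k \<xi>) \<partial>lborel)"
    by (rule nn_integral_suminf) measurable
  also have "\<dots> \<le> (\<Sum>k. ennreal ((1/2) ^ k))"
  proof (rule suminf_le)
    fix k
    have "(\<integral>\<^sup>+\<xi>. ennreal (?a k \<xi>) \<partial>lborel) = ennreal (2 ^ k) * (\<integral>\<^sup>+\<xi>. ennreal ((norm (F (Suc k) \<xi> - F k \<xi>))\<^sup>2) \<partial>lborel)"
      by (subst nn_integral_cmult[symmetric]) (auto simp: ennreal_mult)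
    also have "\<dots> \<le> ennreal (2 ^ k) * ennreal ((1/4) ^ k)" by (intro mult_left_mono b) simp
    also have "\<dots> = ennreal (2 ^ k * (1/4) ^ k)" by (rule ennreal_mult[symmetric]) auto
    also have "(2::real) ^ k * (1/4) ^ k = (1/2) ^ k" by (subst power_mult_distrib[symmetric]) simp
    finally show "(\<integral>\<^sup>+\<xi>. ennreal (?a k \<xi>) \<partial>lborel) \<le> ennreal ((1/2) ^ k)" .
  qed auto
  also have "\<dots> = ennreal (\<Sum>k. (1/2) ^ k)" by (rule suminf_ennreal2) (auto intro: summable_geometric)
  finally have "(\<integral>\<^sup>+\<xi>. (\<Sum>k. ennreal (?a k \<xi>)) \<partial>lborel) \<noteq> \<infinity>" by (auto simp: top_unique)
  then have "AE \<xi> in lborel. (\<Sum>k. ennreal (?a k \<xi>)) \<noteq> \<infinity>" by (intro nn_integral_PInf_AE) auto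
  then show ?thesis
  proof eventually_elim
    fix \<xi> assume "(\<Sum>k. ennreal (?a k \<xi>)) \<noteq> \<infinity>"
    then have s: "summable (\<lambda>k. ?a k \<xi>)" by (intro summable_suminf_not_top) auto
    have sm: "summable (\<lambda>k. F (Suc k) \<xi> - F k \<xi>)"
    proof (rule summable_comparison_test'[OF summable_add[OF s summable_geometric[of "1/2"]]])
      fix k :: nat
      define d where "d = norm (F (Suc k) \<xi> - F k \<xi>)"
      have "d \<le> 2 ^ k * d\<^sup>2 + (1/2) ^ k"
      proof (cases "d \<le> (1/2) ^ k")
        case True
        then show ?thesis by (simp add: add_increasing)
      next
        case False
        then have "2 ^ k * (1/2) ^ k * d \<le> 2 ^ k * d * d" by (intro mult_right_mono mult_left_mono) (auto simp: d_def)
        also have "(2::real) ^ k * (1/2) ^ k = 1" by (subst power_mult_distrib[symmetric]) simp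
        finally show ?thesis by (simp add: power2_eq_square mult.assoc add_increasing2)
      qed
      then show "norm (F (Suc k) \<xi> - F k \<xi>) \<le> 2 ^ k * (norm (F (Suc k) \<xi> - F k \<xi>))\<^sup>2 + (1/2) ^ k"
        by (simp add: d_def)
    qed auto
    have "(\<Sum>i<k. F (Suc i) \<xi> - F i \<xi>) = F k \<xi> - F 0 \<xi>" for k by (rule sum_lessThan_telescope)
    with summable_LIMSEQ[OF sm] have "(\<lambda>k. F k \<xi> - F 0 \<xi>) \<longlonglongrightarrow> (\<Sum>k. F (Suc k) \<xi> - F k \<xi>)" by simp
    then have "(\<lambda>k. F k \<xi> - F 0 \<xi> + F 0 \<xi>) \<longlonglongrightarrow> (\<Sum>k. F (Suc k) \<xi> - F k \<xi>) + F 0 \<xi>" by (intro tendsto_intros)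
    then show "convergent (\<lambda>k. F k \<xi>)" by (auto simp: convergent_def)
  qed
qed

text \<open>By Bessel's inequality the transforms of the truncations form a Cauchy family, with squared distance bounded by the tail
of the mass. A rapidly convergent subfamily has a limit almost everywhere, and Fatou's lemma transfers the distance bound
to this limit.\<close>

lemma is_fourier_L2_exists:
  assumes f: "f \<in> L2"
  shows "\<exists>g. is_fourier_L2 f g"
proof -
  let ?tail = "\<lambda>R. LINT x:- {-R..R}|lborel. (norm (f x))\<^sup>2"
  have "\<exists>N. \<forall>R\<ge>N. ?tail R < (1/4) ^ k" for k :: nat
    using order_tendstoD(2)[OF L2_tail_tendsto_0[OF f], of "(1/4) ^ k"] by (simp add: eventually_at_top_linorder)
  then obtain N where N: "\<And>k R. R \<ge> N k \<Longrightarrow> ?tail R < (1/4) ^ k" for k :: nat by metis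
  \<comment> \<open>Summing \<open>max (N j) 1\<close> makes the radii increasing, at least \<open>N k\<close>, and unbounded.\<close>
  define r where "r k = (\<Sum>j\<le>k. max (N j) 1)" for k :: nat
  have r_mono: "r k \<le> r (Suc k)" for k by (simp add: r_def)
  have r_N: "N k \<le> r k" for k
  proof -
    have "max (N k) 1 \<le> r k" unfolding r_def by (rule member_le_sum) auto
    then show ?thesis by simp
  qed
  have r_k: "real (Suc k) \<le> r k" for k
  proof -
    have "(\<Sum>j\<le>k. 1) \<le> r k" unfolding r_def by (rule sum_mono) auto
    then show ?thesis by simp
  qed
  define F where "F k = truncated_fourier (r k) f" for k
  have Fm [measurable]: "F k \<in> borel_measurable borel" for k unfolding F_def by (rule truncated_fourier_measurable[OF f])
  have conv: "AE \<xi> in lborel. convergent (\<lambda>k. F k \<xi>)"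
  proof (rule fast_cauchy_converges_AE[OF Fm])
    fix k
    have "(\<integral>\<^sup>+\<xi>. ennreal ((norm (F (Suc k) \<xi> - F k \<xi>))\<^sup>2) \<partial>lborel) \<le> ennreal (?tail (r k))"
      unfolding F_def by (rule truncated_fourier_cauchy[OF f r_mono])
    also have "\<dots> \<le> ennreal ((1/4) ^ k)" using N[OF r_N[of k]] by (intro ennreal_leI) simp
    finally show "(\<integral>\<^sup>+\<xi>. ennreal ((norm (F (Suc k) \<xi> - F k \<xi>))\<^sup>2) \<partial>lborel) \<le> ennreal ((1/4) ^ k)" .
  qed
  define g where "g \<xi> = lim (\<lambda>k. F k \<xi>)" for \<xi>
  have gm [measurable]: "g \<in> borel_measurable borel" unfolding g_def by measurable
  have lim: "AE \<xi> in lborel. (\<lambda>k. F k \<xi>) \<longlonglongrightarrow> g \<xi>"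
    using conv by eventually_elim (simp add: g_def convergent_LIMSEQ_iff)
  have [measurable]: "truncated_fourier R f \<in> borel_measurable borel" for R by (rule truncated_fourier_measurable[OF f])
  have close: "(\<integral>\<^sup>+\<xi>. ennreal ((norm (truncated_fourier R f \<xi> - g \<xi>))\<^sup>2) \<partial>lborel) \<le> ennreal (?tail R)" for R
  proof (rule Fatou_norm_sq[OF lim])
    obtain K where K: "R \<le> real K" using real_arch_simple by blast
    have "R \<le> r k" if "k \<ge> K" for k using r_k[of k] that K by simp
    then show "\<forall>\<^sub>F k in sequentially. (\<integral>\<^sup>+\<xi>. ennreal ((norm (truncated_fourier R f \<xi> - F k \<xi>))\<^sup>2) \<partial>lborel) \<le> ennreal (?tail R)"
      using truncated_fourier_cauchy[OF f] unfolding F_def by (intro eventually_sequentiallyI[of K]) (simp add: norm_minus_commute)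
  qed measurable
  have "g \<in> L2"
  proof -
    have "(\<integral>\<^sup>+\<xi>. ennreal ((norm (0 - g \<xi>))\<^sup>2) \<partial>lborel) \<le> ennreal (?tail (-1))"
      using close[of "-1"] by (simp add: truncated_fourier_def set_lebesgue_integral_def)
    then have "(\<integral>\<^sup>+\<xi>. ennreal ((norm (g \<xi>))\<^sup>2) \<partial>lborel) < \<infinity>" by (simp add: le_less_trans)
    then show ?thesis unfolding L2_def by (auto intro!: integrableI_nonneg)
  qed
  moreover have "((\<lambda>R. \<integral>\<^sup>+ \<xi>. ennreal ((norm (truncated_fourier R f \<xi> - g \<xi>))\<^sup>2) \<partial>lborel) \<longlongrightarrow> 0) at_top"
  proof (rule tendsto_sandwich[OF _ _ tendsto_const])
    show "((\<lambda>R. ennreal (?tail R)) \<longlongrightarrow> 0) at_top"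
      using tendsto_ennrealI[OF L2_tail_tendsto_0[OF f]] by simp
  qed (use close in auto)
  ultimately show ?thesis by (auto simp: is_fourier_L2_def)
qed

lemma is_fourier_fourier_L2: "f \<in> L2 \<Longrightarrow> is_fourier_L2 f (fourier_L2 f)"
  unfolding fourier_L2_def using is_fourier_L2_exists by (rule someI_ex)

lemma is_fourier_L2_diff:
  assumes f: "f \<in> L2" "is_fourier_L2 f f'" and g: "g \<in> L2" "is_fourier_L2 g g'"
  shows "is_fourier_L2 (\<lambda>x. f x - g x) (\<lambda>\<xi>. f' \<xi> - g' \<xi>)"
proof -
  have L2: "f' \<in> L2" "g' \<in> L2" using f g by (auto simp: is_fourier_L2_def)
  have [measurable]: "f' \<in> borel_measurable borel" "g' \<in> borel_measurable borel"
    "truncated_fourier R f \<in> borel_measurable borel" "truncated_fourier R g \<in> borel_measurable borel" for R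
    using f g L2 by (auto intro: L2_borel truncated_fourier_measurable)
  let ?I = "\<lambda>f f' R. \<integral>\<^sup>+ \<xi>. ennreal ((norm (truncated_fourier R f \<xi> - f' \<xi>))\<^sup>2) \<partial>lborel"
  have le: "?I (\<lambda>x. f x - g x) (\<lambda>\<xi>. f' \<xi> - g' \<xi>) R \<le> 2 * ?I f f' R + 2 * ?I g g' R" for R
  proof -
    have "?I (\<lambda>x. f x - g x) (\<lambda>\<xi>. f' \<xi> - g' \<xi>) R \<le> (\<integral>\<^sup>+ \<xi>. 2 * ennreal ((norm (truncated_fourier R f \<xi> - f' \<xi>))\<^sup>2) + 2 * ennreal ((norm (truncated_fourier R g \<xi> - g' \<xi>))\<^sup>2) \<partial>lborel)"
    proof (rule nn_integral_mono)
      fix \<xi>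
      have "truncated_fourier R (\<lambda>x. f x - g x) \<xi> - (f' \<xi> - g' \<xi>) = (truncated_fourier R f \<xi> - f' \<xi>) - (truncated_fourier R g \<xi> - g' \<xi>)"
        by (simp add: truncated_fourier_diff f g)
      then have "ennreal ((norm (truncated_fourier R (\<lambda>x. f x - g x) \<xi> - (f' \<xi> - g' \<xi>)))\<^sup>2)
         \<le> ennreal (2 * (norm (truncated_fourier R f \<xi> - f' \<xi>))\<^sup>2 + 2 * (norm (truncated_fourier R g \<xi> - g' \<xi>))\<^sup>2)"
        by (simp only: ennreal_leI norm_sq_diff_le)
      also have "\<dots> = 2 * ennreal ((norm (truncated_fourier R f \<xi> - f' \<xi>))\<^sup>2) + 2 * ennreal ((norm (truncated_fourier R g \<xi> - g' \<xi>))\<^sup>2)"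
        by (simp add: ennreal_mult)
      finally show "ennreal ((norm (truncated_fourier R (\<lambda>x. f x - g x) \<xi> - (f' \<xi> - g' \<xi>)))\<^sup>2) \<le> 2 * ennreal ((norm (truncated_fourier R f \<xi> - f' \<xi>))\<^sup>2) + 2 * ennreal ((norm (truncated_fourier R g \<xi> - g' \<xi>))\<^sup>2)" .
    qed
    also have "\<dots> = 2 * ?I f f' R + 2 * ?I g g' R" by (simp add: nn_integral_add nn_integral_cmult)
    finally show ?thesis .
  qed
  have "((\<lambda>R. 2 * ?I f f' R + 2 * ?I g g' R) \<longlongrightarrow> 2 * 0 + 2 * 0) at_top"
    using f g unfolding is_fourier_L2_def by (intro tendsto_add ennreal_tendsto_cmult) auto
  then have lim: "((\<lambda>R. 2 * ?I f f' R + 2 * ?I g g' R) \<longlongrightarrow> 0) at_top" by simp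
  have "(?I (\<lambda>x. f x - g x) (\<lambda>\<xi>. f' \<xi> - g' \<xi>) \<longlongrightarrow> 0) at_top"
    by (rule tendsto_sandwich[OF _ _ tendsto_const lim]) (use le in auto)
  then show ?thesis using L2_diff[OF L2] by (simp add: is_fourier_L2_def)
qed

lemma is_fourier_L2_zero:
  assumes "is_fourier_L2 (\<lambda>x. 0) g" shows "AE \<xi> in lborel. g \<xi> = 0"
proof -
  have [measurable]: "g \<in> borel_measurable borel" using assms by (auto simp: is_fourier_L2_def intro: L2_borel)
  have "((\<lambda>R::real. \<integral>\<^sup>+ \<xi>. ennreal ((norm (g \<xi>))\<^sup>2) \<partial>lborel) \<longlongrightarrow> 0) at_top"
    using assms by (simp add: is_fourier_L2_def truncated_fourier_def)
  then have "(\<integral>\<^sup>+ \<xi>. ennreal ((norm (g \<xi>))\<^sup>2) \<partial>lborel) = 0"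
    by (subst (asm) tendsto_const_iff) auto
  then show ?thesis by (subst (asm) nn_integral_0_iff_AE) auto
qed

lemma is_fourier_L2_unique:
  assumes "f \<in> L2" "is_fourier_L2 f g" "is_fourier_L2 f h" shows "AE \<xi> in lborel. g \<xi> = h \<xi>"
  using is_fourier_L2_zero[of "\<lambda>\<xi>. g \<xi> - h \<xi>"] is_fourier_L2_diff[OF assms(1,2,1,3)] by simp

lemma fourier_L2_diff:
  assumes "f \<in> L2" "g \<in> L2"
  shows "AE \<xi> in lborel. fourier_L2 (\<lambda>x. f x - g x) \<xi> = fourier_L2 f \<xi> - fourier_L2 g \<xi>"
  by (rule is_fourier_L2_unique[OF L2_diff[OF assms] is_fourier_fourier_L2[OF L2_diff[OF assms]]])
     (intro is_fourier_L2_diff is_fourier_fourier_L2 assms)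

lemma fourier_L2_decaying:
  assumes f: "decaying f" shows "AE \<xi> in lborel. fourier_L2 f \<xi> = fourier f \<xi>"
proof (rule is_fourier_L2_unique[OF decaying_L2[OF f] is_fourier_fourier_L2[OF decaying_L2[OF f]]])
  have fi: "integrable lborel f" by (rule decaying_integrable[OF f])
  have f2: "integrable lborel (\<lambda>x. (norm (f x))\<^sup>2)" by (rule decaying_norm_sq_integrable[OF f])
  have [measurable]: "f \<in> borel_measurable borel" using fi by auto
  have "fourier f \<in> L2" using fourier_norm_sq_integrable[OF fi f2] by (simp add: L2_def)
  let ?tail = "\<lambda>R. LINT x:- {-R..R}|lborel. (norm (f x))\<^sup>2"
  have close: "(\<integral>\<^sup>+ \<xi>. ennreal ((norm (truncated_fourier R f \<xi> - fourier f \<xi>))\<^sup>2) \<partial>lborel) \<le> ennreal (?tail R)" for R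
  proof -
    let ?h = "\<lambda>x. indicator (- {-R..R}) x *\<^sub>R f x"
    have hi: "integrable lborel ?h" by (intro integrable_mult_indicator fi) auto
    have h2: "(\<lambda>x. (norm (?h x))\<^sup>2) = (\<lambda>x. indicator (- {-R..R}) x *\<^sub>R (norm (f x))\<^sup>2)"
      by (auto split: split_indicator)
    have "truncated_fourier R f \<xi> - fourier f \<xi> = - fourier ?h \<xi>" for \<xi>
    proof -
      have "fourier (\<lambda>x. f x - indicator {-R..R} x *\<^sub>R f x) \<xi> = fourier f \<xi> - fourier (\<lambda>x. indicator {-R..R} x *\<^sub>R f x) \<xi>"
        by (rule fourier_diff[OF fi]) (intro integrable_mult_indicator fi, auto)
      also have "(\<lambda>x. f x - indicator {-R..R} x *\<^sub>R f x) = ?h" by (auto split: split_indicator)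
      finally show ?thesis by (simp add: truncated_fourier_eq)
    qed
    then have "(\<integral>\<^sup>+ \<xi>. ennreal ((norm (truncated_fourier R f \<xi> - fourier f \<xi>))\<^sup>2) \<partial>lborel) = (\<integral>\<^sup>+ \<xi>. ennreal ((norm (fourier ?h \<xi>))\<^sup>2) \<partial>lborel)"
      by simp
    also have "\<dots> \<le> ennreal (LINT x|lborel. (norm (?h x))\<^sup>2)"
      by (rule fourier_bessel[OF hi]) (unfold h2, intro integrable_mult_indicator f2, auto)
    finally show ?thesis unfolding h2 set_lebesgue_integral_def .
  qed
  have "((\<lambda>R. \<integral>\<^sup>+ \<xi>. ennreal ((norm (truncated_fourier R f \<xi> - fourier f \<xi>))\<^sup>2) \<partial>lborel) \<longlongrightarrow> 0) at_top"
  proof (rule tendsto_sandwich[OF _ _ tendsto_const])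
    show "((\<lambda>R. ennreal (?tail R)) \<longlongrightarrow> 0) at_top"
      using tendsto_ennrealI[OF L2_tail_tendsto_0[OF decaying_L2[OF f]]] by simp
  qed (use close in auto)
  with \<open>fourier f \<in> L2\<close> show "is_fourier_L2 f (fourier f)" by (simp add: is_fourier_L2_def)
qed

section \<open>The Riccati equation of the Lax pair\<close>

text \<open>If \<open>\<psi>\<^sub>1' = \<kappa> \<psi>\<^sub>1 + (cnj p) \<psi>\<^sub>2 / 2\<close> and \<open>\<psi>\<^sub>2' = - \<kappa> \<psi>\<^sub>2 - p \<psi>\<^sub>1\<close>, then \<open>w = \<psi>\<^sub>2 / \<psi>\<^sub>1\<close> satisfies
\<open>w' + 2 \<kappa> w = - p - (cnj p) w\<^sup>2 / 2\<close>. The integral form selects the solution that is bounded at \<open>-\<infinity>\<close>; the radius \<open>1/2\<close>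
leaves enough room for the fixed-point argument below.\<close>

definition riccati_solution :: "real \<Rightarrow> (real \<Rightarrow> complex) \<Rightarrow> (real \<Rightarrow> complex) \<Rightarrow> bool" where
  "riccati_solution \<kappa> p w \<longleftrightarrow> continuous_on UNIV w \<and> (\<forall>x. norm (w x) \<le> 1/2) \<and>
     (\<forall>x. w x = - resolvent \<kappa> (\<lambda>x. p x + cnj (p x) * ((w x)\<^sup>2 / 2)) x)"

lemma riccati_solutionD:
  assumes "riccati_solution \<kappa> p w"
  shows "continuous_on UNIV w" "norm (w x) \<le> 1/2"
    "w x = - resolvent \<kappa> (\<lambda>x. p x + cnj (p x) * ((w x)\<^sup>2 / 2)) x"
  using assms unfolding riccati_solution_def by blast+

text \<open>The spectral parameter is large compared with the mass. The bound \<open>1/4\<close> makes multiplication by \<open>p\<close> or \<open>cnj p\<close>, followed by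
the resolvent, a contraction by the factor \<open>1/4\<close> in the supremum norm.\<close>

definition small_mass :: "real \<Rightarrow> real \<Rightarrow> (real \<Rightarrow> complex) \<Rightarrow> bool" where
  "small_mass \<kappa> M p \<longleftrightarrow> decaying p \<and> \<kappa> > 0 \<and> M \<ge> 0 \<and> M / (2 * sqrt \<kappa>) \<le> 1/4 \<and> (mass p) \<le> M\<^sup>2"

lemma small_mass_resolvent:
  assumes "small_mass \<kappa> M p" "continuous_on UNIV b" "\<And>x. norm (b x) \<le> B"
  shows "norm (resolvent \<kappa> (\<lambda>x. p x * b x) x) \<le> B / 4"
    and "norm (resolvent \<kappa> (\<lambda>x. cnj (p x) * b x) x) \<le> B / 4"
proof -
  have B: "B \<ge> 0" using assms(3)[of 0] norm_ge_zero order_trans by blast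
  have le: "M / (2 * sqrt \<kappa>) * B \<le> 1/4 * B"
    using assms(1) B by (intro mult_right_mono) (auto simp: small_mass_def)
  have p: "norm (resolvent \<kappa> (\<lambda>x. p x * b x) x) \<le> M / (2 * sqrt \<kappa>) * B"
    by (rule resolvent_square_integrable_bound) (use assms in \<open>auto simp: small_mass_def\<close>)
  show "norm (resolvent \<kappa> (\<lambda>x. p x * b x) x) \<le> B / 4" using order_trans[OF p le] by simp
  have cp: "norm (resolvent \<kappa> (\<lambda>x. cnj (p x) * b x) x) \<le> M / (2 * sqrt \<kappa>) * B"
    by (rule resolvent_square_integrable_bound) (use assms in \<open>auto simp: small_mass_def intro: decaying_cnj\<close>)
  show "norm (resolvent \<kappa> (\<lambda>x. cnj (p x) * b x) x) \<le> B / 4" using order_trans[OF cp le] by simp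
qed

lemma norm_sq_half_le:
  assumes "norm (a :: complex) \<le> 1/2" shows "norm (a\<^sup>2 / 2) \<le> 1/8"
proof -
  have "norm a ^ 2 \<le> (1/2)\<^sup>2" by (intro power_mono assms) simp
  then show ?thesis by (simp add: norm_divide norm_power power_divide)
qed

text \<open>The resolvent form of the equation gives \<open>S \<le> S / 4 + \<eta> / (2 \<kappa>)\<close> for the supremum \<open>S\<close> of \<open>|d|\<close>. This is the stability that
compares Riccati functions at neighbouring times.\<close>

lemma small_mass_stability:
  assumes sm: "small_mass \<kappa> M p" and d: "decaying d" and e: "decaying e"
    and m: "continuous_on UNIV m" "\<And>x. norm (m x) \<le> 1"
    and d': "\<And>x. (d has_vector_derivative (- (cnj (p x) * (m x * d x) + e x) - (2 * \<kappa>) *\<^sub>R d x)) (at x)"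
    and e_le: "\<And>x. norm (e x) \<le> \<eta>"
  shows "norm (d x) \<le> \<eta> / \<kappa>"
proof -
  have \<kappa>: "\<kappa> > 0" and p: "decaying p" using sm by (auto simp: small_mass_def)
  define c where "c x = m x * d x" for x
  have c: "decaying c"
    unfolding c_def mult.commute[of "m _"] by (rule decaying_mult_bounded[OF d m])
  have pc: "decaying (\<lambda>x. cnj (p x) * c x)" by (intro decaying_mult decaying_cnj p c)
  have d_eq: "d x = - (resolvent \<kappa> (\<lambda>x. cnj (p x) * c x) x + resolvent \<kappa> e x)" for x
  proof -
    obtain C1 where C1: "continuous_on UNIV (\<lambda>x. cnj (p x) * c x)" "\<And>x. norm (cnj (p x) * c x) \<le> C1"
      using decaying_bounded_ex[OF pc] by blast
    obtain C2 where C2: "continuous_on UNIV e" "\<And>x. norm (e x) \<le> C2" using decaying_bounded_ex[OF e] by blast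
    obtain C3 where C3: "continuous_on UNIV (\<lambda>x. - (cnj (p x) * c x + e x))" "\<And>x. norm (- (cnj (p x) * c x + e x)) \<le> C3"
      using decaying_bounded_ex[OF decaying_uminus[OF decaying_add[OF pc e]]] by blast
    obtain C4 where C4: "\<And>x. norm (d x) \<le> C4" using decaying_bounded_ex[OF d] by blast
    have "d x = resolvent \<kappa> (\<lambda>x. - (cnj (p x) * c x + e x)) x"
      by (rule fun_cong[OF resolvent_unique[OF \<kappa> C3 d'[folded c_def] C4]])
    then show ?thesis by (simp only: resolvent_uminus resolvent_add[OF \<kappa> C1 C2])
  qed
  define S where "S = (SUP x. norm (d x))"
  obtain C4 where C4: "\<And>x. norm (d x) \<le> C4" using decaying_bounded_ex[OF d] by blast
  have bdd: "bdd_above (range (\<lambda>x. norm (d x)))" using C4 by (auto intro!: bdd_aboveI[where M=C4])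
  have dS: "norm (d x) \<le> S" for x unfolding S_def by (rule cSUP_upper[OF UNIV_I bdd])
  have c_le: "norm (c x) \<le> S" for x
    using mult_mono[OF m(2)[of x] dS[of x]] by (simp add: c_def norm_mult)
  have "S \<le> S / 4 + \<eta> / (2 * \<kappa>)"
    unfolding S_def
  proof (rule cSUP_least)
    fix x
    have "norm (d x) \<le> norm (resolvent \<kappa> (\<lambda>x. cnj (p x) * c x) x) + norm (resolvent \<kappa> e x)"
      unfolding d_eq norm_minus_cancel by (rule norm_triangle_ineq)
    also have "norm (resolvent \<kappa> (\<lambda>x. cnj (p x) * c x) x) \<le> S / 4"
      by (rule small_mass_resolvent(2)[OF sm decaying_continuous[OF c] c_le])
    also have "norm (resolvent \<kappa> e x) \<le> \<eta> / (2 * \<kappa>)"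
      by (rule resolvent_bounded[OF \<kappa> decaying_continuous[OF e] e_le])
    finally show "norm (d x) \<le> (SUP x. norm (d x)) / 4 + \<eta> / (2 * \<kappa>)" by (simp add: S_def)
  qed auto
  then have "S \<le> 4/3 * (\<eta> / (2 * \<kappa>))" by simp
  also have "\<dots> \<le> 2 * (\<eta> / (2 * \<kappa>))"
    by (rule mult_right_mono) (use \<kappa> order_trans[OF norm_ge_zero e_le[of 0]] in auto)
  finally have "S \<le> \<eta> / \<kappa>" by simp
  with dS[of x] show ?thesis by linarith
qed

lemma riccati_source_decaying:
  assumes "decaying p" "continuous_on UNIV w" "\<And>x. norm (w x) \<le> 1/2"
  shows "decaying (\<lambda>x. cnj (p x) * ((w x)\<^sup>2 / 2))" "decaying (\<lambda>x. p x + cnj (p x) * ((w x)\<^sup>2 / 2))"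
proof -
  have "norm ((w x)\<^sup>2 / 2) \<le> 1" for x
    by (rule order_trans[OF norm_sq_half_le[OF assms(3)]]) simp
  then show 1: "decaying (\<lambda>x. cnj (p x) * ((w x)\<^sup>2 / 2))"
    by (intro decaying_mult_bounded[where B=1] decaying_cnj assms continuous_intros) auto
  then show "decaying (\<lambda>x. p x + cnj (p x) * ((w x)\<^sup>2 / 2))"
    by (intro decaying_add assms)
qed

text \<open>Banach's fixed point theorem in the ball of radius \<open>1/2\<close> of the bounded continuous functions: the linear term contributes at
most \<open>1/4\<close> and the quadratic term at most \<open>1/32\<close>, and differences are contracted because \<open>|w\<^sup>2 - z\<^sup>2| \<le> |w - z|\<close> on the ball.\<close>

lemma riccati_solution_exists:
  assumes sm: "small_mass \<kappa> M p"
  shows "\<exists>w. riccati_solution \<kappa> p w"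
proof -
  have p: "decaying p" and \<kappa>: "\<kappa> > 0" using sm by (auto simp: small_mass_def)
  let ?S = "cball (0 :: real \<Rightarrow>\<^sub>C complex) (1/2)"
  have S: "w \<in> ?S \<longleftrightarrow> (\<forall>x. norm (apply_bcontfun w x) \<le> 1/2)" for w :: "real \<Rightarrow>\<^sub>C complex"
  proof
    assume "w \<in> ?S"
    then have "norm w \<le> 1/2" by (simp add: mem_cball dist_norm)
    then show "\<forall>x. norm (apply_bcontfun w x) \<le> 1/2" using norm_bounded order_trans by blast
  next
    assume "\<forall>x. norm (apply_bcontfun w x) \<le> 1/2"
    then have "norm w \<le> 1/2" by (intro norm_bound) simp
    then show "w \<in> ?S" by (simp add: mem_cball dist_norm)
  qed
  define G where "G w x = - resolvent \<kappa> (\<lambda>x. p x + cnj (p x) * ((w x)\<^sup>2 / 2)) x" for w x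
  have G_cont: "continuous_on UNIV (G w)" if w: "continuous_on UNIV w" "\<And>x. norm (w x) \<le> 1/2" for w
  proof -
    obtain C where C: "continuous_on UNIV (\<lambda>x. p x + cnj (p x) * ((w x)\<^sup>2 / 2))" "\<And>x. norm (p x + cnj (p x) * ((w x)\<^sup>2 / 2)) \<le> C"
      using decaying_bounded_ex[OF riccati_source_decaying(2)[OF p w]] by blast
    show ?thesis unfolding G_def by (intro continuous_intros resolvent_continuous[OF \<kappa> C])
  qed
  have split: "resolvent \<kappa> (\<lambda>x. p x + cnj (p x) * ((w x)\<^sup>2 / 2)) x = resolvent \<kappa> p x + resolvent \<kappa> (\<lambda>x. cnj (p x) * ((w x)\<^sup>2 / 2)) x"
    if w: "continuous_on UNIV w" "\<And>x. norm (w x) \<le> 1/2" for w x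
  proof -
    obtain C where C: "continuous_on UNIV p" "\<And>x. norm (p x) \<le> C" using decaying_bounded_ex[OF p] by blast
    obtain D where D: "continuous_on UNIV (\<lambda>x. cnj (p x) * ((w x)\<^sup>2 / 2))" "\<And>x. norm (cnj (p x) * ((w x)\<^sup>2 / 2)) \<le> D"
      using decaying_bounded_ex[OF riccati_source_decaying(1)[OF p w]] by blast
    show ?thesis by (rule resolvent_add[OF \<kappa> C D])
  qed
  have G_bound: "norm (G w x) \<le> 1/2" if w: "continuous_on UNIV w" "\<And>x. norm (w x) \<le> 1/2" for w x
  proof -
    have "norm (resolvent \<kappa> (\<lambda>x. p x * 1) x) \<le> 1 / 4" by (rule small_mass_resolvent[OF sm]) auto
    moreover have "norm (resolvent \<kappa> (\<lambda>x. cnj (p x) * ((w x)\<^sup>2 / 2)) x) \<le> (1/8) / 4"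
      by (rule small_mass_resolvent[OF sm]) (intro continuous_intros norm_sq_half_le w; simp)+
    moreover have "norm (G w x) \<le> norm (resolvent \<kappa> p x) + norm (resolvent \<kappa> (\<lambda>x. cnj (p x) * ((w x)\<^sup>2 / 2)) x)"
      unfolding G_def split[OF w] norm_minus_cancel by (rule norm_triangle_ineq)
    ultimately show ?thesis by simp
  qed
  have G_lip: "norm (G w x - G z x) \<le> 1/2 * d"
    if w: "continuous_on UNIV w" "\<And>x. norm (w x) \<le> 1/2" and z: "continuous_on UNIV z" "\<And>x. norm (z x) \<le> 1/2"
      and d: "\<And>x. norm (w x - z x) \<le> d" for w z x d
  proof -
    have eq: "resolvent \<kappa> (\<lambda>x. cnj (p x) * ((w x)\<^sup>2 / 2)) x - resolvent \<kappa> (\<lambda>x. cnj (p x) * ((z x)\<^sup>2 / 2)) x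
       = resolvent \<kappa> (\<lambda>x. cnj (p x) * (((w x)\<^sup>2 - (z x)\<^sup>2) / 2)) x"
    proof -
      obtain C where C: "continuous_on UNIV (\<lambda>x. cnj (p x) * ((w x)\<^sup>2 / 2))" "\<And>x. norm (cnj (p x) * ((w x)\<^sup>2 / 2)) \<le> C"
        using decaying_bounded_ex[OF riccati_source_decaying(1)[OF p w]] by blast
      obtain D where D: "continuous_on UNIV (\<lambda>x. - (cnj (p x) * ((z x)\<^sup>2 / 2)))" "\<And>x. norm (- (cnj (p x) * ((z x)\<^sup>2 / 2))) \<le> D"
        using decaying_bounded_ex[OF decaying_uminus[OF riccati_source_decaying(1)[OF p z]]] by blast
      have "(\<lambda>x. cnj (p x) * (((w x)\<^sup>2 - (z x)\<^sup>2) / 2)) = (\<lambda>x. cnj (p x) * ((w x)\<^sup>2 / 2) + - (cnj (p x) * ((z x)\<^sup>2 / 2)))"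
        by (intro ext) (simp add: field_simps)
      then show ?thesis using resolvent_add[OF \<kappa> C D] by (simp add: resolvent_uminus)
    qed
    have "norm (((w x)\<^sup>2 - (z x)\<^sup>2) / 2) \<le> d" for x
    proof -
      have "norm ((w x)\<^sup>2 - (z x)\<^sup>2) = norm (w x + z x) * norm (w x - z x)"
        by (simp add: norm_mult[symmetric] power2_eq_square algebra_simps)
      also have "\<dots> \<le> (norm (w x) + norm (z x)) * d" by (intro mult_mono norm_triangle_ineq d) auto
      also have "\<dots> \<le> 1 * d"
        by (intro mult_right_mono) (use w(2)[of x] z(2)[of x] order_trans[OF norm_ge_zero d[of 0]] in auto)
      finally show ?thesis using order_trans[OF norm_ge_zero d[of 0]] by (simp add: norm_divide)
    qed
    then have "norm (resolvent \<kappa> (\<lambda>x. cnj (p x) * (((w x)\<^sup>2 - (z x)\<^sup>2) / 2)) x) \<le> d / 4"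
      by (intro small_mass_resolvent[OF sm]) (use w z in \<open>auto intro!: continuous_intros\<close>)
    moreover have "G w x - G z x = - resolvent \<kappa> (\<lambda>x. cnj (p x) * (((w x)\<^sup>2 - (z x)\<^sup>2) / 2)) x"
      unfolding G_def split[OF w] split[OF z] eq[symmetric] by simp
    ultimately show ?thesis using order_trans[OF norm_ge_zero d[of 0]] by simp
  qed
  define \<Phi> where "\<Phi> w = Bcontfun (G (apply_bcontfun w))" for w :: "real \<Rightarrow>\<^sub>C complex"
  have \<Phi>: "apply_bcontfun (\<Phi> w) = G (apply_bcontfun w)" if "w \<in> ?S" for w
    unfolding \<Phi>_def using that S G_cont[of w] G_bound[of w]
    by (intro Bcontfun_inverse bcontfun_normI[where b="1/2"]) auto
  have "\<exists>!w\<in>?S. \<Phi> w = w"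
  proof (rule Banach_fix[where c="1/2", OF complete_eq_closed[THEN iffD2, OF closed_cball]])
    show "\<Phi> ` ?S \<subseteq> ?S"
    proof (rule image_subsetI)
      fix w assume w: "w \<in> ?S"
      then show "\<Phi> w \<in> ?S" using S[of w] G_bound[of w] by (subst S) (simp add: \<Phi>)
    qed
    show "dist (\<Phi> w) (\<Phi> z) \<le> 1/2 * dist w z" if w: "w \<in> ?S" and z: "z \<in> ?S" for w z
    proof (rule dist_bound)
      fix x
      show "dist (apply_bcontfun (\<Phi> w) x) (apply_bcontfun (\<Phi> z) x) \<le> 1/2 * dist w z"
        unfolding \<Phi>[OF w] \<Phi>[OF z] dist_norm[where 'a=complex]
        using w z S dist_bounded[of w _ z] by (intro G_lip) (auto simp: dist_norm[where 'a=complex])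
    qed
  qed auto
  then obtain w where w: "w \<in> ?S" "\<Phi> w = w" by blast
  then have eq: "apply_bcontfun w x = G (apply_bcontfun w) x" for x using \<Phi>[OF w(1)] by simp
  have "riccati_solution \<kappa> p (apply_bcontfun w)"
    unfolding riccati_solution_def using w(1) S[of w] eq unfolding G_def by blast
  then show ?thesis by blast
qed

lemma riccati_solution_decaying:
  assumes "decaying p" "\<kappa> > 0" "riccati_solution \<kappa> p w"
  shows "decaying w"
proof -
  have "w = (\<lambda>x. - resolvent \<kappa> (\<lambda>x. p x + cnj (p x) * ((w x)\<^sup>2 / 2)) x)"
    by (rule ext) (rule riccati_solutionD(3)[OF assms(3)])
  moreover have "decaying (\<lambda>x. - resolvent \<kappa> (\<lambda>x. p x + cnj (p x) * ((w x)\<^sup>2 / 2)) x)"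
    by (intro decaying_uminus resolvent_decaying riccati_source_decaying assms riccati_solutionD[OF assms(3)])
  ultimately show ?thesis by (rule ssubst[where P=decaying])
qed

lemma riccati_solution_derivative:
  assumes "decaying p" "\<kappa> > 0" "riccati_solution \<kappa> p w"
  shows "(w has_vector_derivative (- p x - cnj (p x) * (w x)\<^sup>2 / 2 - (2 * \<kappa>) *\<^sub>R w x)) (at x)"
proof -
  let ?g = "\<lambda>x. p x + cnj (p x) * ((w x)\<^sup>2 / 2)"
  have w: "w = (\<lambda>x. - resolvent \<kappa> ?g x)" by (rule ext) (rule riccati_solutionD(3)[OF assms(3)])
  have "decaying ?g" by (intro riccati_source_decaying assms riccati_solutionD[OF assms(3)])
  from decaying_resolvent_derivative[OF this assms(2)]
  have "((\<lambda>x. - resolvent \<kappa> ?g x) has_vector_derivative - (?g x - (2 * \<kappa>) *\<^sub>R resolvent \<kappa> ?g x)) (at x)"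
    by (rule has_vector_derivative_minus)
  also have "- (?g x - (2 * \<kappa>) *\<^sub>R resolvent \<kappa> ?g x) = - p x - cnj (p x) * (w x)\<^sup>2 / 2 - (2 * \<kappa>) *\<^sub>R (- resolvent \<kappa> ?g x)"
    by (simp add: algebra_simps)
  also have "- resolvent \<kappa> ?g x = w x" by (rule riccati_solutionD(3)[OF assms(3), symmetric])
  also have "(\<lambda>x. - resolvent \<kappa> ?g x) = w" by (rule w[symmetric])
  finally show ?thesis .
qed

text \<open>The squared norm of the derivative of \<open>resolvent \<kappa> p\<close>. On the Fourier side it weighs \<open>|p^|\<^sup>2\<close> by \<open>\<xi>\<^sup>2 / (4 \<kappa>\<^sup>2 + \<xi>\<^sup>2)\<close>, hence
essentially counts the frequencies above \<open>\<kappa>\<close>.\<close>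

definition resolvent_energy :: "real \<Rightarrow> (real \<Rightarrow> complex) \<Rightarrow> real" where
  "resolvent_energy \<kappa> p = (LINT x|lborel. (norm (p x - (2 * \<kappa>) *\<^sub>R resolvent \<kappa> p x))\<^sup>2)"

lemma resolvent_energy_eq:
  assumes "decaying p" "\<kappa> > 0"
  shows "(mass p) = resolvent_energy \<kappa> p + 4 * \<kappa>\<^sup>2 * (mass (resolvent \<kappa> p))"
    "(LINT x|lborel. inner (p x) (resolvent \<kappa> p x)) = 2 * \<kappa> * (mass (resolvent \<kappa> p))"
  unfolding resolvent_energy_def
  by (rule damped_energy_identity; use assms in \<open>auto intro: resolvent_decaying decaying_resolvent_derivative\<close>)+

text \<open>Split \<open>w = - R p - R g\<close> with \<open>R\<close> the resolvent and \<open>g\<close> the quadratic term. The linear part reproduces the energy \<open>E\<close> exactly.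
Multiplied by \<open>2 \<kappa>\<close>, the rest is at most \<open>M\<^sup>2 sup |w|\<^sup>2 / 2\<close>, by Cauchy-Schwarz and the energy identity for \<open>R g\<close>. Finally
\<open>sup |w|\<^sup>2\<close> is at most twice the bound \<open>M sqrt E / \<kappa>\<close> for \<open>|R p|\<^sup>2\<close>. The factor \<open>sqrt E\<close> gained in this way allows the
error to be absorbed into \<open>E\<close>, at the cost of a power of the mass.\<close>

lemma riccati_energy_estimate:
  assumes sm: "small_mass \<kappa> M p" and ric: "riccati_solution \<kappa> p w"
  shows "\<bar>resolvent_energy \<kappa> p - ((mass p) + 2 * \<kappa> * Re (LINT x|lborel. cnj (p x) * w x))\<bar>
    \<le> resolvent_energy \<kappa> p / 2 + M ^ 6 / (2 * \<kappa>\<^sup>2)"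
proof -
  have p: "decaying p" and \<kappa>: "\<kappa> > 0" and M0: "M \<ge> 0" and M: "(mass p) \<le> M\<^sup>2"
    using sm by (auto simp: small_mass_def)
  have w: "continuous_on UNIV w" "\<And>x. norm (w x) \<le> 1/2"
    and weq: "\<And>x. w x = - resolvent \<kappa> (\<lambda>x. p x + cnj (p x) * ((w x)\<^sup>2 / 2)) x"
    by (rule riccati_solutionD[OF ric])+
  define g where "g x = cnj (p x) * ((w x)\<^sup>2 / 2)" for x
  have g: "decaying g" unfolding g_def by (rule riccati_source_decaying(1)[OF p w])
  let ?R = "resolvent \<kappa>"
  have Rp: "decaying (?R p)" and Rg: "decaying (?R g)" by (intro resolvent_decaying \<kappa> p g)+
  have wsplit: "w x = - (?R p x + ?R g x)" for x
  proof -
    obtain C where C: "continuous_on UNIV p" "\<And>x. norm (p x) \<le> C" using decaying_bounded_ex[OF p] by blast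
    obtain D where D: "continuous_on UNIV g" "\<And>x. norm (g x) \<le> D" using decaying_bounded_ex[OF g] by blast
    show ?thesis using weq[of x] resolvent_add[OF \<kappa> C D, of x] unfolding g_def[abs_def] by simp
  qed
  define E where "E = resolvent_energy \<kappa> p"
  define m where "m = (mass p)"
  define n where "n = (mass (?R p))"
  define k where "k = (mass (?R g))"
  have E0: "E \<ge> 0" "n \<ge> 0" "k \<ge> 0" "m \<ge> 0" unfolding E_def resolvent_energy_def n_def k_def m_def by auto
  have mE: "m = E + 4 * \<kappa>\<^sup>2 * n" unfolding m_def E_def n_def by (rule resolvent_energy_eq[OF p \<kappa>])
  have "n \<le> (M / (2 * \<kappa>))\<^sup>2"
  proof -
    have "4 * \<kappa>\<^sup>2 * n \<le> M\<^sup>2" using mE E0 M by (simp add: m_def)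
    then show ?thesis using \<kappa> by (simp add: power_divide field_simps)
  qed
  have a: "(norm (?R p x))\<^sup>2 \<le> M * sqrt E / \<kappa>" for x
  proof -
    have "(norm (?R p x))\<^sup>2 \<le> 2 * sqrt (n * E)"
      unfolding n_def E_def resolvent_energy_def
      by (rule sup_norm_sq_le[OF Rp _ decaying_resolvent_derivative[OF p \<kappa>]])
         (unfold scaleR_conv_of_real, intro decaying_diff decaying_cmult p Rp)
    also have "\<dots> \<le> 2 * (M / (2 * \<kappa>) * sqrt E)"
      unfolding real_sqrt_mult using \<open>n \<le> (M / (2 * \<kappa>))\<^sup>2\<close> M0 \<kappa> E0
      by (intro mult_left_mono mult_right_mono real_le_lsqrt) auto
    finally show ?thesis using \<kappa> by simp
  qed
  define S where "S = (SUP x. norm (w x))"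
  have bdd: "bdd_above (range (\<lambda>x. norm (w x)))" using w(2) by (auto intro!: bdd_aboveI[where M="1/2"])
  have wS: "norm (w x) \<le> S" for x unfolding S_def by (rule cSUP_upper[OF UNIV_I bdd])
  have S0: "S \<ge> 0" using order_trans[OF norm_ge_zero wS[of 0]] .
  have S1: "S \<le> 1/2" unfolding S_def by (rule cSUP_least) (use w in auto)
  have w2S: "norm ((w x)\<^sup>2 / 2) \<le> S\<^sup>2 / 2" for x
    using power_mono[OF wS[of x], of 2] by (simp add: norm_divide norm_power)
  define a where "a = sqrt (M * sqrt E / \<kappa>)"
  have a0: "a \<ge> 0" using M0 \<kappa> E0 by (simp add: a_def)
  \<comment> \<open>The quadratic term contributes \<open>S\<^sup>2 / 8\<close>, and \<open>S \<le> 1/2\<close> turns this into a small multiple of \<open>S\<close>.\<close>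
  have "S \<le> a + S / 16"
    unfolding S_def
  proof (rule cSUP_least)
    fix x
    have "norm (w x) \<le> norm (?R p x) + norm (?R g x)" unfolding wsplit by (simp only: norm_minus_cancel norm_triangle_ineq)
    also have "norm (?R p x) \<le> a" unfolding a_def by (rule real_le_rsqrt[OF a])
    also have "norm (?R g x) \<le> (S\<^sup>2 / 2) / 4"
      unfolding g_def by (rule small_mass_resolvent[OF sm]) (use w w2S in \<open>auto intro!: continuous_intros\<close>)
    also have "\<dots> \<le> S / 16" using S0 S1 mult_right_mono[OF S1 S0] by (simp add: power2_eq_square)
    finally show "norm (w x) \<le> a + (SUP x. norm (w x)) / 16" by (simp add: S_def)
  qed auto
  then have "S \<le> 16/15 * a" by simp
  then have "S\<^sup>2 \<le> (16/15 * a)\<^sup>2" using S0 by (rule power_mono)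
  also have "\<dots> \<le> 2 * a\<^sup>2" by (simp add: power_mult_distrib power2_eq_square)
  also have "a\<^sup>2 = M * sqrt E / \<kappa>" unfolding a_def using M0 \<kappa> E0 by simp
  finally have S2: "S\<^sup>2 \<le> 2 * (M * sqrt E / \<kappa>)" .
  have kk: "4 * \<kappa>\<^sup>2 * k \<le> (M * (S\<^sup>2 / 2))\<^sup>2"
  proof -
    have "4 * \<kappa>\<^sup>2 * k \<le> (mass g)"
      unfolding k_def resolvent_energy_eq(1)[OF g \<kappa>] by (simp add: resolvent_energy_def)
    also have "\<dots> \<le> (LINT x|lborel. (norm (p x))\<^sup>2 * (S\<^sup>2 / 2)\<^sup>2)"
    proof (rule integral_mono)
      show "integrable lborel (\<lambda>x. (norm (g x))\<^sup>2)" by (rule decaying_norm_sq_integrable[OF g])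
      show "integrable lborel (\<lambda>x. (norm (p x))\<^sup>2 * (S\<^sup>2 / 2)\<^sup>2)" by (intro integrable_mult_left decaying_norm_sq_integrable p)
      show "(norm (g x))\<^sup>2 \<le> (norm (p x))\<^sup>2 * (S\<^sup>2 / 2)\<^sup>2" for x
        unfolding g_def norm_mult power_mult_distrib complex_mod_cnj
        by (intro mult_left_mono power_mono w2S) auto
    qed
    also have "\<dots> = m * (S\<^sup>2 / 2)\<^sup>2" by (simp add: m_def)
    also have "\<dots> \<le> M\<^sup>2 * (S\<^sup>2 / 2)\<^sup>2" using M by (intro mult_right_mono) (auto simp: m_def)
    finally show ?thesis by (simp only: power_mult_distrib)
  qed
  have rem: "2 * \<kappa> * \<bar>LINT x|lborel. inner (p x) (?R g x)\<bar> \<le> E / 2 + M ^ 6 / (2 * \<kappa>\<^sup>2)"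
  proof -
    have [measurable]: "p \<in> borel_measurable borel" "?R g \<in> borel_measurable borel"
      using p Rg by (auto intro: decaying_measurable)
    have ipg: "integrable lborel (\<lambda>x. inner (p x) (?R g x))" by (rule decaying_inner_integrable[OF p Rg])
    have inn: "integrable lborel (\<lambda>x. norm (p x) * norm (?R g x))"
      using integrable_norm[OF decaying_integrable[OF decaying_mult[OF p Rg]]] by (simp add: norm_mult)
    have "\<bar>LINT x|lborel. inner (p x) (?R g x)\<bar> \<le> (LINT x|lborel. \<bar>inner (p x) (?R g x)\<bar>)" by (rule integral_abs_bound)
    also have "\<dots> \<le> (LINT x|lborel. \<bar>norm (p x) * norm (?R g x)\<bar>)"
      by (rule integral_mono) (use ipg inn Cauchy_Schwarz_ineq2 in \<open>auto simp: abs_mult\<close>)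
    finally have "\<bar>LINT x|lborel. inner (p x) (?R g x)\<bar>\<^sup>2 \<le> (LINT x|lborel. \<bar>norm (p x) * norm (?R g x)\<bar>)\<^sup>2"
      by (rule power_mono) simp
    also have "\<dots> \<le> m * k" unfolding m_def k_def
      by (rule Cauchy_Schwarz_integral(2)) (auto intro: decaying_norm_sq_integrable p Rg)
    finally have i: "\<bar>LINT x|lborel. inner (p x) (?R g x)\<bar>\<^sup>2 \<le> m * k" .
    have "(2 * \<kappa> * \<bar>LINT x|lborel. inner (p x) (?R g x)\<bar>)\<^sup>2 = 4 * \<kappa>\<^sup>2 * \<bar>LINT x|lborel. inner (p x) (?R g x)\<bar>\<^sup>2"
      by (simp add: power_mult_distrib)
    also have "\<dots> \<le> 4 * \<kappa>\<^sup>2 * (m * k)" by (intro mult_left_mono i) simp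
    also have "\<dots> = m * (4 * \<kappa>\<^sup>2 * k)" by simp
    also have "\<dots> \<le> M\<^sup>2 * (M * (S\<^sup>2 / 2))\<^sup>2" by (intro mult_mono kk) (use M E0 \<kappa> in \<open>auto simp: m_def\<close>)
    also have "\<dots> = (M * (M * (S\<^sup>2 / 2)))\<^sup>2" by (simp only: power_mult_distrib)
    finally have "2 * \<kappa> * \<bar>LINT x|lborel. inner (p x) (?R g x)\<bar> \<le> M * (M * (S\<^sup>2 / 2))"
      by (rule power2_le_imp_le) (use M0 in auto)
    also have "\<dots> \<le> M * (M * (M * sqrt E / \<kappa>))" by (intro mult_left_mono M0) (use S2 in linarith)
    also have "\<dots> = (M ^ 3 / \<kappa>) * sqrt E" by (simp add: power3_eq_cube)
    also have "\<dots> \<le> ((M ^ 3 / \<kappa>)\<^sup>2 + (sqrt E)\<^sup>2) / 2"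
    proof -
      have "a * b \<le> (a\<^sup>2 + b\<^sup>2) / 2" for a b :: real using sum_squares_bound[of a b] by simp
      then show ?thesis .
    qed
    also have "\<dots> = E / 2 + M ^ 6 / (2 * \<kappa>\<^sup>2)" using E0 by (simp add: power_divide add_divide_distrib flip: power_mult)
    finally show ?thesis .
  qed
  have "Re (LINT x|lborel. cnj (p x) * w x) = (LINT x|lborel. Re (cnj (p x) * w x))"
  proof -
    have "integrable lborel (\<lambda>x. cnj (p x) * w x)"
      by (intro decaying_integrable decaying_mult_bounded[where B="1/2"] decaying_cnj p w)
    then show ?thesis by (rule integral_Re[symmetric])
  qed
  also have "\<dots> = (LINT x|lborel. - inner (p x) (?R p x) - inner (p x) (?R g x))"
    by (rule Bochner_Integration.integral_cong) (simp_all add: wsplit inner_complex_def algebra_simps)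
  also have "\<dots> = - (LINT x|lborel. inner (p x) (?R p x)) - (LINT x|lborel. inner (p x) (?R g x))"
    using decaying_inner_integrable[OF p Rp] decaying_inner_integrable[OF p Rg] by simp
  also have "(LINT x|lborel. inner (p x) (?R p x)) = 2 * \<kappa> * n"
    unfolding n_def by (rule resolvent_energy_eq(2)[OF p \<kappa>])
  finally have A: "Re (LINT x|lborel. cnj (p x) * w x) = - (2 * \<kappa> * n) - (LINT x|lborel. inner (p x) (?R g x))" .
  have "E - (m + 2 * \<kappa> * Re (LINT x|lborel. cnj (p x) * w x)) = 2 * \<kappa> * (LINT x|lborel. inner (p x) (?R g x))"
    unfolding A mE by (simp add: power2_eq_square algebra_simps)
  then have "\<bar>E - (m + 2 * \<kappa> * Re (LINT x|lborel. cnj (p x) * w x))\<bar> = 2 * \<kappa> * \<bar>LINT x|lborel. inner (p x) (?R g x)\<bar>"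
    using \<kappa> by (simp add: abs_mult)
  with rem show ?thesis by (simp add: E_def m_def)
qed

section \<open>Conservation laws of Schwartz solutions\<close>

text \<open>The derivatives of a Schwartz solution that the conservation laws involve; \<open>vtt\<close> serves only to bound the second-order
Taylor remainder in time.\<close>

locale nls_flow =
  fixes v vt vtt vx vxx :: "real \<Rightarrow> real \<Rightarrow> complex"
  assumes v_t: "\<And>t x. ((\<lambda>\<tau>. v \<tau> x) has_vector_derivative vt t x) (at t)"
    and vt_t: "\<And>t x. ((\<lambda>\<tau>. vt \<tau> x) has_vector_derivative vtt t x) (at t)"
    and v_x: "\<And>t x. (v t has_vector_derivative vx t x) (at x)"
    and vx_x: "\<And>t x. (vx t has_vector_derivative vxx t x) (at x)"
    and vxx_continuous: "\<And>t. continuous_on UNIV (vxx t)"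
    and uniform_decay: "\<And>T. \<exists>B. \<forall>t\<in>{-T..T}. \<forall>x. norm (v t x) \<le> B / (1 + x\<^sup>2) \<and> norm (vt t x) \<le> B / (1 + x\<^sup>2)
        \<and> norm (vtt t x) \<le> B / (1 + x\<^sup>2) \<and> norm (vx t x) \<le> B / (1 + x\<^sup>2) \<and> norm (vxx t x) \<le> B / (1 + x\<^sup>2)"
    and nls: "\<And>t x. vt t x = \<i> * vxx t x + \<i> * (v t x * cnj (v t x)) * v t x"

lemma schwartz_nls_solution_flow:
  assumes "schwartz_nls_solution v"
  obtains vt vtt vx vxx where "nls_flow v vt vtt vx vxx"
proof -
  obtain D where D0: "D 0 0 = v"
    and Dt: "\<And>j m t x. ((\<lambda>\<tau>. D j m \<tau> x) has_vector_derivative D (Suc j) m t x) (at t)"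
    and Dx: "\<And>j m t x. ((\<lambda>y. D j m t y) has_vector_derivative D j (Suc m) t x) (at x)"
    and Db: "\<And>j m k T. \<exists>M. \<forall>t\<in>{-T..T}. \<forall>x. \<bar>x\<bar> ^ k * norm (D j m t x) \<le> M"
    and eq: "\<And>t x. \<i> * vector_derivative (\<lambda>\<tau>. v \<tau> x) (at t)
            + vector_derivative (\<lambda>y. vector_derivative (\<lambda>z. v t z) (at y)) (at x)
          = - (complex_of_real ((norm (v t x))\<^sup>2) * v t x)"
    using assms unfolding schwartz_nls_solution_def schwartz_flow_def by metis
  have decay: "\<exists>B. \<forall>t\<in>{-T..T}. \<forall>x. norm (D j m t x) \<le> B / (1 + x\<^sup>2)" for j m T
  proof -
    obtain M where M: "\<And>t x. t \<in> {-T..T} \<Longrightarrow> \<bar>x\<bar> ^ 0 * norm (D j m t x) \<le> M" using Db[where k=0] by blast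
    obtain N where N: "\<And>t x. t \<in> {-T..T} \<Longrightarrow> \<bar>x\<bar> ^ 2 * norm (D j m t x) \<le> N" using Db[where k=2] by blast
    have "norm (D j m t x) \<le> (M + N) / (1 + x\<^sup>2)" if "t \<in> {-T..T}" for t x
    proof -
      have "(1 + x\<^sup>2) * norm (D j m t x) \<le> M + N" using M[OF that, of x] N[OF that, of x] by (simp add: distrib_right)
      moreover have "0 < 1 + x\<^sup>2" by (simp add: add_pos_nonneg)
      ultimately show ?thesis by (simp add: field_simps)
    qed
    then show ?thesis by blast
  qed
  have "nls_flow v (D 1 0) (D 2 0) (D 0 1) (D 0 2)"
  proof
    show "((\<lambda>\<tau>. v \<tau> x) has_vector_derivative D 1 0 t x) (at t)" for t x using Dt[of 0 0 x t] D0 by simp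
    show "((\<lambda>\<tau>. D 1 0 \<tau> x) has_vector_derivative D 2 0 t x) (at t)" for t x using Dt[of 1 0 x t] by (simp add: numeral_2_eq_2)
    show vx: "(v t has_vector_derivative D 0 1 t x) (at x)" for t x using Dx[of 0 0 t x] D0 by simp
    show vxx: "(D 0 1 t has_vector_derivative D 0 2 t x) (at x)" for t x using Dx[of 0 1 t x] by (simp add: numeral_2_eq_2)
    show "continuous_on UNIV (D 0 2 t)" for t
      using has_vector_derivative_continuous[OF Dx[of 0 2 t]] by (simp add: continuous_on_eq_continuous_at)
    show "\<exists>B. \<forall>t\<in>{-T..T}. \<forall>x. norm (v t x) \<le> B / (1 + x\<^sup>2) \<and> norm (D 1 0 t x) \<le> B / (1 + x\<^sup>2)
        \<and> norm (D 2 0 t x) \<le> B / (1 + x\<^sup>2) \<and> norm (D 0 1 t x) \<le> B / (1 + x\<^sup>2) \<and> norm (D 0 2 t x) \<le> B / (1 + x\<^sup>2)" for T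
    proof -
      obtain B1 where B1: "\<forall>t\<in>{-T..T}. \<forall>x. norm (D 0 0 t x) \<le> B1 / (1 + x\<^sup>2)" using decay[of T 0 0] ..
      obtain B2 where B2: "\<forall>t\<in>{-T..T}. \<forall>x. norm (D 1 0 t x) \<le> B2 / (1 + x\<^sup>2)" using decay[of T 1 0] ..
      obtain B3 where B3: "\<forall>t\<in>{-T..T}. \<forall>x. norm (D 2 0 t x) \<le> B3 / (1 + x\<^sup>2)" using decay[of T 2 0] ..
      obtain B4 where B4: "\<forall>t\<in>{-T..T}. \<forall>x. norm (D 0 1 t x) \<le> B4 / (1 + x\<^sup>2)" using decay[of T 0 1] ..
      obtain B5 where B5: "\<forall>t\<in>{-T..T}. \<forall>x. norm (D 0 2 t x) \<le> B5 / (1 + x\<^sup>2)" using decay[of T 0 2] ..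
      note B = B1 B2 B3 B4 B5
      define B where "B = max B1 (max B2 (max B3 (max B4 B5)))"
      have le: "n \<le> B / (1 + x\<^sup>2)" if "n \<le> b / (1 + x\<^sup>2)" "b \<le> B" for n b x :: real
        using that(1) by (rule order_trans) (intro divide_right_mono that(2), simp)
      have "b \<le> B" if "b \<in> {B1, B2, B3, B4, B5}" for b using that by (auto simp: B_def)
      then have leB: "B1 \<le> B" "B2 \<le> B" "B3 \<le> B" "B4 \<le> B" "B5 \<le> B" by auto
      show ?thesis
      proof (intro exI[of _ B] ballI allI)
        fix t x assume t: "t \<in> {-T..T}"
        show "norm (v t x) \<le> B / (1 + x\<^sup>2) \<and> norm (D 1 0 t x) \<le> B / (1 + x\<^sup>2)
          \<and> norm (D 2 0 t x) \<le> B / (1 + x\<^sup>2) \<and> norm (D 0 1 t x) \<le> B / (1 + x\<^sup>2) \<and> norm (D 0 2 t x) \<le> B / (1 + x\<^sup>2)"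
          by (intro conjI) (rule le[OF B(1)[rule_format, OF t, unfolded D0] leB(1)] le[OF B(2)[rule_format, OF t] leB(2)]
             le[OF B(3)[rule_format, OF t] leB(3)] le[OF B(4)[rule_format, OF t] leB(4)] le[OF B(5)[rule_format, OF t] leB(5)])+
      qed
    qed
    show "D 1 0 t x = \<i> * D 0 2 t x + \<i> * (v t x * cnj (v t x)) * v t x" for t x
    proof -
      have 1: "vector_derivative (\<lambda>\<tau>. v \<tau> x) (at t) = D 1 0 t x"
        using Dt[of 0 0 x t] D0 by (intro vector_derivative_at) simp
      have 2: "(\<lambda>y. vector_derivative (\<lambda>z. v t z) (at y)) = D 0 1 t"
        using vx by (intro ext vector_derivative_at) simp
      have 3: "vector_derivative (D 0 1 t) (at x) = D 0 2 t x" using vxx by (intro vector_derivative_at) simp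
      have e: "\<i> * D 1 0 t x + D 0 2 t x = - ((v t x * cnj (v t x)) * v t x)"
        using eq[of x t] unfolding 1 2 3 complex_norm_square .
      have "D 1 0 t x = - \<i> * (\<i> * D 1 0 t x + D 0 2 t x) + \<i> * D 0 2 t x" by (simp add: algebra_simps)
      then show ?thesis unfolding e by (simp add: algebra_simps)
    qed
  qed
  then show ?thesis by (rule that)
qed

lemma lipschitz_of_derivative_bound:
  fixes f :: "real \<Rightarrow> complex"
  assumes "\<And>t. t \<in> S \<Longrightarrow> (f has_vector_derivative f' t) (at t)" "\<And>t. t \<in> S \<Longrightarrow> norm (f' t) \<le> B"
    and "convex S" "a \<in> S" "b \<in> S"
  shows "norm (f b - f a) \<le> B * \<bar>b - a\<bar>"
  unfolding real_norm_def[symmetric]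
proof (rule differentiable_bound[where S=S and f'="\<lambda>x h. h *\<^sub>R f' x"])
  fix x assume x: "x \<in> S"
  show "(f has_derivative (\<lambda>h. h *\<^sub>R f' x)) (at x within S)"
    using assms(1)[OF x] unfolding has_vector_derivative_def by (rule has_derivative_at_withinI)
  have "norm (h *\<^sub>R f' x) \<le> B * norm h" for h :: real
    using mult_left_mono[OF assms(2)[OF x], of "\<bar>h\<bar>"] by (simp add: mult.commute)
  then show "onorm (\<lambda>h. h *\<^sub>R f' x) \<le> B" by (rule onorm_le)
qed (use assms in auto)

lemma quadratic_remainder:
  fixes f :: "real \<Rightarrow> complex"
  assumes f: "\<And>t. (f has_vector_derivative f' t) (at t)" and f': "\<And>t. (f' has_vector_derivative f'' t) (at t)"
    and B: "\<And>t. t \<in> {-T..T} \<Longrightarrow> norm (f'' t) \<le> B" and t: "t \<in> {-T..T}" "t' \<in> {-T..T}"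
  shows "norm (f t' - f t - (t' - t) *\<^sub>R f' t) \<le> B * (t' - t)\<^sup>2"
proof -
  have cs: "closed_segment t t' \<subseteq> {-T..T}" using t by (intro closed_segment_subset) auto
  have d: "norm (f' \<tau> - f' t) \<le> B * \<bar>t' - t\<bar>" if \<tau>: "\<tau> \<in> closed_segment t t'" for \<tau>
  proof -
    have "norm (f' \<tau> - f' t) \<le> B * \<bar>\<tau> - t\<bar>"
      by (rule lipschitz_of_derivative_bound[where S="closed_segment t t'", OF f' B]) (use \<tau> cs in auto)
    also have "\<dots> \<le> B * \<bar>t' - t\<bar>"
      by (rule mult_left_mono) (use \<tau> order_trans[OF norm_ge_zero B[OF t(1)]] in \<open>auto simp: closed_segment_eq_real_ivl split: if_splits\<close>)
    finally show ?thesis .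
  qed
  have "norm ((f t' - t' *\<^sub>R f' t) - (f t - t *\<^sub>R f' t)) \<le> (B * \<bar>t' - t\<bar>) * \<bar>t' - t\<bar>"
  proof (rule lipschitz_of_derivative_bound[where S="closed_segment t t'" and f'="\<lambda>x. f' x - f' t"])
    fix x assume x: "x \<in> closed_segment t t'"
    show "((\<lambda>t'. f t' - t' *\<^sub>R f' t) has_vector_derivative (f' x - f' t)) (at x)"
      by (auto intro!: derivative_eq_intros f)
    show "norm (f' x - f' t) \<le> B * \<bar>t' - t\<bar>" by (rule d[OF x])
  qed auto
  then show ?thesis by (simp add: power2_eq_square algebra_simps abs_mult_self_eq)
qed

text \<open>A local conservation law \<open>\<partial>\<^sub>t \<Phi> = \<partial>\<^sub>x J\<close> in difference form. The time derivative enters only as a first-order expansion with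
quadratic error, because for the Riccati function such an expansion follows directly from stability, whereas
differentiability with respect to the parameter \<open>t\<close> would need an argument of its own.\<close>

lemma conserved_integral:
  fixes \<Phi> G J :: "real \<Rightarrow> real \<Rightarrow> complex"
  assumes \<Phi>: "\<And>t. decaying (\<Phi> t)" and G: "\<And>t. decaying (G t)"
    and J: "\<And>t x. (J t has_vector_derivative G t x) (at x)" "\<And>t. (J t \<longlongrightarrow> 0) at_bot" "\<And>t. (J t \<longlongrightarrow> 0) at_top"
    and approx: "\<And>t. \<exists>C. \<forall>\<^sub>F t' in at t. \<forall>x. norm (\<Phi> t' x - \<Phi> t x - (t' - t) *\<^sub>R G t x) \<le> C * (t' - t)\<^sup>2 / (1 + x\<^sup>2)"
  shows "(LINT x|lborel. \<Phi> t x) = (LINT x|lborel. \<Phi> 0 x)"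
proof -
  define I where "I t = (LINT x|lborel. \<Phi> t x)" for t
  define W where "W = (LINT x|lborel. 1 / (1 + x\<^sup>2 :: real))"
  have "(I has_vector_derivative 0) (at t)" for t
  proof -
    obtain C where C: "\<forall>\<^sub>F t' in at t. \<forall>x. norm (\<Phi> t' x - \<Phi> t x - (t' - t) *\<^sub>R G t x) \<le> C * (t' - t)\<^sup>2 / (1 + x\<^sup>2)"
      using approx by blast
    have G0: "(LINT x|lborel. G t x) = 0"
      by (rule integral_derivative_line[OF J(1) decaying_continuous[OF G] decaying_integrable[OF G] J(2,3)])
    have "\<forall>\<^sub>F t' in at t. norm (norm (I t' - I t) / \<bar>t' - t\<bar>) \<le> C * W * \<bar>t' - t\<bar>"
      using C eventually_neq_at_within[of t t UNIV]
    proof eventually_elim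
      case (elim t')
      have i: "integrable lborel (\<lambda>x. \<Phi> t' x - \<Phi> t x - (t' - t) *\<^sub>R G t x)"
        by (intro Bochner_Integration.integrable_diff integrable_scaleR_right decaying_integrable \<Phi> G)
      have "I t' - I t = (LINT x|lborel. \<Phi> t' x - \<Phi> t x - (t' - t) *\<^sub>R G t x)"
        unfolding I_def using decaying_integrable[OF \<Phi>] decaying_integrable[OF G] G0 by simp
      also have "norm \<dots> \<le> (LINT x|lborel. C * (t' - t)\<^sup>2 * (1 / (1 + x\<^sup>2)))"
      proof (rule order_trans[OF integral_norm_bound integral_mono[OF integrable_norm[OF i]]])
        show "integrable lborel (\<lambda>x. C * (t' - t)\<^sup>2 * (1 / (1 + x\<^sup>2)))"
          by (intro integrable_mult_right integrable_decay_weight)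
        show "norm (\<Phi> t' x - \<Phi> t x - (t' - t) *\<^sub>R G t x) \<le> C * (t' - t)\<^sup>2 * (1 / (1 + x\<^sup>2))" for x
          using elim(1)[rule_format, of x] by simp
      qed
      also have "\<dots> = C * (t' - t)\<^sup>2 * W" unfolding W_def by (rule integral_mult_right_zero)
      finally have le: "norm (I t' - I t) \<le> C * (t' - t)\<^sup>2 * W" .
      have "norm (I t' - I t) / \<bar>t' - t\<bar> \<le> C * (t' - t)\<^sup>2 * W / \<bar>t' - t\<bar>" by (intro divide_right_mono le) simp
      also have "\<dots> = C * W * \<bar>t' - t\<bar>" using elim by (auto simp: power2_eq_square abs_if field_simps)
      finally show ?case by simp
    qed
    moreover have "((\<lambda>t'. C * W * \<bar>t' - t\<bar>) \<longlongrightarrow> 0) (at t)"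
      by (rule tendsto_eq_intros refl)+ simp
    ultimately have "((\<lambda>t'. norm (I t' - I t) / \<bar>t' - t\<bar>) \<longlongrightarrow> 0) (at t)" by (rule Lim_null_comparison)
    then show ?thesis
      unfolding has_vector_derivative_def has_derivative_iff_norm by simp
  qed
  then obtain c where "\<And>t. I t = c"
    using has_vector_derivative_zero_constant[of UNIV I] by auto
  then show ?thesis by (simp add: I_def)
qed

context nls_flow
begin

lemma local_bounds:
  "\<exists>B\<ge>0. \<forall>t\<in>{-T..T}. \<forall>x. norm (v t x) \<le> B / (1 + x\<^sup>2) \<and> norm (vt t x) \<le> B / (1 + x\<^sup>2) \<and>
     norm (vx t x) \<le> B / (1 + x\<^sup>2) \<and> norm (vxx t x) \<le> B / (1 + x\<^sup>2) \<and>
     (\<forall>t'\<in>{-T..T}. norm (v t' x - v t x) \<le> B / (1 + x\<^sup>2) * \<bar>t' - t\<bar> \<and>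
       norm (v t' x - v t x - (t' - t) *\<^sub>R vt t x) \<le> B / (1 + x\<^sup>2) * (t' - t)\<^sup>2)"
proof -
  obtain B where B: "\<forall>t\<in>{-T..T}. \<forall>x. norm (v t x) \<le> B / (1 + x\<^sup>2) \<and> norm (vt t x) \<le> B / (1 + x\<^sup>2)
        \<and> norm (vtt t x) \<le> B / (1 + x\<^sup>2) \<and> norm (vx t x) \<le> B / (1 + x\<^sup>2) \<and> norm (vxx t x) \<le> B / (1 + x\<^sup>2)"
    using uniform_decay by blast
  define B' where "B' = max B 0"
  have le: "B / (1 + x\<^sup>2) \<le> B' / (1 + x\<^sup>2)" for x by (intro divide_right_mono) (auto simp: B'_def)
  have B': "norm (v t x) \<le> B' / (1 + x\<^sup>2)" "norm (vt t x) \<le> B' / (1 + x\<^sup>2)"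
     "norm (vtt t x) \<le> B' / (1 + x\<^sup>2)" "norm (vx t x) \<le> B' / (1 + x\<^sup>2)" "norm (vxx t x) \<le> B' / (1 + x\<^sup>2)"
     if t: "t \<in> {-T..T}" for t x
    using B[rule_format, OF t, of x] le[of x] by linarith+
  have lip: "norm (v t' x - v t x) \<le> B' / (1 + x\<^sup>2) * \<bar>t' - t\<bar>" if t: "t \<in> {-T..T}" "t' \<in> {-T..T}" for t t' x
    by (rule lipschitz_of_derivative_bound[where S="{-T..T}", OF v_t B'(2) _ t]) auto
  have quad: "norm (v t' x - v t x - (t' - t) *\<^sub>R vt t x) \<le> B' / (1 + x\<^sup>2) * (t' - t)\<^sup>2" if t: "t \<in> {-T..T}" "t' \<in> {-T..T}" for t t' x
    by (rule quadratic_remainder[where T=T, OF v_t vt_t _ t]) (rule B'(3))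
  show ?thesis by (intro exI[of _ B'] conjI ballI allI B' lip quad) (auto simp: B'_def)
qed

lemma v_decaying: "decaying (v t)" and vx_decaying: "decaying (vx t)" and vxx_decaying: "decaying (vxx t)"
  and vt_decaying: "decaying (vt t)"
proof -
  obtain B where B: "\<And>x. norm (v t x) \<le> B / (1 + x\<^sup>2)" "\<And>x. norm (vx t x) \<le> B / (1 + x\<^sup>2)" "\<And>x. norm (vxx t x) \<le> B / (1 + x\<^sup>2)"
  proof -
    have "t \<in> {-\<bar>t\<bar>..\<bar>t\<bar>}" by auto
    then show ?thesis using that local_bounds[of "\<bar>t\<bar>"] by blast
  qed
  show v: "decaying (v t)"
    by (rule decayingI[OF _ B(1)]) (use has_vector_derivative_continuous[OF v_x] in \<open>simp add: continuous_on_eq_continuous_at\<close>)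
  show "decaying (vx t)"
    by (rule decayingI[OF _ B(2)]) (use has_vector_derivative_continuous[OF vx_x] in \<open>simp add: continuous_on_eq_continuous_at\<close>)
  show xx: "decaying (vxx t)" by (rule decayingI[OF vxx_continuous B(3)])
  show "decaying (vt t)"
  proof -
    have "vt t = (\<lambda>x. \<i> * vxx t x + \<i> * (v t x * cnj (v t x)) * v t x)" by (intro ext nls)
    then show ?thesis using v xx by (auto intro!: decaying_add decaying_mult decaying_cmult decaying_cnj)
  qed
qed

lemma eventually_in_window: "\<forall>\<^sub>F t' in at (t :: real). t' \<in> {-(\<bar>t\<bar> + 1)..\<bar>t\<bar> + 1} \<and> \<bar>t' - t\<bar> \<le> 1"
proof -
  have "\<forall>\<^sub>F t' in at t. dist t' t < 1" unfolding eventually_at by (intro exI[of _ 1]) auto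
  then show ?thesis by eventually_elim (auto simp: dist_real_def)
qed

text \<open>The flux of \<open>|v|\<^sup>2\<close> is \<open>\<i> (vx (cnj v) - v (cnj vx))\<close>; the nonlinear terms cancel since the nonlinearity is a real multiple of
\<open>\<i> v\<close>.\<close>

lemma mass_conserved: "(mass (v t)) = (mass (v 0))"
proof -
  let ?\<Phi> = "\<lambda>t x. v t x * cnj (v t x)"
  let ?G = "\<lambda>t x. vt t x * cnj (v t x) + v t x * cnj (vt t x)"
  let ?J = "\<lambda>t x. \<i> * (vx t x * cnj (v t x) - v t x * cnj (vx t x))"
  have "(LINT x|lborel. ?\<Phi> t x) = (LINT x|lborel. ?\<Phi> 0 x)"
  proof (rule conserved_integral[where G="?G" and J="?J"])
    show "decaying (?\<Phi> t)" for t by (intro decaying_mult decaying_cnj v_decaying)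
    show "decaying (?G t)" for t by (intro decaying_add decaying_mult decaying_cnj v_decaying vt_decaying)
    have J: "decaying (?J t)" for t by (intro decaying_cmult decaying_diff decaying_mult decaying_cnj v_decaying vx_decaying)
    show "(?J t \<longlongrightarrow> 0) at_bot" "(?J t \<longlongrightarrow> 0) at_top" for t by (rule decaying_tendsto_0[OF J])+
    show "(?J t has_vector_derivative ?G t x) (at x)" for t x
    proof -
      have "(?J t has_vector_derivative \<i> * ((vx t x * cnj (vx t x) + vxx t x * cnj (v t x)) - (v t x * cnj (vxx t x) + vx t x * cnj (vx t x)))) (at x)"
        by (intro has_vector_derivative_mult_right has_vector_derivative_diff has_vector_derivative_mult has_vector_derivative_cnj v_x vx_x)
      then show ?thesis unfolding nls by (simp add: algebra_simps)
    qed
    fix t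
    obtain B where B: "B \<ge> 0" "\<And>t' x. t' \<in> {-(\<bar>t\<bar> + 1)..\<bar>t\<bar> + 1} \<Longrightarrow> norm (v t' x) \<le> B / (1 + x\<^sup>2)"
      "\<And>t' x. t' \<in> {-(\<bar>t\<bar> + 1)..\<bar>t\<bar> + 1} \<Longrightarrow> norm (vt t' x) \<le> B / (1 + x\<^sup>2)"
      "\<And>t' x. t' \<in> {-(\<bar>t\<bar> + 1)..\<bar>t\<bar> + 1} \<Longrightarrow> norm (v t' x - v t x) \<le> B / (1 + x\<^sup>2) * \<bar>t' - t\<bar>"
      "\<And>t' x. t' \<in> {-(\<bar>t\<bar> + 1)..\<bar>t\<bar> + 1} \<Longrightarrow> norm (v t' x - v t x - (t' - t) *\<^sub>R vt t x) \<le> B / (1 + x\<^sup>2) * (t' - t)\<^sup>2"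
    proof -
      have "t \<in> {-(\<bar>t\<bar> + 1)..\<bar>t\<bar> + 1}" by auto
      then show ?thesis using that local_bounds[of "\<bar>t\<bar> + 1"] by blast
    qed
    have "\<forall>\<^sub>F t' in at t. \<forall>x. norm (?\<Phi> t' x - ?\<Phi> t x - (t' - t) *\<^sub>R ?G t x) \<le> 3 * B\<^sup>2 * (t' - t)\<^sup>2 / (1 + x\<^sup>2)"
      using eventually_in_window
    proof eventually_elim
      case (elim t')
      show ?case
      proof
        fix x
        have tt: "t \<in> {-(\<bar>t\<bar> + 1)..\<bar>t\<bar> + 1}" by auto
        define b where "b = B / (1 + x\<^sup>2)"
        have b: "0 \<le> b" "b \<le> B" unfolding b_def using B(1) by (auto simp: add_nonneg_nonneg divide_le_eq add_pos_nonneg mult_le_cancel_left1)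
        define h where "h = t' - t"
        define q where "q = v t' x - v t x - h *\<^sub>R vt t x"
        have q: "norm q \<le> b * h\<^sup>2" using B(5)[of t' x] elim by (simp add: q_def h_def b_def)
        have d: "norm (v t' x - v t x) \<le> b * \<bar>h\<bar>" using B(4)[of t' x] elim by (simp add: h_def b_def)
        have "?\<Phi> t' x - ?\<Phi> t x - h *\<^sub>R ?G t x = q * cnj (v t' x) + h *\<^sub>R (vt t x * cnj (v t' x - v t x)) + v t x * cnj q"
          by (simp add: q_def scaleR_conv_of_real algebra_simps)
        also have "norm \<dots> \<le> norm (q * cnj (v t' x)) + norm (h *\<^sub>R (vt t x * cnj (v t' x - v t x))) + norm (v t x * cnj q)"
          by (intro norm_triangle_le add_right_mono norm_triangle_ineq)
        also have "norm (q * cnj (v t' x)) \<le> (b * h\<^sup>2) * B"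
          unfolding norm_mult by (intro mult_mono q) (use B(2)[of t' x] elim b in \<open>auto simp: b_def\<close>)
        also have "norm (h *\<^sub>R (vt t x * cnj (v t' x - v t x))) \<le> \<bar>h\<bar> * (B * (b * \<bar>h\<bar>))"
          unfolding norm_scaleR norm_mult complex_mod_cnj
          by (intro mult_left_mono mult_mono d) (use B(3)[OF tt, of x] B(1) b in \<open>auto simp: b_def\<close>)
        also have "norm (v t x * cnj q) \<le> B * (b * h\<^sup>2)"
          unfolding norm_mult complex_mod_cnj by (intro mult_mono q) (use B(1,2) B(2)[OF tt, of x] b in \<open>auto simp: b_def\<close>)
        also have "\<bar>h\<bar> * (B * (b * \<bar>h\<bar>)) = B * (b * h\<^sup>2)"
          by (simp only: abs_mult_self_eq[of h, symmetric] power2_eq_square mult_ac)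
        also have "(b * h\<^sup>2) * B + B * (b * h\<^sup>2) + B * (b * h\<^sup>2) = 3 * B\<^sup>2 * h\<^sup>2 / (1 + x\<^sup>2)"
          by (simp add: b_def power2_eq_square)
        finally show "norm (?\<Phi> t' x - ?\<Phi> t x - (t' - t) *\<^sub>R ?G t x) \<le> 3 * B\<^sup>2 * (t' - t)\<^sup>2 / (1 + x\<^sup>2)"
          by (simp add: h_def)
      qed
    qed
    then show "\<exists>C. \<forall>\<^sub>F t' in at t. \<forall>x. norm (?\<Phi> t' x - ?\<Phi> t x - (t' - t) *\<^sub>R ?G t x) \<le> C * (t' - t)\<^sup>2 / (1 + x\<^sup>2)"
      by blast
  qed
  moreover have "(LINT x|lborel. ?\<Phi> t x) = complex_of_real (mass (v t))" for t
    by (subst integral_complex_of_real[symmetric]) (simp only: complex_norm_square)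
  ultimately show ?thesis by simp
qed

text \<open>The time part of the Lax pair prescribes a formal time derivative \<open>F\<close> of the Riccati function \<open>w\<close>. Compatibility of the Lax
pair is the identity \<open>F_x\<close> below: \<open>F\<close> solves the Riccati equation differentiated in time. Hence \<open>w + h F\<close> solves the Riccati
equation at time \<open>t + h\<close> up to \<open>O(h\<^sup>2)\<close>, and by stability it differs from the true Riccati function at that time by \<open>O(h\<^sup>2)\<close>.
So the density \<open>(cnj v) w\<close> has a first-order expansion in time, and its coefficient is the \<open>x\<close>-derivative of a flux.\<close>

lemma riccati_invariant_conserved:
  assumes sm: "\<And>t. small_mass \<kappa> M (v t)" and ric: "\<And>t. riccati_solution \<kappa> (v t) (w t)"
  shows "(LINT x|lborel. cnj (v t x) * w t x) = (LINT x|lborel. cnj (v 0 x) * w 0 x)"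
proof -
  have \<kappa>: "\<kappa> > 0" using sm[of 0] by (simp add: small_mass_def)
  define k where "k = complex_of_real \<kappa>"
  have scale: "(2 * \<kappa>) *\<^sub>R z = 2 * k * z" for z :: complex by (simp add: scaleR_conv_of_real k_def)
  define F0 where "F0 t x = 2 * k * v t x - vx t x + (4 * k * k + v t x * cnj (v t x)) * w t x
      + (2 * k * cnj (v t x) + cnj (vx t x)) * (w t x * w t x) / 2" for t x
  define G0 where "G0 t x = - ((cnj (vxx t x) + v t x * cnj (v t x) * cnj (v t x)) * w t x) + cnj (v t x) * F0 t x" for t x
  define J0 where "J0 t x = - (v t x * cnj (v t x)) - (2 * k * cnj (v t x) + cnj (vx t x)) * w t x" for t x
  have w: "continuous_on UNIV (w t)" "norm (w t x) \<le> 1/2" for t x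
    by (rule riccati_solutionD[OF ric])+
  have w_dec: "decaying (w t)" for t by (rule riccati_solution_decaying[OF v_decaying \<kappa> ric])
  have w_x: "(w t has_vector_derivative (- v t x - cnj (v t x) * (w t x * w t x) / 2 - 2 * k * w t x)) (at x)" for t x
    using riccati_solution_derivative[OF v_decaying \<kappa> ric] unfolding scale power2_eq_square .
  have vt0: "vt t x = \<i> * (vxx t x + v t x * cnj (v t x) * v t x)" for t x
    unfolding nls by (simp add: algebra_simps)
  have vt0': "cnj (vt t x) = - (\<i> * (cnj (vxx t x) + v t x * cnj (v t x) * cnj (v t x)))" for t x
    unfolding vt0 by (simp add: algebra_simps)
  note dec = decaying_add decaying_diff decaying_uminus decaying_mult decaying_cmult decaying_cnj v_decaying vx_decaying vxx_decaying vt_decaying w_dec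
  have F0_dec: "decaying (F0 t)" for t
  proof -
    have eq: "F0 t = (\<lambda>x. 2 * k * v t x - vx t x + (4 * k * k * w t x + v t x * cnj (v t x) * w t x)
      + (1/2) * ((2 * k * cnj (v t x) + cnj (vx t x)) * (w t x * w t x)))"
      by (intro ext) (simp add: F0_def algebra_simps)
    show ?thesis unfolding eq by (intro dec)
  qed
  have G0_dec: "decaying (G0 t)" for t unfolding G0_def[abs_def] by (intro dec F0_dec)
  have J0_dec: "decaying (J0 t)" for t unfolding J0_def[abs_def] by (intro dec)
  \<comment> \<open>The factor \<open>\<i>\<close> is split off from the time derivative and from the flux, so that the two identities below
    are polynomial identities in which \<open>\<i>\<close> does not occur.\<close>
  have J0_x: "(J0 t has_vector_derivative G0 t x) (at x)" for t x
  proof (rule has_vector_derivative_eq_rhs)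
    show "(J0 t has_vector_derivative
        - (v t x * cnj (vx t x) + vx t x * cnj (v t x))
        - ((2 * k * cnj (v t x) + cnj (vx t x)) * (- v t x - cnj (v t x) * (w t x * w t x) / 2 - 2 * k * w t x)
          + (2 * k * cnj (vx t x) + cnj (vxx t x)) * w t x)) (at x)"
      unfolding J0_def
      by (intro has_vector_derivative_diff has_vector_derivative_minus has_vector_derivative_mult has_vector_derivative_add
          has_vector_derivative_mult_right has_vector_derivative_cnj v_x vx_x w_x)
  qed (simp add: G0_def F0_def field_simps)
  have F0_x: "(F0 t has_vector_derivative
      (- 2 * k * F0 t x - (vxx t x + v t x * cnj (v t x) * v t x)
       + (cnj (vxx t x) + v t x * cnj (v t x) * cnj (v t x)) * (w t x * w t x) / 2 - cnj (v t x) * w t x * F0 t x)) (at x)" for t x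
  proof (rule has_vector_derivative_eq_rhs)
    let ?w' = "- v t x - cnj (v t x) * (w t x * w t x) / 2 - 2 * k * w t x"
    show "(F0 t has_vector_derivative
        2 * k * vx t x - vxx t x
        + ((4 * k * k + v t x * cnj (v t x)) * ?w' + (0 + (v t x * cnj (vx t x) + vx t x * cnj (v t x))) * w t x)
        + ((2 * k * cnj (v t x) + cnj (vx t x)) * (w t x * ?w' + ?w' * w t x)
           + (2 * k * cnj (vx t x) + cnj (vxx t x)) * (w t x * w t x)) / 2) (at x)"
      unfolding F0_def
      by (intro has_vector_derivative_diff has_vector_derivative_mult has_vector_derivative_add has_vector_derivative_const
          has_vector_derivative_mult_right has_vector_derivative_divide has_vector_derivative_cnj v_x vx_x w_x)
  qed (simp add: F0_def field_simps)
  define F where "F t x = \<i> * F0 t x" for t x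
  have F_dec: "decaying (F t)" for t unfolding F_def[abs_def] by (intro dec F0_dec)
  have F_x: "(F t has_vector_derivative
      (- 2 * k * F t x - vt t x - cnj (vt t x) * (w t x * w t x) / 2 - cnj (v t x) * w t x * F t x)) (at x)" for t x
  proof (rule has_vector_derivative_eq_rhs)
    show "(F t has_vector_derivative \<i> * (- 2 * k * F0 t x - (vxx t x + v t x * cnj (v t x) * v t x)
       + (cnj (vxx t x) + v t x * cnj (v t x) * cnj (v t x)) * (w t x * w t x) / 2 - cnj (v t x) * w t x * F0 t x)) (at x)"
      unfolding F_def by (intro has_vector_derivative_mult_right F0_x)
  qed (simp add: F_def vt0 vt0' field_simps)
  let ?\<Phi> = "\<lambda>t x. cnj (v t x) * w t x"
  let ?G = "\<lambda>t x. cnj (vt t x) * w t x + cnj (v t x) * F t x"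
  have G_eq: "?G t x = \<i> * G0 t x" for t x unfolding vt0' F_def G0_def by (simp add: algebra_simps)
  show ?thesis
  proof (rule conserved_integral[where G="?G" and J="\<lambda>t x. \<i> * J0 t x"])
    show "decaying (?\<Phi> t)" for t by (intro dec)
    show "decaying (?G t)" for t by (intro dec F_dec)
    show "((\<lambda>x. \<i> * J0 t x) has_vector_derivative ?G t x) (at x)" for t x
      unfolding G_eq by (intro has_vector_derivative_mult_right J0_x)
    have "decaying (\<lambda>x. \<i> * J0 t x)" for t by (intro dec J0_dec)
    then show "((\<lambda>x. \<i> * J0 t x) \<longlongrightarrow> 0) at_bot" "((\<lambda>x. \<i> * J0 t x) \<longlongrightarrow> 0) at_top" for t
      by (rule decaying_tendsto_0)+
    fix t :: real
    obtain B where B: "B \<ge> 0" "\<And>t' x. t' \<in> {-(\<bar>t\<bar> + 1)..\<bar>t\<bar> + 1} \<Longrightarrow> norm (v t' x) \<le> B / (1 + x\<^sup>2)"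
      "\<And>t' x. t' \<in> {-(\<bar>t\<bar> + 1)..\<bar>t\<bar> + 1} \<Longrightarrow> norm (v t' x - v t x) \<le> B / (1 + x\<^sup>2) * \<bar>t' - t\<bar>"
      "\<And>t' x. t' \<in> {-(\<bar>t\<bar> + 1)..\<bar>t\<bar> + 1} \<Longrightarrow> norm (v t' x - v t x - (t' - t) *\<^sub>R vt t x) \<le> B / (1 + x\<^sup>2) * (t' - t)\<^sup>2"
    proof -
      have "t \<in> {-(\<bar>t\<bar> + 1)..\<bar>t\<bar> + 1}" by auto
      then show ?thesis using that local_bounds[of "\<bar>t\<bar> + 1"] by blast
    qed
    obtain K where K: "\<And>x. norm (F t x) \<le> K" using decaying_bounded_ex[OF F_dec] by blast
    have K0: "K \<ge> 0" using order_trans[OF norm_ge_zero K[of 0]] .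
    define Ce where "Ce = B * (2 + K + K\<^sup>2)"
    have Ce0: "Ce \<ge> 0" using B(1) K0 by (simp add: Ce_def)
    have "\<forall>\<^sub>F t' in at t. dist t' t < 1 / (1 + K)"
      unfolding eventually_at using K0 by (intro exI[of _ "1 / (1 + K)"]) auto
    with eventually_in_window[of t]
    have "\<forall>\<^sub>F t' in at t. \<forall>x. norm (?\<Phi> t' x - ?\<Phi> t x - (t' - t) *\<^sub>R ?G t x) \<le> B * (Ce / \<kappa> + 1 + K) * (t' - t)\<^sup>2 / (1 + x\<^sup>2)"
    proof eventually_elim
      case (elim t')
      define h where "h = t' - t"
      have hK: "\<bar>h\<bar> * K \<le> 1"
      proof -
        have "\<bar>h\<bar> < 1 / (1 + K)" using elim by (simp add: h_def dist_real_def)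
        then have "\<bar>h\<bar> * (1 + K) < 1" using K0 by (simp add: field_simps)
        moreover have "\<bar>h\<bar> * K \<le> \<bar>h\<bar> * (1 + K)" by (rule mult_left_mono) auto
        ultimately show ?thesis by linarith
      qed
      define b where "b x = B / (1 + x\<^sup>2)" for x :: real
      have b: "0 \<le> b x" "b x \<le> B" for x unfolding b_def using B(1) by (auto simp: add_nonneg_nonneg divide_le_eq add_pos_nonneg mult_le_cancel_left1)
      define q where "q x = v t' x - v t x - h *\<^sub>R vt t x" for x
      have q: "norm (q x) \<le> b x * h\<^sup>2" for x using B(4)[of t' x] elim by (simp add: q_def h_def b_def)
      define l where "l x = v t' x - v t x" for x
      have l: "norm (l x) \<le> b x * \<bar>h\<bar>" for x using B(3)[of t' x] elim by (simp add: h_def b_def l_def)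
      have v': "norm (v t' x) \<le> b x" for x using B(2)[of t' x] elim by (simp add: b_def)
      have q_dec: "decaying q" unfolding q_def scaleR_conv_of_real by (intro dec)
      have l_dec: "decaying l" unfolding l_def by (intro dec)
      define d where "d x = w t' x - (w t x + h *\<^sub>R F t x)" for x
      have d_dec: "decaying d" unfolding d_def scaleR_conv_of_real by (intro dec F_dec)
      \<comment> \<open>\<open>e\<close> is the defect of \<open>w + h F\<close> in the Riccati equation at time \<open>t'\<close>: the terms of first order in \<open>h\<close>
        have cancelled, and what is left are Taylor remainders and products of two increments.\<close>
      define e where "e x = q x + (cnj (q x) * (w t x * w t x)) * (1/2) + h *\<^sub>R (cnj (l x) * (w t x * F t x)) + (h\<^sup>2 / 2) *\<^sub>R (cnj (v t' x) * (F t x * F t x))" for x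
      have e_dec: "decaying e"
        unfolding e_def scaleR_conv_of_real mult.commute[of _ "1/2"] by (intro dec F_dec q_dec l_dec)
      have e_le: "norm (e x) \<le> Ce * h\<^sup>2" for x
      proof -
        have q': "norm (q x) \<le> B * h\<^sup>2" using order_trans[OF q mult_right_mono[OF b(2)]] by simp
        have l': "norm (l x) \<le> B * \<bar>h\<bar>" using order_trans[OF l mult_right_mono[OF b(2)]] by simp
        have w1: "norm (w t x) \<le> 1" using w(2)[of t x] by simp
        have "norm (e x) \<le> norm (q x) + norm ((cnj (q x) * (w t x * w t x)) * (1/2)) + norm (h *\<^sub>R (cnj (l x) * (w t x * F t x))) + norm ((h\<^sup>2 / 2) *\<^sub>R (cnj (v t' x) * (F t x * F t x)))"
          unfolding e_def by (intro norm_triangle_le add_right_mono norm_triangle_ineq)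
        also have "norm ((cnj (q x) * (w t x * w t x)) * (1/2)) \<le> (B * h\<^sup>2 * (1 * 1)) * 1"
          unfolding norm_mult complex_mod_cnj by (intro mult_mono q' w1) (use B(1) in auto)
        also have "norm (h *\<^sub>R (cnj (l x) * (w t x * F t x))) \<le> \<bar>h\<bar> * ((B * \<bar>h\<bar>) * (1 * K))"
          unfolding norm_mult norm_scaleR complex_mod_cnj by (intro mult_mono l' w1 K) (use B(1) K0 in auto)
        also have "norm ((h\<^sup>2 / 2) *\<^sub>R (cnj (v t' x) * (F t x * F t x))) \<le> h\<^sup>2 * (B * (K * K))"
          unfolding norm_mult norm_scaleR complex_mod_cnj by (intro mult_mono K order_trans[OF v' b(2)]) (use B(1) K0 in auto)
        also have "\<bar>h\<bar> * ((B * \<bar>h\<bar>) * (1 * K)) = B * K * h\<^sup>2"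
          by (simp only: abs_mult_self_eq[of h, symmetric] power2_eq_square mult_ac mult_1_left)
        also have "norm (q x) + B * h\<^sup>2 * (1 * 1) * 1 + B * K * h\<^sup>2 + h\<^sup>2 * (B * (K * K)) \<le> Ce * h\<^sup>2"
          using q' by (simp add: Ce_def power2_eq_square algebra_simps)
        finally show ?thesis by simp
      qed
      define m where "m x = (w t' x + w t x + h *\<^sub>R F t x) / 2" for x
      have m_cont: "continuous_on UNIV m"
        unfolding m_def by (intro continuous_intros w decaying_continuous[OF F_dec]) simp
      have m_le: "norm (m x) \<le> 1" for x
      proof -
        have "norm (w t' x + w t x + h *\<^sub>R F t x) \<le> norm (w t' x) + norm (w t x) + \<bar>h\<bar> * norm (F t x)"
          by (intro norm_triangle_le) (simp add: norm_triangle_ineq)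
        also have "\<dots> \<le> 1/2 + 1/2 + \<bar>h\<bar> * K" by (intro add_mono w mult_left_mono K) simp
        also have "\<dots> \<le> 2" using hK by simp
        finally show ?thesis by (simp add: m_def norm_divide)
      qed
      have d_x: "(d has_vector_derivative (- (cnj (v t' x) * (m x * d x) + e x) - (2 * \<kappa>) *\<^sub>R d x)) (at x)" for x
      proof (rule has_vector_derivative_eq_rhs)
        show "(d has_vector_derivative
           (- v t' x - cnj (v t' x) * (w t' x * w t' x) / 2 - 2 * k * w t' x) -
           ((- v t x - cnj (v t x) * (w t x * w t x) / 2 - 2 * k * w t x) + h *\<^sub>R
             (- 2 * k * F t x - vt t x - cnj (vt t x) * (w t x * w t x) / 2 - cnj (v t x) * w t x * F t x))) (at x)"
          unfolding d_def
          by (intro has_vector_derivative_diff has_vector_derivative_add w_x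
              bounded_linear.has_vector_derivative[OF bounded_linear_scaleR_right] F_x)
      qed (simp add: k_def m_def e_def d_def q_def l_def scaleR_conv_of_real field_simps power2_eq_square)
      have d_le: "norm (d x) \<le> Ce / \<kappa> * h\<^sup>2" for x
        using small_mass_stability[OF sm d_dec e_dec m_cont m_le d_x e_le] by simp
      show ?case
      proof
        fix x
        have "?\<Phi> t' x - ?\<Phi> t x - h *\<^sub>R ?G t x = cnj (v t' x) * d x + cnj (q x) * w t x + h *\<^sub>R (cnj (l x) * F t x)"
          by (simp add: d_def q_def l_def scaleR_conv_of_real algebra_simps)
        also have "norm \<dots> \<le> norm (cnj (v t' x) * d x) + norm (cnj (q x) * w t x) + norm (h *\<^sub>R (cnj (l x) * F t x))"
          by (intro norm_triangle_le add_right_mono norm_triangle_ineq)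
        also have "norm (cnj (v t' x) * d x) \<le> b x * (Ce / \<kappa> * h\<^sup>2)"
          unfolding norm_mult complex_mod_cnj by (intro mult_mono v' d_le b) auto
        also have "norm (cnj (q x) * w t x) \<le> (b x * h\<^sup>2) * 1"
          unfolding norm_mult complex_mod_cnj by (intro mult_mono q) (use w(2)[of t x] b in auto)
        also have "norm (h *\<^sub>R (cnj (l x) * F t x)) \<le> \<bar>h\<bar> * ((b x * \<bar>h\<bar>) * K)"
          unfolding norm_mult norm_scaleR complex_mod_cnj by (intro mult_mono l K) (use b K0 in auto)
        also have "\<bar>h\<bar> * ((b x * \<bar>h\<bar>) * K) = b x * K * h\<^sup>2"
          by (simp only: abs_mult_self_eq[of h, symmetric] power2_eq_square mult_ac)
        also have "b x * (Ce / \<kappa> * h\<^sup>2) + (b x * h\<^sup>2) * 1 + b x * K * h\<^sup>2 = B * (Ce / \<kappa> + 1 + K) * h\<^sup>2 / (1 + x\<^sup>2)"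
          unfolding b_def by (simp add: algebra_simps add_divide_distrib)
        finally show "norm (?\<Phi> t' x - ?\<Phi> t x - (t' - t) *\<^sub>R ?G t x) \<le> B * (Ce / \<kappa> + 1 + K) * (t' - t)\<^sup>2 / (1 + x\<^sup>2)"
          by (simp add: h_def)
      qed
    qed
    then show "\<exists>C. \<forall>\<^sub>F t' in at t. \<forall>x. norm (?\<Phi> t' x - ?\<Phi> t x - (t' - t) *\<^sub>R ?G t x) \<le> C * (t' - t)\<^sup>2 / (1 + x\<^sup>2)"
      by blast
  qed
qed

text \<open>The mass and the Riccati invariant are the same at both times, so the energies are compared through
\<open>E(t) / 2 \<le> Q + M ^ 6 / (2 \<kappa>\<^sup>2)\<close> and \<open>Q \<le> 3 E(0) / 2 + M ^ 6 / (2 \<kappa>\<^sup>2)\<close>, where \<open>Q\<close> is their conserved combination.\<close>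

lemma resolvent_energy_almost_conserved:
  assumes sm: "\<And>t. small_mass \<kappa> M (v t)"
  shows "resolvent_energy \<kappa> (v t) \<le> 3 * resolvent_energy \<kappa> (v 0) + 2 * M ^ 6 / \<kappa>\<^sup>2"
proof -
  obtain w where ric: "\<And>t. riccati_solution \<kappa> (v t) (w t)"
    using riccati_solution_exists[OF sm] by metis
  show ?thesis
    using riccati_energy_estimate[OF sm ric, of t] riccati_energy_estimate[OF sm ric, of 0]
      mass_conserved[of t] riccati_invariant_conserved[OF sm ric, of t] by (simp add: abs_if split: if_splits)
qed

end

section \<open>Sobolev norms as averages over the spectral parameter\<close>

lemma decaying_fourier_norm_sq_integrable:
  "decaying f \<Longrightarrow> integrable lborel (\<lambda>\<xi>. (norm (fourier f \<xi>))\<^sup>2)"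
  by (rule fourier_norm_sq_integrable[OF decaying_integrable decaying_norm_sq_integrable])

text \<open>The equation \<open>y' + 2 \<kappa> y = p\<close> becomes \<open>(2 \<kappa> + \<i> \<xi>) y^ = p^\<close>, and Plancherel's identity is applied to \<open>y'\<close>.\<close>

lemma resolvent_energy_fourier:
  assumes p: "decaying p" and \<kappa>: "\<kappa> > 0"
  shows "ennreal (resolvent_energy \<kappa> p) = (\<integral>\<^sup>+\<xi>. ennreal (\<xi>\<^sup>2 / (4 * \<kappa>\<^sup>2 + \<xi>\<^sup>2) * (norm (fourier p \<xi>))\<^sup>2) \<partial>lborel)"
proof -
  define y where "y = resolvent \<kappa> p"
  define y' where "y' x = p x - (2 * \<kappa>) *\<^sub>R y x" for x
  have y: "decaying y" unfolding y_def by (rule resolvent_decaying[OF \<kappa> p])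
  have y': "decaying y'" unfolding y'_def scaleR_conv_of_real by (intro decaying_diff decaying_cmult p y)
  have d: "(y has_vector_derivative y' x) (at x)" for x
    unfolding y_def y'_def by (rule decaying_resolvent_derivative[OF p \<kappa>])
  have symbol: "(norm (fourier y' \<xi>))\<^sup>2 = \<xi>\<^sup>2 / (4 * \<kappa>\<^sup>2 + \<xi>\<^sup>2) * (norm (fourier p \<xi>))\<^sup>2" for \<xi>
  proof -
    have 1: "fourier y' \<xi> = \<i> * \<xi> * fourier y \<xi>" by (rule fourier_derivative[OF y y' d])
    have "fourier y' \<xi> = fourier p \<xi> - of_real (2 * \<kappa>) * fourier y \<xi>"
      unfolding y'_def scaleR_conv_of_real
      by (subst fourier_diff) (auto intro!: decaying_integrable decaying_cmult p y simp: fourier_cmult)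
    with 1 have "fourier p \<xi> = Complex (2 * \<kappa>) \<xi> * fourier y \<xi>"
      by (simp add: complex_eq_iff algebra_simps)
    then have "(norm (fourier p \<xi>))\<^sup>2 = (4 * \<kappa>\<^sup>2 + \<xi>\<^sup>2) * (norm (fourier y \<xi>))\<^sup>2"
      by (simp add: norm_mult power_mult_distrib cmod_power2)
    moreover have "(norm (fourier y' \<xi>))\<^sup>2 = \<xi>\<^sup>2 * (norm (fourier y \<xi>))\<^sup>2"
      unfolding 1 by (simp add: norm_mult power_mult_distrib)
    moreover have "4 * \<kappa>\<^sup>2 + \<xi>\<^sup>2 > 0" using \<kappa> by (intro add_pos_nonneg) auto
    ultimately show ?thesis by simp
  qed
  have "resolvent_energy \<kappa> p = (LINT \<xi>|lborel. (norm (fourier y' \<xi>))\<^sup>2)"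
    unfolding fourier_plancherel[OF y'] resolvent_energy_def y'_def y_def ..
  also have "ennreal \<dots> = (\<integral>\<^sup>+\<xi>. ennreal ((norm (fourier y' \<xi>))\<^sup>2) \<partial>lborel)"
    by (rule nn_integral_eq_integral[OF decaying_fourier_norm_sq_integrable[OF y'], symmetric]) simp
  finally show ?thesis unfolding symbol .
qed

text \<open>The multiplier obtained by averaging the energies over all spectral parameters above \<open>\<mu>\<close>.\<close>

definition scale_weight :: "real \<Rightarrow> real \<Rightarrow> real \<Rightarrow> ennreal" where
  "scale_weight s \<mu> \<xi> = (\<integral>\<^sup>+\<kappa>. ennreal (\<kappa> powr (2 * s - 1) * (\<xi>\<^sup>2 / (4 * \<kappa>\<^sup>2 + \<xi>\<^sup>2))) * indicator {\<mu>..} \<kappa> \<partial>lborel)"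

abbreviation scale_integral :: "real \<Rightarrow> real set \<Rightarrow> ennreal" where
  "scale_integral s A \<equiv> (\<integral>\<^sup>+r. ennreal (r powr (2 * s - 1) / (4 * r\<^sup>2 + 1)) * indicator A r \<partial>lborel)"

text \<open>The substitution \<open>\<kappa> = |\<xi>| r\<close>.\<close>

lemma scale_weight_rescaled:
  assumes "\<xi> \<noteq> 0" "\<mu> > 0"
  shows "scale_weight s \<mu> \<xi> = ennreal (\<bar>\<xi>\<bar> powr (2 * s)) *
     (scale_integral s {\<mu> / \<bar>\<xi>\<bar>..})"
proof -
  let ?a = "\<bar>\<xi>\<bar>"
  have a: "?a > 0" using assms by simp
  have "scale_weight s \<mu> \<xi> = ?a * (\<integral>\<^sup>+r. ennreal ((0 + ?a * r) powr (2 * s - 1) * (\<xi>\<^sup>2 / (4 * (0 + ?a * r)\<^sup>2 + \<xi>\<^sup>2))) * indicator {\<mu>..} (0 + ?a * r) \<partial>lborel)"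
    unfolding scale_weight_def by (subst nn_integral_real_affine[where c="?a" and t=0]) (use a in auto)
  also have "\<dots> = ?a * (\<integral>\<^sup>+r. ennreal (?a powr (2 * s - 1)) * (ennreal (r powr (2 * s - 1) / (4 * r\<^sup>2 + 1)) * indicator {\<mu> / ?a..} r) \<partial>lborel)"
  proof -
    have "ennreal ((0 + ?a * r) powr (2 * s - 1) * (\<xi>\<^sup>2 / (4 * (0 + ?a * r)\<^sup>2 + \<xi>\<^sup>2))) * indicator {\<mu>..} (0 + ?a * r)
       = ennreal (?a powr (2 * s - 1)) * (ennreal (r powr (2 * s - 1) / (4 * r\<^sup>2 + 1)) * indicator {\<mu> / ?a..} r)" for r
    proof (cases "\<mu> \<le> ?a * r")
      case True
      then have r: "r > 0" using a assms by (metis less_le_trans zero_less_mult_pos)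
      have "\<xi>\<^sup>2 / (4 * (?a * r)\<^sup>2 + \<xi>\<^sup>2) = 1 / (4 * r\<^sup>2 + 1)"
      proof -
        have "4 * (?a * r)\<^sup>2 + \<xi>\<^sup>2 = \<xi>\<^sup>2 * (4 * r\<^sup>2 + 1)" by (simp add: power_mult_distrib algebra_simps)
        then show ?thesis using assms by simp
      qed
      moreover have "\<mu> / ?a \<le> r" using True a by (simp add: field_simps)
      ultimately show ?thesis using True r a by (simp add: powr_mult ennreal_mult[symmetric])
    next
      case False
      then have "\<not> \<mu> / ?a \<le> r" using a by (simp add: field_simps)
      with False show ?thesis by simp
    qed
    then show ?thesis by (simp only:)
  qed
  also have "\<dots> = ?a * (ennreal (?a powr (2 * s - 1)) * (scale_integral s {\<mu> / ?a..}))"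
    by (subst nn_integral_cmult) auto
  also have "\<dots> = ennreal (?a * ?a powr (2 * s - 1)) * (scale_integral s {\<mu> / ?a..})"
    by (simp add: ennreal_mult mult.assoc)
  also have "?a * ?a powr (2 * s - 1) = ?a powr (2 * s)" using a by (simp add: powr_diff)
  finally show ?thesis .
qed

lemma nn_integral_powr_tail:
  assumes "a < -1" "c > 0"
  shows "(\<integral>\<^sup>+r. ennreal (r powr a) * indicator {c..} r \<partial>lborel) = ennreal (- (c powr (a + 1) / (a + 1)))"
proof -
  have "(\<integral>\<^sup>+r. ennreal (indicator {c..} r * r powr a) \<partial>lborel) = ennreal (- (c powr (a + 1) / (a + 1)))"
    by (rule nn_integral_has_integral_lebesgue) (use has_integral_powr_to_inf[of a c] assms in auto)
  then show ?thesis by (simp add: ennreal_mult' ennreal_indicator mult.commute)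
qed

text \<open>The condition \<open>0 < s\<close> gives integrability at \<open>0\<close>, and \<open>s < 1\<close> gives it at infinity, where the integrand is at most
\<open>r powr (2 s - 3)\<close>.\<close>

lemma scale_integral_finite:
  assumes "0 < s" "s < 1"
  shows "(scale_integral s {0<..}) < \<infinity>"
proof -
  have small: "(\<integral>\<^sup>+r. ennreal (indicator {0..1} r * r powr (2 * s - 1)) \<partial>lborel) = ennreal (1 powr (2 * s - 1 + 1) / (2 * s - 1 + 1))"
    by (rule nn_integral_has_integral_lebesgue) (use has_integral_powr_from_0[of "2 * s - 1" 1] assms in auto)
  have "(scale_integral s {0<..})
    \<le> (\<integral>\<^sup>+r. ennreal (indicator {0..1} r * r powr (2 * s - 1)) + ennreal (r powr (2 * s - 3)) * indicator {1..} r \<partial>lborel)"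
  proof (rule nn_integral_mono)
    fix r :: real
    consider "r \<le> 0" | "0 < r" "r \<le> 1" | "1 < r" by linarith
    then show "ennreal (r powr (2 * s - 1) / (4 * r\<^sup>2 + 1)) * indicator {0<..} r
      \<le> ennreal (indicator {0..1} r * r powr (2 * s - 1)) + ennreal (r powr (2 * s - 3)) * indicator {1..} r"
    proof cases
      case 2
      have "r powr (2 * s - 1) / (4 * r\<^sup>2 + 1) \<le> r powr (2 * s - 1) / 1"
        by (rule divide_left_mono) (auto simp: add_nonneg_pos)
      with 2 show ?thesis by (auto intro!: ennreal_leI add_increasing2)
    next
      case 3
      have "r powr (2 * s - 1) / (4 * r\<^sup>2 + 1) \<le> r powr (2 * s - 1) / r\<^sup>2"
        using 3 by (intro divide_left_mono) (auto simp: add_nonneg_pos)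
      also have "\<dots> = r powr (2 * s - 3)" using 3 powr_diff[of r "2 * s - 1" 2] by (simp add: powr_numeral)
      finally show ?thesis using 3 by (auto intro!: ennreal_leI)
    qed auto
  qed
  also have "\<dots> = ennreal (1 powr (2 * s - 1 + 1) / (2 * s - 1 + 1)) + ennreal (- (1 powr (2 * s - 3 + 1) / (2 * s - 3 + 1)))"
    using assms by (subst nn_integral_add) (auto simp: small nn_integral_powr_tail)
  also have "\<dots> < \<infinity>" by simp
  finally show ?thesis .
qed

text \<open>On \<open>[1, 2]\<close> the numerator is at least \<open>1/2\<close> and the denominator at most \<open>17\<close>.\<close>

lemma scale_integral_lower:
  assumes "0 < s" "c \<le> 1"
  shows "ennreal (1/34) \<le> (scale_integral s {c..})"
proof -
  have "ennreal (1/34) = (\<integral>\<^sup>+r. ennreal (1/34) * indicator {1..2::real} r \<partial>lborel)"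
    by (subst nn_integral_cmult_indicator) auto
  also have "\<dots> \<le> (scale_integral s {c..})"
  proof (rule nn_integral_mono)
    fix r :: real
    show "ennreal (1/34) * indicator {1..2} r \<le> ennreal (r powr (2 * s - 1) / (4 * r\<^sup>2 + 1)) * indicator {c..} r"
    proof (cases "r \<in> {1..2}")
      case True
      have "1/2 \<le> r powr (-1)" using True by (simp add: powr_minus_divide field_simps)
      also have "\<dots> \<le> r powr (2 * s - 1)" using True assms by (intro powr_mono) auto
      finally have 1: "1/2 \<le> r powr (2 * s - 1)" .
      have 2: "4 * r\<^sup>2 + 1 \<le> 17" using True power_mono[of r 2 2] by auto
      have "1/34 = (1/2) / (17 :: real)" by simp
      also have "\<dots> \<le> r powr (2 * s - 1) / (4 * r\<^sup>2 + 1)" using 1 2 by (intro frac_le) (auto simp: add_nonneg_pos)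
      finally show ?thesis using True assms by (auto intro!: ennreal_leI)
    qed auto
  qed
  finally show ?thesis .
qed

lemma scale_weight_upper:
  assumes "\<mu> > 0"
  shows "scale_weight s \<mu> \<xi> \<le> ennreal (\<bar>\<xi>\<bar> powr (2 * s)) * (scale_integral s {0<..})"
proof (cases "\<xi> = 0")
  case True
  then show ?thesis by (simp add: scale_weight_def)
next
  case False
  then have "\<mu> / \<bar>\<xi>\<bar> > 0" using assms by simp
  then have "indicator {\<mu> / \<bar>\<xi>\<bar>..} r \<le> (indicator {0<..} r :: ennreal)" for r
    by (auto split: split_indicator)
  then show ?thesis
    unfolding scale_weight_rescaled[OF False assms] by (intro mult_left_mono nn_integral_mono) auto
qed

lemma scale_weight_lower:
  assumes "0 < s" "\<mu> > 0" "\<mu> \<le> \<bar>\<xi>\<bar>"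
  shows "ennreal (\<bar>\<xi>\<bar> powr (2 * s) / 34) \<le> scale_weight s \<mu> \<xi>"
proof -
  have ne: "\<xi> \<noteq> 0" using assms by auto
  have "ennreal (\<bar>\<xi>\<bar> powr (2 * s) / 34) = ennreal (\<bar>\<xi>\<bar> powr (2 * s)) * ennreal (1/34)"
    by (subst ennreal_mult[symmetric]) auto
  also have "\<dots> \<le> scale_weight s \<mu> \<xi>"
    unfolding scale_weight_rescaled[OF ne assms(2)] using assms ne by (intro mult_left_mono scale_integral_lower) auto
  finally show ?thesis .
qed

text \<open>Below the threshold \<open>\<mu>\<close> the weight is at most its value at \<open>\<mu>\<close>. Above it \<open>1 + \<xi>\<^sup>2 \<le> 2 \<xi>\<^sup>2\<close>, and \<open>68 = 2 * 34\<close> combines this factor with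
the constant of the lower bound for \<open>scale_weight\<close>.\<close>

lemma sobolev_weight_le:
  assumes "0 < s" "\<mu> \<ge> 1" "s < 1"
  shows "ennreal ((1 + \<xi>\<^sup>2) powr s) \<le> ennreal ((1 + \<mu>\<^sup>2) powr s) + 68 * scale_weight s \<mu> \<xi>"
proof (cases "\<mu> \<le> \<bar>\<xi>\<bar>")
  case True
  have "1 \<le> \<bar>\<xi>\<bar>" using True assms by simp
  then have "1 \<le> \<xi>\<^sup>2" using power_mono[of 1 "\<bar>\<xi>\<bar>" 2] by simp
  then have "(1 + \<xi>\<^sup>2) powr s \<le> (2 * \<xi>\<^sup>2) powr s" using assms by (intro powr_mono2) auto
  also have "\<dots> = 2 powr s * \<bar>\<xi>\<bar> powr (2 * s)"
  proof -
    have "(\<xi>\<^sup>2) powr s = \<bar>\<xi>\<bar> powr (2 * s)"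
      using \<open>1 \<le> \<bar>\<xi>\<bar>\<close> powr_powr[of "\<bar>\<xi>\<bar>" 2 s] by (simp add: powr_numeral)
    then show ?thesis by (simp add: powr_mult)
  qed
  also have "\<dots> \<le> 2 powr 1 * \<bar>\<xi>\<bar> powr (2 * s)" using assms by (intro mult_right_mono powr_mono) auto
  finally have "(1 + \<xi>\<^sup>2) powr s \<le> 68 * (\<bar>\<xi>\<bar> powr (2 * s) / 34)" by simp
  then have "ennreal ((1 + \<xi>\<^sup>2) powr s) \<le> 68 * ennreal (\<bar>\<xi>\<bar> powr (2 * s) / 34)"
    by (metis ennreal_leI ennreal_mult' ennreal_numeral zero_le_numeral)
  also have "\<dots> \<le> 68 * scale_weight s \<mu> \<xi>"
    by (intro mult_left_mono scale_weight_lower) (use assms True in auto)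
  finally show ?thesis by (rule order_trans) simp
next
  case False
  then have "\<bar>\<xi>\<bar>\<^sup>2 \<le> \<mu>\<^sup>2" by (intro power_mono) auto
  then have "(1 + \<xi>\<^sup>2) powr s \<le> (1 + \<mu>\<^sup>2) powr s" using assms by (intro powr_mono2) auto
  then have "ennreal ((1 + \<xi>\<^sup>2) powr s) \<le> ennreal ((1 + \<mu>\<^sup>2) powr s)" by (rule ennreal_leI)
  then show ?thesis by (rule order_trans) simp
qed

lemma scale_weight_measurable [measurable]: "scale_weight s \<mu> \<in> borel_measurable borel"
  unfolding scale_weight_def by measurable

text \<open>Tonelli's theorem after inserting the Fourier representation of the energy.\<close>

lemma energy_integral_eq:
  assumes p: "decaying p" and \<mu>: "\<mu> > 0"
  shows "(\<integral>\<^sup>+\<kappa>. ennreal (\<kappa> powr (2 * s - 1)) * ennreal (resolvent_energy \<kappa> p) * indicator {\<mu>..} \<kappa> \<partial>lborel)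
     = (\<integral>\<^sup>+\<xi>. scale_weight s \<mu> \<xi> * ennreal ((norm (fourier p \<xi>))\<^sup>2) \<partial>lborel)"
proof -
  have [measurable]: "p \<in> borel_measurable borel" by (rule decaying_measurable[OF p])
  let ?f = "\<lambda>\<kappa> \<xi>. ennreal (\<kappa> powr (2 * s - 1) * (\<xi>\<^sup>2 / (4 * \<kappa>\<^sup>2 + \<xi>\<^sup>2))) * indicator {\<mu>..} \<kappa> * ennreal ((norm (fourier p \<xi>))\<^sup>2)"
  have "(\<integral>\<^sup>+\<kappa>. ennreal (\<kappa> powr (2 * s - 1)) * ennreal (resolvent_energy \<kappa> p) * indicator {\<mu>..} \<kappa> \<partial>lborel) = (\<integral>\<^sup>+\<kappa>. \<integral>\<^sup>+\<xi>. ?f \<kappa> \<xi> \<partial>lborel \<partial>lborel)"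
  proof (rule nn_integral_cong)
    fix \<kappa> :: real
    show "ennreal (\<kappa> powr (2 * s - 1)) * ennreal (resolvent_energy \<kappa> p) * indicator {\<mu>..} \<kappa> = (\<integral>\<^sup>+\<xi>. ?f \<kappa> \<xi> \<partial>lborel)"
    proof (cases "\<kappa> \<ge> \<mu>")
      case True
      have "ennreal (\<kappa> powr (2 * s - 1)) * ennreal (resolvent_energy \<kappa> p)
        = (\<integral>\<^sup>+\<xi>. ennreal (\<kappa> powr (2 * s - 1)) * ennreal (\<xi>\<^sup>2 / (4 * \<kappa>\<^sup>2 + \<xi>\<^sup>2) * (norm (fourier p \<xi>))\<^sup>2) \<partial>lborel)"
        using True \<mu> by (subst resolvent_energy_fourier[OF p]) (auto simp: nn_integral_cmult)
      also have "\<dots> = (\<integral>\<^sup>+\<xi>. ?f \<kappa> \<xi> \<partial>lborel)"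
        using True by (intro nn_integral_cong) (simp add: ennreal_mult[symmetric] mult.assoc)
      finally show ?thesis using True by simp
    qed simp
  qed
  also have "\<dots> = (\<integral>\<^sup>+\<xi>. \<integral>\<^sup>+\<kappa>. ?f \<kappa> \<xi> \<partial>lborel \<partial>lborel)"
    by (rule lborel_pair.Fubini') measurable
  also have "\<dots> = (\<integral>\<^sup>+\<xi>. scale_weight s \<mu> \<xi> * ennreal ((norm (fourier p \<xi>))\<^sup>2) \<partial>lborel)"
    unfolding scale_weight_def by (intro nn_integral_cong nn_integral_multc) measurable
  finally show ?thesis .
qed

lemma fourier_L2_borel: "f \<in> L2 \<Longrightarrow> fourier_L2 f \<in> borel_measurable borel"
  using is_fourier_fourier_L2[of f] by (simp add: is_fourier_L2_def L2_borel)

lemma sobolev_norm_sq: "(sobolev_norm s f)\<^sup>2 = (LINT \<xi>|lborel. (1 + \<xi>\<^sup>2) powr s * (norm (fourier_L2 f \<xi>))\<^sup>2)"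
  unfolding sobolev_norm_def by (intro real_sqrt_pow2 integral_nonneg_AE) auto

text \<open>Membership uses \<open>(1 + \<xi>\<^sup>2) powr s \<le> 1 + \<xi>\<^sup>2\<close>, the weight whose integral against \<open>|y^|\<^sup>2\<close> is the mass of \<open>y\<close> plus that of \<open>y'\<close>.\<close>

lemma sobolev_decaying:
  assumes y: "decaying y" "decaying y'" "\<And>x. (y has_vector_derivative y' x) (at x)" and s: "0 \<le> s" "s \<le> 1"
  shows "y \<in> sobolev_space s"
    and "ennreal ((sobolev_norm s y)\<^sup>2) = (\<integral>\<^sup>+\<xi>. ennreal ((1 + \<xi>\<^sup>2) powr s) * ennreal ((norm (fourier y \<xi>))\<^sup>2) \<partial>lborel)"
proof -
  have L: "y \<in> L2" by (rule decaying_L2[OF y(1)])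
  have [measurable]: "y \<in> borel_measurable borel" "fourier_L2 y \<in> borel_measurable borel"
    using decaying_measurable[OF y(1)] fourier_L2_borel[OF L] by auto
  have ae: "AE \<xi> in lborel. (1 + \<xi>\<^sup>2) powr s * (norm (fourier_L2 y \<xi>))\<^sup>2 = (1 + \<xi>\<^sup>2) powr s * (norm (fourier y \<xi>))\<^sup>2"
    using fourier_L2_decaying[OF y(1)] by eventually_elim simp
  have sq: "integrable lborel (\<lambda>\<xi>. (norm (fourier z \<xi>))\<^sup>2)" if "decaying z" for z
    by (rule decaying_fourier_norm_sq_integrable[OF that])
  have i: "integrable lborel (\<lambda>\<xi>. (1 + \<xi>\<^sup>2) powr s * (norm (fourier y \<xi>))\<^sup>2)"
  proof (rule Bochner_Integration.integrable_bound[OF Bochner_Integration.integrable_add[OF sq[OF y(1)] sq[OF y(2)]]])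
    show "AE \<xi> in lborel. norm ((1 + \<xi>\<^sup>2) powr s * (norm (fourier y \<xi>))\<^sup>2) \<le> norm ((norm (fourier y \<xi>))\<^sup>2 + (norm (fourier y' \<xi>))\<^sup>2)"
    proof (rule AE_I2)
      fix \<xi> :: real
      have "(1 + \<xi>\<^sup>2) powr s \<le> (1 + \<xi>\<^sup>2) powr 1" using s by (intro powr_mono) auto
      then have "(1 + \<xi>\<^sup>2) powr s * (norm (fourier y \<xi>))\<^sup>2 \<le> (1 + \<xi>\<^sup>2) * (norm (fourier y \<xi>))\<^sup>2"
        by (intro mult_right_mono) (auto simp: add_nonneg_nonneg)
      also have "\<dots> = (norm (fourier y \<xi>))\<^sup>2 + (norm (fourier y' \<xi>))\<^sup>2"
        unfolding fourier_derivative[OF y] by (simp add: norm_mult power_mult_distrib algebra_simps)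
      finally show "norm ((1 + \<xi>\<^sup>2) powr s * (norm (fourier y \<xi>))\<^sup>2) \<le> norm ((norm (fourier y \<xi>))\<^sup>2 + (norm (fourier y' \<xi>))\<^sup>2)"
        by simp
    qed
  qed simp
  show "y \<in> sobolev_space s"
    unfolding sobolev_space_def using L i ae by (auto intro: integrable_cong_AE[THEN iffD2, OF _ _ ae])
  have "(sobolev_norm s y)\<^sup>2 = (LINT \<xi>|lborel. (1 + \<xi>\<^sup>2) powr s * (norm (fourier y \<xi>))\<^sup>2)"
    unfolding sobolev_norm_sq by (rule integral_cong_AE[OF _ _ ae]) auto
  also have "ennreal \<dots> = (\<integral>\<^sup>+\<xi>. ennreal ((1 + \<xi>\<^sup>2) powr s * (norm (fourier y \<xi>))\<^sup>2) \<partial>lborel)"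
    by (rule nn_integral_eq_integral[symmetric, OF i]) auto
  finally show "ennreal ((sobolev_norm s y)\<^sup>2) = (\<integral>\<^sup>+\<xi>. ennreal ((1 + \<xi>\<^sup>2) powr s) * ennreal ((norm (fourier y \<xi>))\<^sup>2) \<partial>lborel)"
    by (simp add: ennreal_mult)
qed

text \<open>The triangle inequality in the weak form \<open>|a + b|\<^sup>2 \<le> 2 |a|\<^sup>2 + 2 |b|\<^sup>2\<close>, which holds pointwise and is strong enough for limits of
bounds.\<close>

lemma sobolev_norm_sq_diff:
  assumes f: "f \<in> sobolev_space s" and g: "g \<in> sobolev_space s"
  shows "(sobolev_norm s f)\<^sup>2 \<le> 2 * (sobolev_norm s (\<lambda>x. f x - g x))\<^sup>2 + 2 * (sobolev_norm s g)\<^sup>2"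
    and "(sobolev_norm s g)\<^sup>2 \<le> 2 * (sobolev_norm s (\<lambda>x. f x - g x))\<^sup>2 + 2 * (sobolev_norm s f)\<^sup>2"
proof -
  let ?w = "\<lambda>\<xi>::real. (1 + \<xi>\<^sup>2) powr s"
  let ?d = "\<lambda>x. f x - g x"
  have L: "f \<in> L2" "g \<in> L2" "?d \<in> L2" using f g L2_diff by (auto simp: sobolev_space_def)
  have [measurable]: "fourier_L2 f \<in> borel_measurable borel" "fourier_L2 g \<in> borel_measurable borel" "fourier_L2 ?d \<in> borel_measurable borel"
    by (intro fourier_L2_borel L)+
  have fi: "integrable lborel (\<lambda>\<xi>. ?w \<xi> * (norm (fourier_L2 f \<xi>))\<^sup>2)" and gi: "integrable lborel (\<lambda>\<xi>. ?w \<xi> * (norm (fourier_L2 g \<xi>))\<^sup>2)"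
    using f g by (auto simp: sobolev_space_def)
  have ae: "AE \<xi> in lborel. fourier_L2 ?d \<xi> = fourier_L2 f \<xi> - fourier_L2 g \<xi>" by (rule fourier_L2_diff[OF L(1,2)])
  have wmono: "?w \<xi> * a \<le> 2 * (?w \<xi> * b) + 2 * (?w \<xi> * c)" if "a \<le> 2 * b + 2 * c" for a b c \<xi> :: real
    using mult_left_mono[OF that, of "?w \<xi>"] by (simp add: algebra_simps)
  have di: "integrable lborel (\<lambda>\<xi>. ?w \<xi> * (norm (fourier_L2 ?d \<xi>))\<^sup>2)"
  proof (rule Bochner_Integration.integrable_bound)
    show "integrable lborel (\<lambda>\<xi>. 2 * (?w \<xi> * (norm (fourier_L2 f \<xi>))\<^sup>2) + 2 * (?w \<xi> * (norm (fourier_L2 g \<xi>))\<^sup>2))"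
      using fi gi by (intro Bochner_Integration.integrable_add integrable_mult_right)
    show "AE \<xi> in lborel. norm (?w \<xi> * (norm (fourier_L2 ?d \<xi>))\<^sup>2) \<le> norm (2 * (?w \<xi> * (norm (fourier_L2 f \<xi>))\<^sup>2) + 2 * (?w \<xi> * (norm (fourier_L2 g \<xi>))\<^sup>2))"
      using ae
    proof eventually_elim
      case (elim \<xi>)
      show ?case unfolding elim using wmono[OF norm_sq_diff_le, of \<xi> "fourier_L2 f \<xi>" "fourier_L2 g \<xi>"] by simp
    qed
  qed simp
  have int_le: "(LINT \<xi>|lborel. ?w \<xi> * a \<xi>) \<le> 2 * (LINT \<xi>|lborel. ?w \<xi> * b \<xi>) + 2 * (LINT \<xi>|lborel. ?w \<xi> * c \<xi>)"
    if "integrable lborel (\<lambda>\<xi>. ?w \<xi> * a \<xi>)" and b: "integrable lborel (\<lambda>\<xi>. ?w \<xi> * b \<xi>)"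
      and c: "integrable lborel (\<lambda>\<xi>. ?w \<xi> * c \<xi>)" and le: "AE \<xi> in lborel. a \<xi> \<le> 2 * b \<xi> + 2 * c \<xi>" for a b c :: "real \<Rightarrow> real"
  proof -
    have "(LINT \<xi>|lborel. ?w \<xi> * a \<xi>) \<le> (LINT \<xi>|lborel. 2 * (?w \<xi> * b \<xi>) + 2 * (?w \<xi> * c \<xi>))"
      by (rule integral_mono_AE) (use that wmono in \<open>auto elim!: eventually_mono\<close>)
    then show ?thesis using b c by simp
  qed
  show "(sobolev_norm s f)\<^sup>2 \<le> 2 * (sobolev_norm s ?d)\<^sup>2 + 2 * (sobolev_norm s g)\<^sup>2"
    unfolding sobolev_norm_sq
  proof (rule int_le[OF fi di gi], use ae in eventually_elim)
    case (elim \<xi>)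
    show ?case using norm_sq_add_le[of "fourier_L2 ?d \<xi>" "fourier_L2 g \<xi>"] by (simp add: elim)
  qed
  show "(sobolev_norm s g)\<^sup>2 \<le> 2 * (sobolev_norm s ?d)\<^sup>2 + 2 * (sobolev_norm s f)\<^sup>2"
    unfolding sobolev_norm_sq
  proof (rule int_le[OF gi di fi], use ae in eventually_elim)
    case (elim \<xi>)
    show ?case using norm_sq_diff_le[of "fourier_L2 f \<xi>" "fourier_L2 ?d \<xi>"] by (simp add: elim)
  qed
qed

lemma (in nls_flow) v_sobolev:
  assumes "0 \<le> s" "s \<le> 1"
  shows "v t \<in> sobolev_space s"
    and "ennreal ((sobolev_norm s (v t))\<^sup>2) = (\<integral>\<^sup>+\<xi>. ennreal ((1 + \<xi>\<^sup>2) powr s) * ennreal ((norm (fourier (v t) \<xi>))\<^sup>2) \<partial>lborel)"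
  using sobolev_decaying[OF v_decaying vx_decaying v_x assms] by auto

section \<open>Uniform bounds and passage to the limit\<close>

text \<open>The threshold \<open>\<mu> = 1 + 4 N\<^sup>2\<close> is large compared with the mass, which is at most \<open>N\<^sup>2\<close>, so the energies at all \<open>\<kappa> \<ge> \<mu>\<close> are
almost conserved. Their average controls the frequencies above \<open>\<mu>\<close>; the mass controls those below. The bound depends on the
solution only through \<open>N\<close>, and it contains the initial \<open>H\<^sup>s\<close> norm because the averaged initial energy is at most a constant times
its square.\<close>

lemma schwartz_solution_bound:
  assumes s: "0 < s" "s < 1" and N: "N \<ge> 0"
  shows "\<exists>B\<ge>0. \<forall>v t. schwartz_nls_solution v \<longrightarrow> sobolev_norm s (v 0) \<le> N \<longrightarrow> (sobolev_norm s (v t))\<^sup>2 \<le> B"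
proof -
  define \<mu> where "\<mu> = 1 + 4 * N\<^sup>2"
  have \<mu>: "\<mu> \<ge> 1" "\<mu> > 0" by (auto simp: \<mu>_def add_pos_nonneg)
  define c where "c = (scale_integral s {0<..})"
  have c: "c < \<infinity>" unfolding c_def by (rule scale_integral_finite[OF s])
  define tail where "tail = (\<integral>\<^sup>+\<kappa>. ennreal (\<kappa> powr (2 * s - 3)) * indicator {\<mu>..} \<kappa> \<partial>lborel)"
  have tail: "tail < \<infinity>" unfolding tail_def using s \<mu> by (subst nn_integral_powr_tail) auto
  define Bd where "Bd = ennreal ((1 + \<mu>\<^sup>2) powr s) * ennreal (N\<^sup>2) + 68 * (3 * (c * ennreal (N\<^sup>2)) + ennreal (2 * N ^ 6) * tail)"
  have Bd: "Bd < \<infinity>" using c tail by (simp add: Bd_def ennreal_mult_less_top)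
  have main: "ennreal ((sobolev_norm s (v t))\<^sup>2) \<le> Bd" if v: "schwartz_nls_solution v" and v0: "sobolev_norm s (v 0) \<le> N" for v t
  proof -
    obtain vt vtt vx vxx where "nls_flow v vt vtt vx vxx" using schwartz_nls_solution_flow[OF v] by blast
    then interpret nls_flow v vt vtt vx vxx .
    have [measurable]: "v t \<in> borel_measurable borel" for t by (rule decaying_measurable[OF v_decaying])
    let ?p = "\<lambda>t \<xi>. ennreal ((norm (fourier (v t) \<xi>))\<^sup>2)"
    have nn: "0 \<le> sobolev_norm s (v 0)" unfolding sobolev_norm_def by (intro real_sqrt_ge_zero integral_nonneg_AE) auto
    have H0: "(\<integral>\<^sup>+\<xi>. ennreal ((1 + \<xi>\<^sup>2) powr s) * ?p 0 \<xi> \<partial>lborel) \<le> ennreal (N\<^sup>2)"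
      using v_sobolev(2)[of s 0] s power_mono[OF v0 nn, of 2] by (simp flip: v_sobolev(2)) 
    have L2: "(\<integral>\<^sup>+\<xi>. ?p t \<xi> \<partial>lborel) = ennreal (mass (v t))" for t
      unfolding fourier_plancherel[OF v_decaying, symmetric]
      by (rule nn_integral_eq_integral[OF decaying_fourier_norm_sq_integrable[OF v_decaying]]) simp
    have mass: "(mass (v t)) \<le> N\<^sup>2" for t
    proof -
      have "ennreal (mass (v t)) = (\<integral>\<^sup>+\<xi>. ?p 0 \<xi> \<partial>lborel)" unfolding mass_conserved[of t] L2 ..
      also have "\<dots> \<le> (\<integral>\<^sup>+\<xi>. ennreal ((1 + \<xi>\<^sup>2) powr s) * ?p 0 \<xi> \<partial>lborel)"
      proof (rule nn_integral_mono)
        fix \<xi> :: real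
        have "1 \<le> (1 + \<xi>\<^sup>2) powr s" using s by (intro ge_one_powr_ge_zero) auto
        then have "1 * ?p 0 \<xi> \<le> ennreal ((1 + \<xi>\<^sup>2) powr s) * ?p 0 \<xi>" by (intro mult_right_mono) auto
        then show "?p 0 \<xi> \<le> ennreal ((1 + \<xi>\<^sup>2) powr s) * ?p 0 \<xi>" by simp
      qed
      also note H0
      finally show ?thesis by simp
    qed
    have sm: "small_mass \<kappa> N (v t)" if "\<kappa> \<ge> \<mu>" for \<kappa> t
    proof -
      have "\<kappa> > 0" using that \<mu> by simp
      have "(2 * N)\<^sup>2 \<le> \<kappa>" using that by (simp add: \<mu>_def power_mult_distrib)
      then have "2 * N \<le> sqrt \<kappa>" by (rule real_le_rsqrt)
      then have "N / (2 * sqrt \<kappa>) \<le> 1/4" using \<open>\<kappa> > 0\<close> by (simp add: field_simps)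
      then show ?thesis unfolding small_mass_def using v_decaying \<open>\<kappa> > 0\<close> N mass by auto
    qed
    let ?e = "\<lambda>t \<kappa>. ennreal (\<kappa> powr (2 * s - 1)) * ennreal (resolvent_energy \<kappa> (v t)) * indicator {\<mu>..} \<kappa>"
    let ?I = "\<lambda>t. \<integral>\<^sup>+\<kappa>. ?e t \<kappa> \<partial>lborel"
    let ?W = "\<lambda>t. \<integral>\<^sup>+\<xi>. scale_weight s \<mu> \<xi> * ?p t \<xi> \<partial>lborel"
    have IW: "?I t = ?W t" for t by (rule energy_integral_eq[OF v_decaying \<mu>(2)])
    have W0: "?W 0 \<le> c * ennreal (N\<^sup>2)"
    proof -
      have "?W 0 \<le> (\<integral>\<^sup>+\<xi>. c * (ennreal ((1 + \<xi>\<^sup>2) powr s) * ?p 0 \<xi>) \<partial>lborel)"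
      proof (rule nn_integral_mono)
        fix \<xi> :: real
        have "\<bar>\<xi>\<bar> powr (2 * s) = (\<xi>\<^sup>2) powr s"
          using powr_powr[of "\<bar>\<xi>\<bar>" 2 s] by (cases "\<xi> = 0") (auto simp: powr_numeral)
        also have "\<dots> \<le> (1 + \<xi>\<^sup>2) powr s" using s by (intro powr_mono2) auto
        finally have "ennreal (\<bar>\<xi>\<bar> powr (2 * s)) \<le> ennreal ((1 + \<xi>\<^sup>2) powr s)" by (rule ennreal_leI)
        then have "scale_weight s \<mu> \<xi> \<le> ennreal ((1 + \<xi>\<^sup>2) powr s) * c"
          unfolding c_def by (intro order_trans[OF scale_weight_upper[OF \<mu>(2)]] mult_right_mono) auto
        then have "scale_weight s \<mu> \<xi> * ?p 0 \<xi> \<le> ennreal ((1 + \<xi>\<^sup>2) powr s) * c * ?p 0 \<xi>" by (rule mult_right_mono) simp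
        then show "scale_weight s \<mu> \<xi> * ?p 0 \<xi> \<le> c * (ennreal ((1 + \<xi>\<^sup>2) powr s) * ?p 0 \<xi>)" by (simp add: mult_ac)
      qed
      also have "\<dots> = c * (\<integral>\<^sup>+\<xi>. ennreal ((1 + \<xi>\<^sup>2) powr s) * ?p 0 \<xi> \<partial>lborel)" by (rule nn_integral_cmult) measurable
      also have "\<dots> \<le> c * ennreal (N\<^sup>2)" by (intro mult_left_mono H0) simp
      finally show ?thesis .
    qed
    have energy_measurable [measurable]: "(\<lambda>\<kappa>. ?e 0 \<kappa>) \<in> borel_measurable lborel"
    proof -
      have "(\<lambda>\<kappa>. ?e 0 \<kappa>)
        = (\<lambda>\<kappa>. ennreal (\<kappa> powr (2 * s - 1)) * (\<integral>\<^sup>+\<xi>. ennreal (\<xi>\<^sup>2 / (4 * \<kappa>\<^sup>2 + \<xi>\<^sup>2) * (norm (fourier (v 0) \<xi>))\<^sup>2) \<partial>lborel) * indicator {\<mu>..} \<kappa>)"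
      proof
        fix \<kappa> :: real
        show "?e 0 \<kappa>
          = ennreal (\<kappa> powr (2 * s - 1)) * (\<integral>\<^sup>+\<xi>. ennreal (\<xi>\<^sup>2 / (4 * \<kappa>\<^sup>2 + \<xi>\<^sup>2) * (norm (fourier (v 0) \<xi>))\<^sup>2) \<partial>lborel) * indicator {\<mu>..} \<kappa>"
          using resolvent_energy_fourier[OF v_decaying, of \<kappa> 0] \<mu> by (cases "\<mu> \<le> \<kappa>") auto
      qed
      then show ?thesis by (rule ssubst) measurable
    qed
    have "?I t \<le> (\<integral>\<^sup>+\<kappa>. 3 * ?e 0 \<kappa>
       + ennreal (2 * N ^ 6) * (ennreal (\<kappa> powr (2 * s - 3)) * indicator {\<mu>..} \<kappa>) \<partial>lborel)"
    proof (rule nn_integral_mono)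
      fix \<kappa> :: real
      show "?e t \<kappa>
        \<le> 3 * ?e 0 \<kappa>
       + ennreal (2 * N ^ 6) * (ennreal (\<kappa> powr (2 * s - 3)) * indicator {\<mu>..} \<kappa>)"
      proof (cases "\<kappa> \<ge> \<mu>")
        case True
        have pos: "\<kappa> > 0" using True \<mu> by simp
        have e0: "0 \<le> resolvent_energy \<kappa> (v t)" for t by (simp add: resolvent_energy_def)
        have "\<kappa> powr (2 * s - 1) * resolvent_energy \<kappa> (v t)
          \<le> \<kappa> powr (2 * s - 1) * (3 * resolvent_energy \<kappa> (v 0) + 2 * N ^ 6 / \<kappa>\<^sup>2)"
          by (intro mult_left_mono resolvent_energy_almost_conserved sm True) simp
        also have "\<dots> = 3 * (\<kappa> powr (2 * s - 1) * resolvent_energy \<kappa> (v 0)) + 2 * N ^ 6 * (\<kappa> powr (2 * s - 1) / \<kappa>\<^sup>2)"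
          by (simp add: algebra_simps)
        also have "\<kappa> powr (2 * s - 1) / \<kappa>\<^sup>2 = \<kappa> powr (2 * s - 3)"
          using pos powr_diff[of \<kappa> "2 * s - 1" 2] by (simp add: powr_numeral)
        finally have "ennreal (\<kappa> powr (2 * s - 1) * resolvent_energy \<kappa> (v t))
          \<le> ennreal (3 * (\<kappa> powr (2 * s - 1) * resolvent_energy \<kappa> (v 0)) + 2 * N ^ 6 * \<kappa> powr (2 * s - 3))"
          by (rule ennreal_leI)
        also have "\<dots> = ennreal (3 * (\<kappa> powr (2 * s - 1) * resolvent_energy \<kappa> (v 0))) + ennreal (2 * N ^ 6 * \<kappa> powr (2 * s - 3))"
          using e0 N by (intro ennreal_plus) auto
        finally show ?thesis using True e0 N by (simp add: ennreal_mult)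
      qed simp
    qed
    also have "\<dots> = 3 * ?I 0 + ennreal (2 * N ^ 6) * tail"
      unfolding tail_def by (subst nn_integral_add) (auto simp: nn_integral_cmult)
    finally have "?W t \<le> 3 * ?W 0 + ennreal (2 * N ^ 6) * tail" unfolding IW .
    also have "\<dots> \<le> 3 * (c * ennreal (N\<^sup>2)) + ennreal (2 * N ^ 6) * tail"
      by (intro add_right_mono mult_left_mono W0) simp
    finally have Wt: "?W t \<le> 3 * (c * ennreal (N\<^sup>2)) + ennreal (2 * N ^ 6) * tail" .
    have "ennreal ((sobolev_norm s (v t))\<^sup>2) = (\<integral>\<^sup>+\<xi>. ennreal ((1 + \<xi>\<^sup>2) powr s) * ?p t \<xi> \<partial>lborel)"
      using s by (intro v_sobolev(2)) auto
    also have "\<dots> \<le> (\<integral>\<^sup>+\<xi>. (ennreal ((1 + \<mu>\<^sup>2) powr s) + 68 * scale_weight s \<mu> \<xi>) * ?p t \<xi> \<partial>lborel)"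
      by (intro nn_integral_mono mult_right_mono sobolev_weight_le s \<mu>) auto
    also have "\<dots> = ennreal ((1 + \<mu>\<^sup>2) powr s) * (\<integral>\<^sup>+\<xi>. ?p t \<xi> \<partial>lborel) + 68 * ?W t"
      unfolding distrib_right mult.assoc by (subst nn_integral_add) (auto simp: nn_integral_cmult)
    also have "\<dots> \<le> Bd"
      unfolding Bd_def L2 using mass by (intro add_mono mult_left_mono Wt ennreal_leI) auto
    finally show ?thesis .
  qed
  show ?thesis
  proof (intro exI[of _ "enn2real Bd"] conjI allI impI)
    fix v t assume "schwartz_nls_solution v" "sobolev_norm s (v 0) \<le> N"
    from main[OF this, of t] show "(sobolev_norm s (v t))\<^sup>2 \<le> enn2real Bd"
      using Bd by (cases Bd) auto
  qed simp
qed

text \<open>At a given time the solution is within distance one, in \<open>H\<^sup>s\<close>, of a Schwartz solution whose data are also within distance one of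
\<open>u0\<close>. The uniform bound for that Schwartz solution transfers to \<open>u\<close>.\<close>

theorem theorem1p1:
  fixes s \<epsilon> :: real
  assumes "0 < s" and "s < 1" and "\<epsilon> > 0"
  shows "\<exists>C :: real \<Rightarrow> real. (\<forall>r\<ge>0. C r > 0) \<and>
    (\<forall>u0 \<in> sobolev_space s. \<forall>u. nls_global_solution s u0 u \<longrightarrow>
       (\<forall>t. sobolev_norm s (u t)
          \<le> C (sobolev_norm s u0) * (1 + \<bar>t\<bar>) powr (2 * s + \<epsilon>)))"
proof -
  \<comment> \<open>Data at distance at most one from \<open>u0\<close> have squared norm at most \<open>2 + 2 r\<^sup>2\<close>, where \<open>r\<close> is the norm of \<open>u0\<close>.\<close>
  have bounds: "\<forall>r. \<exists>B\<ge>0. \<forall>v t. schwartz_nls_solution v \<longrightarrow> sobolev_norm s (v 0) \<le> sqrt (2 + 2 * r\<^sup>2) \<longrightarrow> (sobolev_norm s (v t))\<^sup>2 \<le> B"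
    by (intro allI schwartz_solution_bound assms) simp
  from choice[OF bounds] obtain B where
    BB: "\<forall>r. 0 \<le> B r \<and> (\<forall>v t. schwartz_nls_solution v \<longrightarrow> sobolev_norm s (v 0) \<le> sqrt (2 + 2 * r\<^sup>2) \<longrightarrow> (sobolev_norm s (v t))\<^sup>2 \<le> B r)" ..
  have B0: "B r \<ge> 0" for r using BB by blast
  have B: "(sobolev_norm s (v t))\<^sup>2 \<le> B r"
    if "schwartz_nls_solution v" "sobolev_norm s (v 0) \<le> sqrt (2 + 2 * r\<^sup>2)" for r v t using BB that by blast
  show ?thesis
  proof (intro exI[of _ "\<lambda>r. sqrt (2 + 2 * B r)"] conjI ballI allI impI)
    show "0 < sqrt (2 + 2 * B r)" for r using B0[of r] by simp
    fix u0 u t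
    assume u0: "u0 \<in> sobolev_space s" and sol: "nls_global_solution s u0 u"
    have u: "u t \<in> sobolev_space s" using sol by (simp add: nls_global_solution_def continuous_sobolev_flow_def)
    obtain v where v: "\<And>n. schwartz_nls_solution (v n)"
      and v0: "(\<lambda>n. sobolev_norm s (\<lambda>x. v n 0 x - u0 x)) \<longlonglongrightarrow> 0"
      and vT: "\<And>T e. T > 0 \<Longrightarrow> e > 0 \<Longrightarrow> \<forall>\<^sub>F n in sequentially. \<forall>t\<in>{-T..T}. sobolev_norm s (\<lambda>x. v n t x - u t x) < e"
      using sol unfolding nls_global_solution_def by blast
    have "\<forall>\<^sub>F n in sequentially. sobolev_norm s (\<lambda>x. v n 0 x - u0 x) < 1 \<and> (\<forall>\<tau>\<in>{-(\<bar>t\<bar> + 1)..\<bar>t\<bar> + 1}. sobolev_norm s (\<lambda>x. v n \<tau> x - u \<tau> x) < 1)"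
      using order_tendstoD(2)[OF v0, of 1] vT[of "\<bar>t\<bar> + 1" 1] by (intro eventually_conj) auto
    then obtain n where n0: "sobolev_norm s (\<lambda>x. v n 0 x - u0 x) < 1"
      and nt: "\<forall>\<tau>\<in>{-(\<bar>t\<bar> + 1)..\<bar>t\<bar> + 1}. sobolev_norm s (\<lambda>x. v n \<tau> x - u \<tau> x) < 1"
      by (auto dest!: eventually_happens)
    have "t \<in> {-(\<bar>t\<bar> + 1)..\<bar>t\<bar> + 1}" by auto
    with nt have nt: "sobolev_norm s (\<lambda>x. v n t x - u t x) < 1" by blast
    have nonneg: "0 \<le> sobolev_norm s f" for f unfolding sobolev_norm_def by (intro real_sqrt_ge_zero integral_nonneg_AE) auto
    obtain vt vtt vx vxx where "nls_flow (v n) vt vtt vx vxx" using schwartz_nls_solution_flow[OF v] by blast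
    then interpret nls_flow "v n" vt vtt vx vxx .
    have vs: "v n \<tau> \<in> sobolev_space s" for \<tau> using assms by (intro v_sobolev(1)) auto
    have sq: "(sobolev_norm s f)\<^sup>2 \<le> 1" if "sobolev_norm s f < 1" for f
      using power_mono[OF less_imp_le[OF that] nonneg, of 2] by simp
    have "(sobolev_norm s (v n 0))\<^sup>2 \<le> 2 + 2 * (sobolev_norm s u0)\<^sup>2"
      using sobolev_norm_sq_diff(1)[OF vs[of 0] u0] sq[OF n0] by linarith
    then have "sobolev_norm s (v n 0) \<le> sqrt (2 + 2 * (sobolev_norm s u0)\<^sup>2)" by (rule real_le_rsqrt)
    then have "(sobolev_norm s (v n t))\<^sup>2 \<le> B (sobolev_norm s u0)" by (rule B[OF v])
    then have "(sobolev_norm s (u t))\<^sup>2 \<le> 2 + 2 * B (sobolev_norm s u0)"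
      using sobolev_norm_sq_diff(2)[OF vs[of t] u] sq[OF nt] by linarith
    then have le: "sobolev_norm s (u t) \<le> sqrt (2 + 2 * B (sobolev_norm s u0))" by (rule real_le_rsqrt)
    have "1 \<le> (1 + \<bar>t\<bar>) powr (2 * s + \<epsilon>)" using assms by (intro ge_one_powr_ge_zero) auto
    then have "sqrt (2 + 2 * B (sobolev_norm s u0)) * 1 \<le> sqrt (2 + 2 * B (sobolev_norm s u0)) * (1 + \<bar>t\<bar>) powr (2 * s + \<epsilon>)"
      by (rule mult_left_mono) (use B0 in simp)
    with le show "sobolev_norm s (u t) \<le> sqrt (2 + 2 * B (sobolev_norm s u0)) * (1 + \<bar>t\<bar>) powr (2 * s + \<epsilon>)" by simp
  qed
qed

end
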